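(* Let $p\ge1$ and $\phi\in\mathbf{C}_{[0,1]}$. Suppose there is a closed interval $I\subset Rg(\sqrt{\omega_\phi^p})$ on which $\left(\sqrt{\xi_\phi^p}\right)^{-1}$ is of class $C^2(I)$. Let $\{y_0,y_1,\dots,y_r\}$ be a uniform discretization of $I$ (that is, $I=[y_0,y_r]$ and $y_i=y_0+\frac{i}{r}(y_r-y_0)$). Then for all sufficiently large $n$ the following hold. 1. If $\left(\sqrt{\xi_\phi^p}\right)^{-1}$ is strictly convex on $I$, then for all $i\in\{1,\dots,r-1\}$: $$\left|\left\{k=1,\dots,N:\ y_{i-1}<\sqrt{n^{-2}\lambda_{k,h}}\le y_i\right\}\right|<\left|\left\{k=1,\dots,N:\ y_i<\sqrt{n^{-2}\lambda_{k,h}}\le y_{i+1}\right\}\right|.$$ 2. If $\left(\sqrt{\xi_\phi^p}\right)^{-1}$ is strictly concave on $I$, then for all $i\in\{1,\dots,r-1\}$: $$\left|\left\{k=1,\dots,N:\ y_{i-1}<\sqrt{n^{-2}\lambda_{k,h}}\le y_i\right\}\right|>\left|\left\{k=1,\dots,N:\ y_i<\sqrt{n^{-2}\lambda_{k,h}}\le y_{i+1}\right\}\right|.$$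
   Context: $\mathbb{N}^*=\{1,2,\dots\}$; $|A|$ is the number of elements of a finite set $A$. $\mathbf{C}_{[0,1]}$ is the set of $\phi\in C^2([0,1])$ with $\phi'>0$ on $[0,1]$, with either $\phi''>0$ on $[0,1]$ or $\phi''<0$ on $[0,1]$, and with $\phi(0)=0$, $\phi(1)=1$. B-splines: for $n,p\in\mathbb{N}^*$ take the knots $t_0=\dots=t_p=0$, $t_{p+i}=i/n$ for $1\le i\le n-1$, $t_{p+n}=\dots=t_{2p+n}=1$. Put $N_j^0=\chi_{[t_j,t_{j+1})}$ and, for $1\le q\le p$, $N_j^q(t)=\frac{t-t_j}{t_{j+q}-t_j}N_j^{q-1}(t)+\frac{t_{j+q+1}-t}{t_{j+q+1}-t_{j+1}}N_{j+1}^{q-1}(t)$, a fraction with zero denominator being taken to be $0$. The degree-$p$ B-splines are $N_0^p,\dots,N_{n+p-1}^p$. Matrices: let $N=n+p-2$ and $h=1/n$. For $\phi\in\mathbf{C}_{[0,1]}$ let $M_{\phi,n}^p,K_{\phi,n}^p$ be the $N\times N$ matrices $(M_{\phi,n}^p)_{i,j}=\int_0^1|\phi'(x)|N_i^p(x)N_j^p(x)\,dx$, $(K_{\phi,n}^p)_{i,j}=\int_0^1\frac{1}{|\phi'(x)|}(N_i^p)'(x)(N_j^p)'(x)\,dx$, $1\le i,j\le N$, and let $L_{\phi,n}^p=(M_{\phi,n}^p)^{-1}K_{\phi,n}^p$. Its eigenvalues, counted with multiplicity, are $\lambda_{1,h},\dots,\lambda_{N,h}$. Symbol: the cardinal B-splines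 are $\mathcal{N}_0=\chi_{[0,1]}$, $\mathcal{N}_q(x)=\frac{x}{q}\mathcal{N}_{q-1}(x)+\frac{q+1-x}{q}\mathcal{N}_{q-1}(x-1)$ for $q\ge1$. For $\theta\in[0,\pi]$ let $f_p(\theta)=-\mathcal{N}_{2p+1}''(p+1)-2\sum_{k=1}^p\mathcal{N}_{2p+1}''(p+1-k)\cos(k\theta)$, $g_p(\theta)=\mathcal{N}_{2p+1}(p+1)+2\sum_{k=1}^p\mathcal{N}_{2p+1}(p+1-k)\cos(k\theta)$, $e_p=f_p/g_p$. Let $\omega_\phi^p(x,\theta)=e_p(\theta)/(\phi'(x))^2$ on $[0,1]\times[0,\pi]$. $Rg(\cdot)$ denotes the range (image) of a function and $\mu_2$ the Lebesgue measure on $\mathbb{R}^2$. The monotone rearrangement $\xi_\phi^p:[0,1]\to Rg(\omega_\phi^p)$ of $\omega_\phi^p$ is the extension to $[0,1]$ by continuity of $\xi_\phi^p(x)=\inf\{y\in Rg(\omega_\phi^p):\ \mu_2(\{\omega_\phi^p\le y\})>\pi x\}$, $x\in(0,1)$. $\sqrt{\xi_\phi^p}$ is the function $x\mapsto\sqrt{\xi_\phi^p(x)}$, and $\left(\sqrt{\xi_\phi^p}\right)^{-1}:Rg(\sqrt{\omega_\phi^p})\to[0,1]$ is its inverse function.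
   Formalization: The cardinal B-spline of degree 0 is taken as the indicator of [0,1) instead of [0,1], since with [0,1] the second derivatives at integers in f_p do not exist; the interval I is assumed to have more than one point, since otherwise the strict inequalities fail. *)

theory Defs
  imports
    "HOL-Analysis.Analysis"
    "Jordan_Normal_Form.Char_Poly"
    "Jordan_Normal_Form.Gauss_Jordan_Elimination"
begin

(* Derivative relative to S: one-sided at the end points of an interval, and independent of
   the values of f outside S. *)
definition deriv_on :: "real set \<Rightarrow> (real \<Rightarrow> real) \<Rightarrow> real \<Rightarrow> real" where
  "deriv_on S f x = vector_derivative f (at x within S)"

definition C2_on :: "real set \<Rightarrow> (real \<Rightarrow> real) \<Rightarrow> bool" where
  "C2_on S f \<longleftrightarrow> f differentiable_on S \<and> deriv_on S f differentiable_on S \<and>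
     continuous_on S (deriv_on S (deriv_on S f))"

definition strictly_convex_on :: "real set \<Rightarrow> (real \<Rightarrow> real) \<Rightarrow> bool" where
  "strictly_convex_on S f \<longleftrightarrow> (\<forall>x\<in>S. \<forall>y\<in>S. \<forall>t\<in>{0<..<1}. x \<noteq> y \<longrightarrow>
     f ((1 - t) * x + t * y) < (1 - t) * f x + t * f y)"

definition strictly_concave_on :: "real set \<Rightarrow> (real \<Rightarrow> real) \<Rightarrow> bool" where
  "strictly_concave_on S f \<longleftrightarrow> (\<forall>x\<in>S. \<forall>y\<in>S. \<forall>t\<in>{0<..<1}. x \<noteq> y \<longrightarrow>
     f ((1 - t) * x + t * y) > (1 - t) * f x + t * f y)"

abbreviation dphi :: "(real \<Rightarrow> real) \<Rightarrow> real \<Rightarrow> real" where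
  "dphi \<phi> \<equiv> deriv_on {0..1} \<phi>"

definition C01 :: "(real \<Rightarrow> real) set" where
  "C01 = {\<phi>. C2_on {0..1} \<phi> \<and> (\<forall>x\<in>{0..1}. dphi \<phi> x > 0) \<and>
     ((\<forall>x\<in>{0..1}. deriv_on {0..1} (dphi \<phi>) x > 0) \<or>
      (\<forall>x\<in>{0..1}. deriv_on {0..1} (dphi \<phi>) x < 0)) \<and>
     \<phi> 0 = 0 \<and> \<phi> 1 = 1}"


definition knot :: "nat \<Rightarrow> nat \<Rightarrow> nat \<Rightarrow> real" where
  "knot n p j = (if j \<le> p then 0 else if j < p + n then real (j - p) / real n else 1)"

(* bspline n p q j is the degree-q function N_j^q on the knots belonging to n and the final
   degree p.  Fractions with zero denominator vanish because x / 0 = 0. *)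
fun bspline :: "nat \<Rightarrow> nat \<Rightarrow> nat \<Rightarrow> nat \<Rightarrow> real \<Rightarrow> real" where
  "bspline n p 0 j t = indicator {knot n p j..<knot n p (j + 1)} t"
| "bspline n p (Suc q) j t =
     (t - knot n p j) / (knot n p (j + Suc q) - knot n p j) * bspline n p q j t +
     (knot n p (j + Suc q + 1) - t) / (knot n p (j + Suc q + 1) - knot n p (j + 1)) *
       bspline n p q (j + 1) t"

(* Matrices are indexed from 0, so entry (i, j) is the one for the B-splines i + 1 and j + 1. *)
definition mass_matrix :: "nat \<Rightarrow> (real \<Rightarrow> real) \<Rightarrow> nat \<Rightarrow> real mat" where
  "mass_matrix p \<phi> n = Matrix.mat (n + p - 2) (n + p - 2) (\<lambda>(i, j).
     integral {0..1} (\<lambda>x. \<bar>dphi \<phi> x\<bar> * bspline n p p (i + 1) x * bspline n p p (j + 1) x))"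

(* For p = 1 the B-splines are not differentiable at the knots; the value of deriv at these
   finitely many points does not affect the integral. *)
definition stiffness_matrix :: "nat \<Rightarrow> (real \<Rightarrow> real) \<Rightarrow> nat \<Rightarrow> real mat" where
  "stiffness_matrix p \<phi> n = Matrix.mat (n + p - 2) (n + p - 2) (\<lambda>(i, j).
     integral {0..1} (\<lambda>x. 1 / \<bar>dphi \<phi> x\<bar> *
       deriv (bspline n p p (i + 1)) x * deriv (bspline n p p (j + 1)) x))"

definition L_matrix :: "nat \<Rightarrow> (real \<Rightarrow> real) \<Rightarrow> nat \<Rightarrow> real mat" where
  "L_matrix p \<phi> n = the (mat_inverse (mass_matrix p \<phi> n)) * stiffness_matrix p \<phi> n"

(* The eigenvalues with algebraic multiplicity.  The mass matrix is positive definite and the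
   stiffness matrix positive semidefinite, so L_matrix has only real eigenvalues and no root
   of its characteristic polynomial is missed over the reals. *)
definition eigenvalues_L :: "nat \<Rightarrow> (real \<Rightarrow> real) \<Rightarrow> nat \<Rightarrow> real multiset" where
  "eigenvalues_L p \<phi> n = proots (char_poly (L_matrix p \<phi> n))"

definition num_eigenvalues :: "nat \<Rightarrow> (real \<Rightarrow> real) \<Rightarrow> nat \<Rightarrow> real \<Rightarrow> real \<Rightarrow> nat" where
  "num_eigenvalues p \<phi> n u v =
     size {#l \<in># eigenvalues_L p \<phi> n. u < sqrt (l / (real n)\<^sup>2) \<and> sqrt (l / (real n)\<^sup>2) \<le> v#}"


(* The degree-0 function is the indicator of the half-open interval: with the closed interval
   the recursion would count the value at each interior integer twice, and the spline of
   degree 2p+1 would not even be continuous there, while the symbols below use its second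
   derivative at integers. *)
fun cardinal_bspline :: "nat \<Rightarrow> real \<Rightarrow> real" where
  "cardinal_bspline 0 x = indicator {0..<1} x"
| "cardinal_bspline (Suc q) x =
     x / real (Suc q) * cardinal_bspline q x +
     (real (Suc q) + 1 - x) / real (Suc q) * cardinal_bspline q (x - 1)"

definition f_symbol :: "nat \<Rightarrow> real \<Rightarrow> real" where
  "f_symbol p \<theta> = - deriv (deriv (cardinal_bspline (2 * p + 1))) (real p + 1) -
     2 * (\<Sum>k = 1..p. deriv (deriv (cardinal_bspline (2 * p + 1))) (real p + 1 - real k) *
       cos (real k * \<theta>))"

definition g_symbol :: "nat \<Rightarrow> real \<Rightarrow> real" where
  "g_symbol p \<theta> = cardinal_bspline (2 * p + 1) (real p + 1) +
     2 * (\<Sum>k = 1..p. cardinal_bspline (2 * p + 1) (real p + 1 - real k) * cos (real k * \<theta>))"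

definition e_symbol :: "nat \<Rightarrow> real \<Rightarrow> real" where
  "e_symbol p \<theta> = f_symbol p \<theta> / g_symbol p \<theta>"

abbreviation omega_dom :: "(real \<times> real) set" where
  "omega_dom \<equiv> {0..1} \<times> {0..pi}"

definition omega :: "nat \<Rightarrow> (real \<Rightarrow> real) \<Rightarrow> real \<times> real \<Rightarrow> real" where
  "omega p \<phi> = (\<lambda>(x, \<theta>). e_symbol p \<theta> / (dphi \<phi> x)\<^sup>2)"

definition xi_interior :: "nat \<Rightarrow> (real \<Rightarrow> real) \<Rightarrow> real \<Rightarrow> real" where
  "xi_interior p \<phi> x =
     Inf {y \<in> omega p \<phi> ` omega_dom.
       measure lebesgue {z \<in> omega_dom. omega p \<phi> z \<le> y} > pi * x}"

definition xi :: "nat \<Rightarrow> (real \<Rightarrow> real) \<Rightarrow> real \<Rightarrow> real" where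
  "xi p \<phi> x =
     (if x = 0 then Lim (at_right 0) (xi_interior p \<phi>)
      else if x = 1 then Lim (at_left 1) (xi_interior p \<phi>)
      else xi_interior p \<phi> x)"

definition sqrt_xi_inv :: "nat \<Rightarrow> (real \<Rightarrow> real) \<Rightarrow> real \<Rightarrow> real" where
  "sqrt_xi_inv p \<phi> = the_inv_into {0..1} (\<lambda>x. sqrt (xi p \<phi> x))"

end

(* The statement is a Weyl law, proved by bracketing.  An eigenvalue count of the pencil (K, M) is bounded below by
   the dimension of any space on which K - n^2 t M is definite.  Split the mesh into about sqrt n blocks of about
   sqrt n cells and use only splines supported in a single block.  Replacing phi' on a block by its maximum (minimum)
   bounds the form below (above) by a banded Toeplitz form, and on discrete sine vectors vanishing near the ends of the
   block such a form is diagonal, with the values of its symbol on a uniform grid.  So, up to o(n), the number of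
   eigenvalues above (below) n^2 t is at least n / pi times the area of the grid cells on which omega > t (omega < t).
   By Fatou's lemma these areas are asymptotically at least those of {omega > t} and {omega < t}; as the level sets of
   omega are null sets and there are n + p - 2 eigenvalues, both bounds are sharp.  Hence the number of eigenvalues in
   a cell of the discretization is n (F(y_i) - F(y_(i-1))) + o(n), where F, the inverse of the rearrangement of
   sqrt omega, is the normalized measure of {omega <= y^2}; strict convexity or concavity of F then compares
   neighbouring cells. *)
theory Submission
  imports Defs "Jordan_Normal_Form.Schur_Decomposition" "Jordan_Normal_Form.Spectral_Radius"
begin

section \<open>Symmetric pencils and linear systems\<close>

text \<open>Only dimensions of explicit test spaces are bounded, always from below; there are no
  norm estimates, no perturbation argument and no rates. An upper bound for the count above n^2 t is
  the lower bound for the count below it, subtracted from the total, which is why a sign \<sigma>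
  runs through the argument. The scale n^2 appears because interior stiffness entries have size n
  and mass entries size 1/n. Freezing leaves no error term to estimate: for t \<ge> 0 the
  coefficient phi' enters K - n^2 t M through 1 / phi' and - phi', which both decrease in phi', so
  one extremal value over a block bounds the whole form. The block length S has two duties: S / n
  must tend to 0 so that frozen values approach the true ones, and S must tend to infinity so that
  the 2p constraints per block, about 2 p n / S in all, are negligible against n. The choice sqrt n
  does both. The splines with repeated knots at 0 and 1 stay out of the test spaces; they matter
  only for the positive definiteness of M.\<close>

lemma symmetric_scalar_prod:
  fixes A :: "real mat"
  assumes A: "A \<in> carrier_mat n n" "transpose_mat A = A" and v: "v \<in> carrier_vec n" "w \<in> carrier_vec n"
  shows "scalar_prod v (A *\<^sub>v w) = scalar_prod w (A *\<^sub>v v)"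
proof -
  have "scalar_prod v (A *\<^sub>v w) = scalar_prod (transpose_mat A *\<^sub>v v) w"
    using transpose_vec_mult_scalar[OF A(1) v(2) v(1)] by simp
  also have "\<dots> = scalar_prod w (A *\<^sub>v v)"
    using A v by (simp add: comm_scalar_prod[of _ n])
  finally show ?thesis .
qed

lemma congruence_entry:
  fixes A :: "real mat"
  assumes A: "A \<in> carrier_mat n n" and P: "P \<in> carrier_mat n k" and ij: "i < k" "j < k"
  shows "(transpose_mat P * A * P) $$ (i, j) = scalar_prod (col P i) (A *\<^sub>v col P j)"
proof -
  have "transpose_mat P * A * P = transpose_mat P * (A * P)"
    by (rule assoc_mult_mat[of _ k n _ n _ k]) (use A P in auto)
  then show ?thesis using A P ij by (simp add: mult_mat_vec_def)
qed

lemma mat_vec_Re_Im: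
  fixes A :: "real mat"
  assumes A: "A \<in> carrier_mat n n" and w: "w \<in> carrier_vec n"
    and e: "map_mat complex_of_real A *\<^sub>v w = z \<cdot>\<^sub>v w"
  shows "A *\<^sub>v map_vec Re w = Re z \<cdot>\<^sub>v map_vec Re w - Im z \<cdot>\<^sub>v map_vec Im w"
    and "A *\<^sub>v map_vec Im w = Im z \<cdot>\<^sub>v map_vec Re w + Re z \<cdot>\<^sub>v map_vec Im w"
proof -
  have s: "(\<Sum>j = 0..<n. complex_of_real (A $$ (i, j)) * vec_index w j) = z * vec_index w i" if "i < n" for i
    using arg_cong[OF e, of "\<lambda>v. vec_index v i"] that A w
    by (simp add: scalar_prod_def)
  show "A *\<^sub>v map_vec Re w = Re z \<cdot>\<^sub>v map_vec Re w - Im z \<cdot>\<^sub>v map_vec Im w"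
  proof (rule eq_vecI)
    fix i assume "i < dim_vec (Re z \<cdot>\<^sub>v map_vec Re w - Im z \<cdot>\<^sub>v map_vec Im w)"
    then have i: "i < n" using w by simp
    show "vec_index (A *\<^sub>v map_vec Re w) i = vec_index (Re z \<cdot>\<^sub>v map_vec Re w - Im z \<cdot>\<^sub>v map_vec Im w) i"
      using arg_cong[OF s[OF i], of Re] A w i by (simp add: scalar_prod_def)
  qed (use A w in auto)
  show "A *\<^sub>v map_vec Im w = Im z \<cdot>\<^sub>v map_vec Re w + Re z \<cdot>\<^sub>v map_vec Im w"
  proof (rule eq_vecI)
    fix i assume "i < dim_vec (Im z \<cdot>\<^sub>v map_vec Re w + Re z \<cdot>\<^sub>v map_vec Im w)"
    then have i: "i < n" using w by simp
    show "vec_index (A *\<^sub>v map_vec Im w) i = vec_index (Im z \<cdot>\<^sub>v map_vec Re w + Re z \<cdot>\<^sub>v map_vec Im w) i"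
      using arg_cong[OF s[OF i], of Im] A w i by (simp add: scalar_prod_def algebra_simps)
  qed (use A w in auto)
qed

text \<open>Guarantees that the \<open>the\<close> in \<open>L_matrix\<close> is applied to a
  \<open>Some\<close>.\<close>

lemma posdef_inverse:
  fixes M :: "real mat"
  assumes M: "M \<in> carrier_mat n n"
    and pos: "\<And>v. v \<in> carrier_vec n \<Longrightarrow> v \<noteq> 0\<^sub>v n \<Longrightarrow> scalar_prod v (M *\<^sub>v v) > 0"
  shows "\<exists>B. mat_inverse M = Some B \<and> M * B = 1\<^sub>m n \<and> B * M = 1\<^sub>m n \<and> B \<in> carrier_mat n n"
proof -
  have "det M \<noteq> 0"
  proof
    assume "det M = 0"
    then obtain v where "v \<in> carrier_vec n" "v \<noteq> 0\<^sub>v n" "M *\<^sub>v v = 0\<^sub>v n"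
      using det_0_iff_vec_prod_zero[OF M] by auto
    with pos[of v] show False by auto
  qed
  then have "M \<in> Units (ring_mat TYPE(real) n ())"
    using det_non_zero_imp_unit[OF M] by auto
  then have "mat_inverse M \<noteq> None" using mat_inverse(1)[OF M, of "()"] by auto
  then show ?thesis using mat_inverse(2)[OF M] by auto
qed

text \<open>A complex eigenvector x + i y of M^-1 K always exists. Let b be the imaginary part of
  its eigenvalue. Comparing x . K y with y . K x, the symmetry of K and M gives b (x . M x + y . M
  y) = 0. Hence b = 0, and whichever of x and y is nonzero is a real eigenvector.\<close>

lemma pencil_eigenvector:
  fixes M K :: "real mat"
  assumes M: "M \<in> carrier_mat n n" "transpose_mat M = M" and K: "K \<in> carrier_mat n n" "transpose_mat K = K"
    and pos: "\<And>v. v \<in> carrier_vec n \<Longrightarrow> v \<noteq> 0\<^sub>v n \<Longrightarrow> scalar_prod v (M *\<^sub>v v) > 0"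
    and n: "n > 0"
  shows "\<exists>l v. v \<in> carrier_vec n \<and> K *\<^sub>v v = l \<cdot>\<^sub>v (M *\<^sub>v v) \<and> scalar_prod v (M *\<^sub>v v) = 1"
proof -
  obtain B where B: "M * B = 1\<^sub>m n" "B \<in> carrier_mat n n"
    using posdef_inverse[OF M(1) pos] by auto
  define L where "L = B * K"
  have L: "L \<in> carrier_mat n n" using B K by (auto simp: L_def)
  have BK: "M * L = K" unfolding L_def using B K M
    by (simp add: assoc_mult_mat[symmetric, of _ n n _ n _ n])
  let ?C = "map_mat complex_of_real L"
  have C: "?C \<in> carrier_mat n n" using L by auto
  obtain z where "z \<in> spectrum ?C" using spectrum_non_empty[OF C n] by auto
  then obtain w where w: "w \<in> carrier_vec n" "w \<noteq> 0\<^sub>v n" "?C *\<^sub>v w = z \<cdot>\<^sub>v w"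
    using C unfolding spectrum_def eigenvalue_def eigenvector_def by auto
  define x y where "x = map_vec Re w" and "y = map_vec Im w"
  have xy: "x \<in> carrier_vec n" "y \<in> carrier_vec n" using w by (auto simp: x_def y_def)
  define a b where "a = Re z" and "b = Im z"
  note ri = mat_vec_Re_Im[OF L w(1,3), folded x_def y_def a_def b_def]
  have Kx: "K *\<^sub>v x = a \<cdot>\<^sub>v (M *\<^sub>v x) - b \<cdot>\<^sub>v (M *\<^sub>v y)"
  proof -
    have "K *\<^sub>v x = M *\<^sub>v (L *\<^sub>v x)" using BK M L xy by (metis assoc_mult_mat_vec)
    also have "\<dots> = M *\<^sub>v (a \<cdot>\<^sub>v x) - M *\<^sub>v (b \<cdot>\<^sub>v y)"
      unfolding ri(1) by (rule mult_minus_distrib_mat_vec[OF M(1)]) (use xy in auto)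
    finally show ?thesis using mult_mat_vec[OF M(1)] xy by simp
  qed
  have Ky: "K *\<^sub>v y = b \<cdot>\<^sub>v (M *\<^sub>v x) + a \<cdot>\<^sub>v (M *\<^sub>v y)"
  proof -
    have "K *\<^sub>v y = M *\<^sub>v (L *\<^sub>v y)" using BK M L xy by (metis assoc_mult_mat_vec)
    also have "\<dots> = M *\<^sub>v (b \<cdot>\<^sub>v x) + M *\<^sub>v (a \<cdot>\<^sub>v y)"
      unfolding ri(2) by (rule mult_add_distrib_mat_vec[OF M(1)]) (use xy in auto)
    finally show ?thesis using mult_mat_vec[OF M(1)] xy by simp
  qed
  have Mxy: "M *\<^sub>v x \<in> carrier_vec n" "M *\<^sub>v y \<in> carrier_vec n" using M xy by auto
  have "scalar_prod x (K *\<^sub>v y) = b * scalar_prod x (M *\<^sub>v x) + a * scalar_prod x (M *\<^sub>v y)"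
    unfolding Ky using Mxy xy by (simp add: scalar_prod_add_distrib[of _ n])
  moreover have "scalar_prod y (K *\<^sub>v x) = a * scalar_prod y (M *\<^sub>v x) - b * scalar_prod y (M *\<^sub>v y)"
    unfolding Kx using Mxy xy by (simp add: scalar_prod_minus_distrib[of _ n])
  ultimately have b0: "b * (scalar_prod x (M *\<^sub>v x) + scalar_prod y (M *\<^sub>v y)) = 0"
    using symmetric_scalar_prod[OF K xy] symmetric_scalar_prod[OF M xy] by (simp add: algebra_simps)
  have nonz: "x \<noteq> 0\<^sub>v n \<or> y \<noteq> 0\<^sub>v n"
  proof (rule ccontr)
    assume "\<not> ?thesis"
    then have "w = 0\<^sub>v n" using w(1) unfolding x_def y_def
      by (intro eq_vecI) (auto simp: vec_eq_iff complex_eq_iff)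
    with w(2) show False by simp
  qed
  have ge: "scalar_prod v (M *\<^sub>v v) \<ge> 0" if "v \<in> carrier_vec n" for v
    using pos[of v] that M by (cases "v = 0\<^sub>v n") (auto simp: less_imp_le)
  have "scalar_prod x (M *\<^sub>v x) + scalar_prod y (M *\<^sub>v y) > 0"
    using nonz pos[of x] pos[of y] ge[of x] ge[of y] xy by (auto simp: add_pos_nonneg add_nonneg_pos)
  then have "b = 0" using b0 by auto
  then have e: "K *\<^sub>v x = a \<cdot>\<^sub>v (M *\<^sub>v x)" "K *\<^sub>v y = a \<cdot>\<^sub>v (M *\<^sub>v y)"
    unfolding Kx Ky using Mxy by (auto intro!: eq_vecI)
  obtain u where u: "u \<in> carrier_vec n" "u \<noteq> 0\<^sub>v n" "K *\<^sub>v u = a \<cdot>\<^sub>v (M *\<^sub>v u)"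
    using nonz e xy by metis
  define s where "s = scalar_prod u (M *\<^sub>v u)"
  have s: "s > 0" using pos u unfolding s_def by auto
  define v where "v = (1 / sqrt s) \<cdot>\<^sub>v u"
  have v: "v \<in> carrier_vec n" using u by (simp add: v_def)
  have "K *\<^sub>v v = a \<cdot>\<^sub>v (M *\<^sub>v v)"
    unfolding v_def using u M K by (simp add: mult_mat_vec[of _ n n] smult_smult_assoc mult.commute)
  moreover have "scalar_prod v (M *\<^sub>v v) = 1"
    unfolding v_def using u M s by (simp add: mult_mat_vec[of _ n n] s_def[symmetric] real_div_sqrt)
  ultimately show ?thesis using v by blast
qed

text \<open>Gram-Schmidt, applied to a basis that starts with u, keeps u as its first vector.
  Dropping that column leaves R, whose columns parametrize the hyperplane orthogonal to u.\<close>

lemma orthogonal_complement_matrix: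
  fixes u :: "real vec"
  assumes u: "u \<in> carrier_vec (Suc n)" "u \<noteq> 0\<^sub>v (Suc n)"
  shows "\<exists>R \<in> carrier_mat (Suc n) n. (\<forall>j<n. scalar_prod u (col R j) = 0) \<and>
     (\<forall>c \<in> carrier_vec n. R *\<^sub>v c = 0\<^sub>v (Suc n) \<longrightarrow> c = 0\<^sub>v n)"
proof -
  interpret cof_vec_space "Suc n" "TYPE(real)" .
  note bc = basis_completion[OF u]
  define ws where "ws = gram_schmidt (Suc n) (basis_completion u)"
  have ws: "corthogonal ws" "set ws \<subseteq> carrier_vec (Suc n)" "length ws = Suc n"
    using gram_schmidt_result[OF bc(2,4,5) ws_def] bc by auto
  have hd: "hd ws = u"
  proof -
    have "basis_completion u \<noteq> []" using bc(6) by auto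
    then obtain vs where "basis_completion u = u # vs" using bc(7) by (cases "basis_completion u") auto
    then show ?thesis unfolding ws_def using u(1) by simp
  qed
  define W where "W = mat_of_cols (Suc n) ws"
  have W: "W \<in> carrier_mat (Suc n) (Suc n)" using ws unfolding W_def by auto
  have oW: "corthogonal_mat W" unfolding W_def by (rule orthogonal_mat_of_cols) (use ws in auto)
  have inv: "inverts_mat (corthogonal_inv W) W" by (rule corthogonal_inv_result[OF oW])
  have iW: "corthogonal_inv W \<in> carrier_mat (Suc n) (Suc n)"
    using W by (auto simp: corthogonal_inv_def mat_of_rows_def)
  have col0: "col W 0 = u"
    unfolding W_def using ws hd by (cases ws) auto
  define R where "R = Matrix.mat (Suc n) n (\<lambda>(i, j). W $$ (i, Suc j))"
  have R: "R \<in> carrier_mat (Suc n) n" by (simp add: R_def)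
  have "col R j = col W (Suc j)" if "j < n" for j
    using that W by (intro eq_vecI) (auto simp: R_def)
  then have o: "scalar_prod u (col R j) = 0" if "j < n" for j
    using corthogonal_matD[OF oW, of 0 "Suc j"] that W col0 by simp
  have "c = 0\<^sub>v n" if c: "c \<in> carrier_vec n" "R *\<^sub>v c = 0\<^sub>v (Suc n)" for c
  proof -
    \<comment> \<open>Padding c with a zero in front turns R c into W d, to which the inverse of W
      applies.\<close>
    define d where "d = Matrix.vec (Suc n) (\<lambda>i. if i = 0 then 0 else vec_index c (i - 1))"
    have d: "d \<in> carrier_vec (Suc n)" by (simp add: d_def)
    have "W *\<^sub>v d = R *\<^sub>v c"
    proof (rule eq_vecI)
      fix i assume "i < dim_vec (R *\<^sub>v c)"
      then have i: "i < Suc n" using R by simp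
      have "(\<Sum>j = 0..<Suc n. W $$ (i, j) * vec_index d j) = (\<Sum>j = 0..<n. R $$ (i, j) * vec_index c j)"
        using i by (subst sum.atLeast0_lessThan_Suc_shift) (simp add: d_def R_def)
      then show "vec_index (W *\<^sub>v d) i = vec_index (R *\<^sub>v c) i"
        using i W R c(1) d by (simp add: scalar_prod_def del: sum.op_ivl_Suc)
    qed (use W R in auto)
    then have "W *\<^sub>v d = 0\<^sub>v (Suc n)" using c by simp
    then have "corthogonal_inv W *\<^sub>v (W *\<^sub>v d) = 0\<^sub>v (Suc n)" using iW by (auto intro!: eq_vecI)
    moreover have "corthogonal_inv W *\<^sub>v (W *\<^sub>v d) = (corthogonal_inv W * W) *\<^sub>v d"
      using iW W d by simp
    moreover have "corthogonal_inv W * W = 1\<^sub>m (Suc n)" using inv iW W by (simp add: inverts_mat_def)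
    ultimately have d0: "d = 0\<^sub>v (Suc n)" using d by simp
    show ?thesis
    proof (rule eq_vecI)
      fix i assume "i < dim_vec (0\<^sub>v n :: real vec)"
      then show "vec_index c i = vec_index (0\<^sub>v n) i"
        using arg_cong[OF d0, of "\<lambda>v. vec_index v (Suc i)"] by (simp add: d_def)
    qed (use c in auto)
  qed
  then show ?thesis using R o by blast
qed

text \<open>Deflation: the vectors that are M-orthogonal to an eigenvector v are also K-orthogonal
  to it, because K v is a multiple of M v. Compressing both forms to this hyperplane keeps symmetry
  and definiteness, so the induction hypothesis applies there.\<close>

lemma pencil_diagonalization:
  fixes M K :: "real mat"
  assumes "M \<in> carrier_mat n n" "transpose_mat M = M" "K \<in> carrier_mat n n" "transpose_mat K = K"
    and "\<And>v. v \<in> carrier_vec n \<Longrightarrow> v \<noteq> 0\<^sub>v n \<Longrightarrow> scalar_prod v (M *\<^sub>v v) > 0"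
  shows "\<exists>P d. P \<in> carrier_mat n n \<and> transpose_mat P * M * P = 1\<^sub>m n \<and>
    transpose_mat P * K * P = Matrix.mat n n (\<lambda>(i, j). if i = j then d i else 0)"
  using assms
proof (induction n arbitrary: M K)
  case 0
  then show ?case by (intro exI[of _ "1\<^sub>m 0"] exI[of _ "\<lambda>_. 0"]) (auto intro!: eq_matI)
next
  case (Suc n)
  note M = Suc.prems(1,2) and K = Suc.prems(3,4) and pos = Suc.prems(5)
  obtain l v where v: "v \<in> carrier_vec (Suc n)" "K *\<^sub>v v = l \<cdot>\<^sub>v (M *\<^sub>v v)" "scalar_prod v (M *\<^sub>v v) = 1"
    using pencil_eigenvector[OF M K pos] by auto
  \<comment> \<open>Plain orthogonality to M v is M-orthogonality to v.\<close>
  define u where "u = M *\<^sub>v v"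
  have u: "u \<in> carrier_vec (Suc n)" using M v by (simp add: u_def)
  have u0: "u \<noteq> 0\<^sub>v (Suc n)" using v u_def by auto
  obtain R where R: "R \<in> carrier_mat (Suc n) n"
    and Ro: "\<And>j. j < n \<Longrightarrow> scalar_prod u (col R j) = 0"
    and Ri: "\<And>c. c \<in> carrier_vec n \<Longrightarrow> R *\<^sub>v c = 0\<^sub>v (Suc n) \<Longrightarrow> c = 0\<^sub>v n"
    using orthogonal_complement_matrix[OF u u0] by blast
  define M' K' where "M' = transpose_mat R * M * R" and "K' = transpose_mat R * K * R"
  have carr: "M' \<in> carrier_mat n n" "K' \<in> carrier_mat n n" using M K R by (auto simp: M'_def K'_def)
  have colR: "col R j \<in> carrier_vec (Suc n)" for j using R col_dim[of R j] by simp
  have sym: "transpose_mat M' = M'" "transpose_mat K' = K'"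
  proof -
    show "transpose_mat M' = M'"
    proof (rule eq_matI)
      fix i j assume "i < dim_row M'" "j < dim_col M'"
      then have ij: "i < n" "j < n" using carr by auto
      then have "transpose_mat M' $$ (i, j) = M' $$ (j, i)" using carr by simp
      also have "\<dots> = M' $$ (i, j)" unfolding M'_def
        using ij symmetric_scalar_prod[OF M colR[of i] colR[of j]]
        by (simp add: congruence_entry[OF M(1) R])
      finally show "transpose_mat M' $$ (i, j) = M' $$ (i, j)" .
    qed (use carr in auto)
    show "transpose_mat K' = K'"
    proof (rule eq_matI)
      fix i j assume "i < dim_row K'" "j < dim_col K'"
      then have ij: "i < n" "j < n" using carr by auto
      then have "transpose_mat K' $$ (i, j) = K' $$ (j, i)" using carr by simp
      also have "\<dots> = K' $$ (i, j)" unfolding K'_def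
        using ij symmetric_scalar_prod[OF K colR[of i] colR[of j]]
        by (simp add: congruence_entry[OF K(1) R])
      finally show "transpose_mat K' $$ (i, j) = K' $$ (i, j)" .
    qed (use carr in auto)
  qed
  have qf: "scalar_prod c (transpose_mat R * A * R *\<^sub>v e) = scalar_prod (R *\<^sub>v c) (A *\<^sub>v (R *\<^sub>v e))"
    if "A \<in> carrier_mat (Suc n) (Suc n)" "c \<in> carrier_vec n" "e \<in> carrier_vec n" for A c e
  proof -
    have "transpose_mat R * A * R *\<^sub>v e = transpose_mat R *\<^sub>v (A *\<^sub>v (R *\<^sub>v e))"
    proof -
      have c: "transpose_mat R \<in> carrier_mat n (Suc n)" "transpose_mat R * A \<in> carrier_mat n (Suc n)"
        "R *\<^sub>v e \<in> carrier_vec (Suc n)" using that R by auto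
      show ?thesis
        unfolding assoc_mult_mat_vec[OF c(2) R that(3)] assoc_mult_mat_vec[OF c(1) that(1) c(3)] ..
    qed
    then show ?thesis
      using that R transpose_vec_mult_scalar[of "transpose_mat R" n "Suc n" "A *\<^sub>v (R *\<^sub>v e)" c]
      by simp
  qed
  have pos': "scalar_prod c (M' *\<^sub>v c) > 0" if "c \<in> carrier_vec n" "c \<noteq> 0\<^sub>v n" for c
    unfolding M'_def qf[OF M(1) that(1) that(1)]
    by (rule pos) (use that R Ri in auto)
  obtain P' d' where P': "P' \<in> carrier_mat n n" "transpose_mat P' * M' * P' = 1\<^sub>m n"
    "transpose_mat P' * K' * P' = Matrix.mat n n (\<lambda>(i, j). if i = j then d' i else 0)"
    using Suc.IH[OF carr(1) sym(1) carr(2) sym(2) pos'] by blast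
  define P where "P = Matrix.mat (Suc n) (Suc n) (\<lambda>(i, j). if j = 0 then vec_index v i else (R * P') $$ (i, j - 1))"
  have P: "P \<in> carrier_mat (Suc n) (Suc n)" by (simp add: P_def)
  have colP0: "col P 0 = v" using v by (intro eq_vecI) (auto simp: P_def)
  have colP': "col P' j \<in> carrier_vec n" for j using P' col_dim[of P' j] by simp
  have colP: "col P (Suc j) = R *\<^sub>v col P' j" if "j < n" for j
    using that R P' by (intro eq_vecI) (auto simp: P_def)
  have uR: "scalar_prod u (R *\<^sub>v c) = 0" if "c \<in> carrier_vec n" for c
  proof -
    have "transpose_mat R *\<^sub>v u = 0\<^sub>v n"
    proof (rule eq_vecI)
      fix j assume "j < dim_vec (0\<^sub>v n :: real vec)"
      then show "vec_index (transpose_mat R *\<^sub>v u) j = vec_index (0\<^sub>v n) j"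
        using Ro[of j] R u comm_scalar_prod[OF colR u] by simp
    qed (use R in auto)
    then show ?thesis using transpose_vec_mult_scalar[OF R that u] that by simp
  qed
  have entry: "(transpose_mat P * A * P) $$ (i, j) =
     (if i = 0 then if j = 0 then scalar_prod v (A *\<^sub>v v) else scalar_prod v (A *\<^sub>v (R *\<^sub>v col P' (j - 1)))
      else if j = 0 then scalar_prod v (A *\<^sub>v (R *\<^sub>v col P' (i - 1)))
      else (transpose_mat P' * (transpose_mat R * A * R) * P') $$ (i - 1, j - 1))"
    if A: "A \<in> carrier_mat (Suc n) (Suc n)" "transpose_mat A = A" and ij: "i < Suc n" "j < Suc n" for A i j
  proof -
    have RP: "R *\<^sub>v col P' k \<in> carrier_vec (Suc n)" for k using R P' by auto
    have "(transpose_mat P * A * P) $$ (i, j) = scalar_prod (col P i) (A *\<^sub>v col P j)"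
      by (rule congruence_entry[OF A(1) P ij])
    then show ?thesis
      using ij colP0 colP symmetric_scalar_prod[OF A RP v(1)] qf[OF A(1) colP' colP']
        congruence_entry[of "transpose_mat R * A * R" n P' n "i - 1" "j - 1"] A R P'
      by (cases i; cases j) auto
  qed
  have vM: "scalar_prod v (M *\<^sub>v (R *\<^sub>v c)) = 0" if "c \<in> carrier_vec n" for c
    using symmetric_scalar_prod[OF M v(1), of "R *\<^sub>v c"] that R uR[OF that] u
    by (simp add: u_def comm_scalar_prod[of _ "Suc n"])
  have vK: "scalar_prod v (K *\<^sub>v (R *\<^sub>v c)) = 0" if "c \<in> carrier_vec n" for c
  proof -
    have "scalar_prod v (K *\<^sub>v (R *\<^sub>v c)) = scalar_prod (R *\<^sub>v c) (l \<cdot>\<^sub>v u)"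
      using symmetric_scalar_prod[OF K v(1), of "R *\<^sub>v c"] that R v(2) by (simp add: u_def)
    also have "\<dots> = l * scalar_prod u (R *\<^sub>v c)"
      using that R u by (simp add: comm_scalar_prod[of _ "Suc n"])
    finally show ?thesis using uR[OF that] by simp
  qed
  have vKv: "scalar_prod v (K *\<^sub>v v) = l" using v M by simp
  define d where "d i = (if i = 0 then l else d' (i - 1))" for i :: nat
  have "transpose_mat P * M * P = 1\<^sub>m (Suc n)"
  proof (rule eq_matI)
    fix i j assume "i < dim_row (1\<^sub>m (Suc n) :: real mat)" "j < dim_col (1\<^sub>m (Suc n) :: real mat)"
    then have ij: "i < Suc n" "j < Suc n" by auto
    show "(transpose_mat P * M * P) $$ (i, j) = 1\<^sub>m (Suc n) $$ (i, j)"
      unfolding entry[OF M ij] M'_def[symmetric] P'(2) using ij v(3) vM[OF colP'] by auto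
  qed (use P in auto)
  moreover have "transpose_mat P * K * P = Matrix.mat (Suc n) (Suc n) (\<lambda>(i, j). if i = j then d i else 0)"
  proof (rule eq_matI)
    fix i j assume "i < dim_row (Matrix.mat (Suc n) (Suc n) (\<lambda>(i, j). if i = j then d i else 0))"
      "j < dim_col (Matrix.mat (Suc n) (Suc n) (\<lambda>(i, j). if i = j then d i else 0))"
    then have ij: "i < Suc n" "j < Suc n" by auto
    show "(transpose_mat P * K * P) $$ (i, j) = Matrix.mat (Suc n) (Suc n) (\<lambda>(i, j). if i = j then d i else 0) $$ (i, j)"
      unfolding entry[OF K ij] K'_def[symmetric] P'(3) using ij vKv vK[OF colP'] by (auto simp: d_def)
  qed (use P in auto)
  ultimately show ?case using P by blast
qed

section \<open>Eigenvalues of a diagonalized pencil, with multiplicity\<close>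

lemma proots_linear_factors:
  fixes xs :: "real list"
  shows "proots (\<Prod>a\<leftarrow>xs. [:- a, 1:]) = mset xs"
proof (induction xs)
  case (Cons a xs)
  have "(\<Prod>a\<leftarrow>xs. [:- a, 1:]) \<noteq> 0" by (auto simp: prod_list_zero_iff)
  then have "proots ([:- a, 1:] * (\<Prod>a\<leftarrow>xs. [:- a, 1:])) = proots [:- a, 1:] + proots (\<Prod>a\<leftarrow>xs. [:- a, 1:])"
    by (intro proots_mult) auto
  then show ?case using Cons by simp
qed simp

lemma proots_char_poly_diag:
  "proots (char_poly (Matrix.mat n n (\<lambda>(i, j). if i = j then d i else (0::real)))) = image_mset d (mset_set {..<n})"
proof -
  let ?D = "Matrix.mat n n (\<lambda>(i, j). if i = j then d i else (0::real))"
  have "char_poly ?D = (\<Prod>a\<leftarrow>diag_mat ?D. [:- a, 1:])"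
    by (rule char_poly_upper_triangular[of _ n]) auto
  also have "diag_mat ?D = map d [0..<n]" by (auto simp: diag_mat_def)
  also have "proots (\<Prod>a\<leftarrow>map d [0..<n]. [:- a, 1:]) = mset (map d [0..<n])"
    by (rule proots_linear_factors)
  also have "\<dots> = image_mset d (mset_set {..<n})"
    by (simp add: atLeast0LessThan[symmetric])
  finally show ?thesis .
qed

lemma quadratic_form_sum:
  fixes A :: "real mat"
  assumes "A \<in> carrier_mat n n"
  shows "scalar_prod (Matrix.vec n w) (A *\<^sub>v Matrix.vec n w) = (\<Sum>i<n. \<Sum>j<n. A $$ (i, j) * w i * w j)"
  using assms by (simp add: scalar_prod_def atLeast0LessThan sum_distrib_left mult_ac)

text \<open>Under the normalization P^T M P = 1 the inverse of P is Q = P^T M, hence M = Q^T Q, K =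
  Q^T D Q and M^-1 K = P D Q. One family of linear forms, the rows q of Q, therefore diagonalizes K
  - t M for every t at once, with the eigenvalues d as coefficients.\<close>

lemma pencil_spectral_decomposition:
  fixes M K :: "real mat"
  assumes M: "M \<in> carrier_mat n n" "transpose_mat M = M" and K: "K \<in> carrier_mat n n" "transpose_mat K = K"
    and pos: "\<And>w. (\<exists>i<n. w i \<noteq> 0) \<Longrightarrow> (\<Sum>i<n. \<Sum>j<n. M $$ (i, j) * w i * w j) > 0"
  obtains d :: "nat \<Rightarrow> real" and q :: "nat \<Rightarrow> nat \<Rightarrow> real"
  where "proots (char_poly (the (mat_inverse M) * K)) = image_mset d (mset_set {..<n})"
    and "\<And>t w. (\<Sum>i<n. \<Sum>j<n. (K $$ (i, j) - t * M $$ (i, j)) * w i * w j) =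
      (\<Sum>i<n. (d i - t) * (\<Sum>j<n. q i j * w j)\<^sup>2)"
proof -
  have pos': "scalar_prod v (M *\<^sub>v v) > 0" if v: "v \<in> carrier_vec n" "v \<noteq> 0\<^sub>v n" for v
  proof -
    have e: "Matrix.vec n (vec_index v) = v" using v by auto
    have "\<exists>i<n. vec_index v i \<noteq> 0"
      using v by (metis carrier_vecD eq_vecI index_zero_vec(1) index_zero_vec(2))
    then show ?thesis using quadratic_form_sum[OF M(1), of "vec_index v"] pos[of "vec_index v"] e by simp
  qed
  obtain P d where P: "P \<in> carrier_mat n n" "transpose_mat P * M * P = 1\<^sub>m n"
    "transpose_mat P * K * P = Matrix.mat n n (\<lambda>(i, j). if i = j then d i else 0)"
    using pencil_diagonalization[OF M K pos'] by blast
  define D where "D = Matrix.mat n n (\<lambda>(i, j). if i = j then d i else (0::real))"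
  have D: "D \<in> carrier_mat n n" by (simp add: D_def)
  define Q where "Q = transpose_mat P * M"
  have Q: "Q \<in> carrier_mat n n" using P M by (auto simp: Q_def)
  have QP: "Q * P = 1\<^sub>m n" using P(2) by (simp add: Q_def)
  then have PQ: "P * Q = 1\<^sub>m n" using mat_mult_left_right_inverse[OF Q P(1)] by simp
  have "transpose_mat Q * transpose_mat P = transpose_mat (P * Q)"
    by (rule transpose_mult[OF P(1) Q, symmetric])
  then have tQP: "transpose_mat Q * transpose_mat P = 1\<^sub>m n" by (simp add: PQ)
  have tc: "transpose_mat P \<in> carrier_mat n n" "transpose_mat Q \<in> carrier_mat n n" using P Q by auto
  have expand: "A = transpose_mat Q * (transpose_mat P * A * P) * Q" if A: "A \<in> carrier_mat n n" for A
  proof -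
    have "transpose_mat Q * (transpose_mat P * A * P) * Q = (transpose_mat Q * transpose_mat P) * A * (P * Q)"
      using tc A P(1) Q by (simp add: assoc_mult_mat[of _ n n _ n _ n])
    then show ?thesis using tQP PQ A by simp
  qed
  have MQ: "M = transpose_mat Q * Q" using expand[OF M(1)] P(2) tc by simp
  have KQ: "K = transpose_mat Q * D * Q" using expand[OF K(1)] P(3) by (simp add: D_def)
  obtain B where B: "mat_inverse M = Some B" "B * M = 1\<^sub>m n" "B \<in> carrier_mat n n"
    using posdef_inverse[OF M(1) pos'] by auto
  have "M * (P * D * Q) = transpose_mat Q * (Q * P) * D * Q"
    unfolding MQ using tc P(1) Q D by (simp add: assoc_mult_mat[of _ n n _ n _ n])
  also have "\<dots> = K" unfolding QP KQ using tc by simp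
  finally have "B * K = B * (M * (P * D * Q))" by simp
  also have "\<dots> = (B * M) * (P * D * Q)"
    by (rule assoc_mult_mat[symmetric, of _ n n _ n _ n]) (use B M P(1) D Q in auto)
  also have "\<dots> = P * D * Q" unfolding B(2) using P(1) D Q by (intro left_mult_one_mat[of _ n n]) auto
  finally have BK: "B * K = P * D * Q" .
  have "similar_mat (B * K) D"
    unfolding similar_mat_def similar_mat_wit_def Let_def BK
    using P(1) Q D PQ QP by (intro exI[of _ P] exI[of _ Q]) auto
  then have c: "char_poly (B * K) = char_poly D" by (rule char_poly_similar)
  have "proots (char_poly (the (mat_inverse M) * K)) = image_mset d (mset_set {..<n})"
    using c proots_char_poly_diag[of n d] B by (simp add: D_def)
  moreover have "(\<Sum>i<n. \<Sum>j<n. (K $$ (i, j) - t * M $$ (i, j)) * w i * w j) =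
      (\<Sum>i<n. (d i - t) * (\<Sum>j<n. Q $$ (i, j) * w j)\<^sup>2)" for t w
  proof -
    let ?v = "Matrix.vec n w"
    let ?z = "Q *\<^sub>v ?v"
    have v: "?v \<in> carrier_vec n" by simp
    have z: "?z \<in> carrier_vec n" using Q by auto
    have zi: "vec_index ?z i = (\<Sum>j<n. Q $$ (i, j) * w j)" if "i < n" for i
      using that Q by (simp add: scalar_prod_def atLeast0LessThan)
    have tr: "scalar_prod ?v (transpose_mat Q *\<^sub>v x) = scalar_prod ?z x" if "x \<in> carrier_vec n" for x
      using transpose_vec_mult_scalar[OF tc(2) that v] by simp
    have "scalar_prod ?v (M *\<^sub>v ?v) = scalar_prod ?z ?z"
      using tr[OF z] tc Q v by (subst MQ) (simp add: assoc_mult_mat_vec[of _ n n _ n])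
    then have m: "(\<Sum>i<n. \<Sum>j<n. M $$ (i, j) * w i * w j) = (\<Sum>i<n. (\<Sum>j<n. Q $$ (i, j) * w j)\<^sup>2)"
      using quadratic_form_sum[OF M(1), of w] zi Q
      by (simp add: scalar_prod_def atLeast0LessThan power2_eq_square)
    have "scalar_prod ?v (K *\<^sub>v ?v) = scalar_prod ?z (D *\<^sub>v ?z)"
      using tr[of "D *\<^sub>v ?z"] D z tc Q v
      by (subst KQ) (simp add: assoc_mult_mat_vec[of _ n n _ n] assoc_mult_mat[of _ n n _ n _ n])
    moreover have "vec_index (D *\<^sub>v x) i = d i * vec_index x i" if "i < n" "x \<in> carrier_vec n" for i x
    proof -
      have "vec_index (D *\<^sub>v x) i = (\<Sum>j<n. (if i = j then d i else 0) * vec_index x j)"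
        using that D by (simp add: scalar_prod_def atLeast0LessThan D_def)
      also have "\<dots> = (\<Sum>j<n. if i = j then d i * vec_index x j else 0)"
        by (rule sum.cong) auto
      finally show ?thesis using that by simp
    qed
    note this[OF _ z]
    ultimately have k: "(\<Sum>i<n. \<Sum>j<n. K $$ (i, j) * w i * w j) = (\<Sum>i<n. d i * (\<Sum>j<n. Q $$ (i, j) * w j)\<^sup>2)"
      using quadratic_form_sum[OF K(1), of w] zi Q D
      by (simp add: scalar_prod_def[of ?z "D *\<^sub>v ?z"] atLeast0LessThan power2_eq_square mult_ac)
    show ?thesis using m k
      by (simp add: left_diff_distrib sum_subtractf mult.assoc flip: sum_distrib_left)
  qed
  ultimately show ?thesis by (rule that[of d "\<lambda>i j. Q $$ (i, j)"])
qed

text \<open>Elimination of one unknown by one equation. The index sets are arbitrary because the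
  later use has pairs as unknowns and a disjoint sum of two index sets as equations.\<close>

lemma homogeneous_system_nontrivial_solution:
  fixes c :: "'e \<Rightarrow> 'a \<Rightarrow> real"
  assumes "finite E" "finite A" "card E < card A"
  shows "\<exists>x. (\<exists>a\<in>A. x a \<noteq> 0) \<and> (\<forall>e\<in>E. (\<Sum>a\<in>A. c e a * x a) = 0)"
  using assms
proof (induction E arbitrary: A c rule: finite_induct)
  case empty
  then have "A \<noteq> {}" by auto
  then show ?case by (intro exI[of _ "\<lambda>_. 1"]) auto
next
  case (insert e E)
  show ?case
  proof (cases "\<forall>a\<in>A. c e a = 0")
    case True
    then show ?thesis using insert.IH[OF insert.prems(1), of c] insert.prems(2) insert.hyps by auto
  next
    case False
    then obtain b where b: "b \<in> A" "c e b \<noteq> 0" by auto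
    define A' where "A' = A - {b}"
    have A': "finite A'" "card E < card A'" "b \<notin> A'" "A = insert b A'"
      using insert.prems insert.hyps b by (auto simp: A'_def card_Diff_singleton)
    \<comment> \<open>Coefficients after solving equation e for the unknown b and substituting into
      the others.\<close>
    define c' where "c' f a = c f a - c f b * c e a / c e b" for f a
    obtain x where x: "\<exists>a\<in>A'. x a \<noteq> 0" "\<forall>f\<in>E. (\<Sum>a\<in>A'. c' f a * x a) = 0"
      using insert.IH[OF A'(1,2), of c'] by auto
    define s where "s = (\<Sum>a\<in>A'. c e a * x a)"
    define y where "y = x(b := - s / c e b)"
    have ysum: "(\<Sum>a\<in>A. c f a * y a) = (\<Sum>a\<in>A'. c f a * x a) - c f b * s / c e b" for f
    proof -
      have "(\<Sum>a\<in>A'. c f a * y a) = (\<Sum>a\<in>A'. c f a * x a)"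
        by (rule sum.cong) (use A' in \<open>auto simp: y_def\<close>)
      then show ?thesis using A' by (simp add: y_def)
    qed
    have "(\<Sum>a\<in>A. c f a * y a) = 0" if "f \<in> insert e E" for f
    proof (cases "f = e")
      case True
      then show ?thesis using ysum[of e] b by (simp add: s_def)
    next
      case False
      then have "(\<Sum>a\<in>A'. c' f a * x a) = 0" using x that by auto
      moreover have "(\<Sum>a\<in>A'. c' f a * x a) = (\<Sum>a\<in>A'. c f a * x a) - c f b * s / c e b"
        unfolding c'_def s_def left_diff_distrib sum_subtractf sum_distrib_left sum_divide_distrib
        by (simp add: mult.assoc)
      ultimately show ?thesis using ysum by simp
    qed
    moreover have "\<exists>a\<in>A. y a \<noteq> 0" using x(1) A' by (auto simp: y_def)
    ultimately show ?thesis by blast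
  qed
qed

section \<open>Cardinal B-splines\<close>

declare cardinal_bspline.simps(2) [simp del]

lemma cardinal_bspline_eq_0: "x < 0 \<or> x \<ge> real q + 1 \<Longrightarrow> cardinal_bspline q x = 0"
proof (induction q arbitrary: x)
  case (Suc q)
  then show ?case using Suc.IH[of x] Suc.IH[of "x - 1"] by (auto simp: cardinal_bspline.simps(2))
qed auto

lemma cardinal_bspline_Suc_at_0 [simp]: "cardinal_bspline (Suc q) 0 = 0"
  by (simp add: cardinal_bspline.simps(2) cardinal_bspline_eq_0)

lemma cardinal_bspline_Suc_eq_0: "x \<le> 0 \<or> x \<ge> real (Suc q) + 1 \<Longrightarrow> cardinal_bspline (Suc q) x = 0"
  using cardinal_bspline_eq_0[of x "Suc q"] cardinal_bspline_Suc_at_0[of q]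
  by (cases "x = 0") (auto)

lemma cardinal_bspline_1: "cardinal_bspline (Suc 0) x = max 0 (min x (2 - x))"
  by (auto simp: cardinal_bspline.simps(2) indicator_def max_def min_def)

lemma cardinal_bspline_pos: "0 < x \<Longrightarrow> x < real q + 1 \<Longrightarrow> cardinal_bspline q x > 0"
proof (induction q arbitrary: x)
  case (Suc q)
  show ?case
  proof (cases q)
    \<comment> \<open>Degree 1 is treated apart: at x = 1 neither 1 nor 0 lies in the open interval
      on which the induction hypothesis for degree 0 speaks.\<close>
    case 0
    then show ?thesis using Suc.prems cardinal_bspline_1[of x] by simp
  next
    case (Suc q')
    have nonneg: "cardinal_bspline q y \<ge> 0" for y
      using Suc.IH[of y] cardinal_bspline_Suc_eq_0[of y q'] Suc
      by (cases "0 < y \<and> y < real q + 1") (auto)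
    show ?thesis
    proof (cases "x < real q + 1")
      case True
      then show ?thesis using Suc.prems Suc.IH[of x] nonneg[of "x - 1"]
        by (simp add: cardinal_bspline.simps(2) add_pos_nonneg)
    next
      case False
      then have "cardinal_bspline q (x - 1) > 0" using Suc.prems Suc by (intro Suc.IH) auto
      then show ?thesis using Suc.prems nonneg[of x] by (simp add: cardinal_bspline.simps(2) add_nonneg_pos)
    qed
  qed
qed simp

lemma cardinal_bspline_nonneg: "cardinal_bspline q x \<ge> 0"
proof (cases "0 < x \<and> x < real q + 1")
  case False
  then show ?thesis
  proof (cases q)
    case (Suc q')
    then show ?thesis using False cardinal_bspline_Suc_eq_0[of x q'] by auto
  qed simp
qed (use cardinal_bspline_pos[of x q] in auto)

lemma borel_measurable_cardinal_bspline [measurable]: "cardinal_bspline q \<in> borel_measurable borel"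
proof (induction q)
  case 0
  have "cardinal_bspline 0 = indicator {0..<1}" by auto
  then show ?case by simp
next
  case (Suc q)
  note [measurable] = Suc
  have "cardinal_bspline (Suc q) = (\<lambda>x. x / real (Suc q) * cardinal_bspline q x +
     (real (Suc q) + 1 - x) / real (Suc q) * cardinal_bspline q (x - 1))"
    by (rule ext) (simp add: cardinal_bspline.simps(2))
  then show ?case by simp
qed

lemma continuous_on_cardinal_bspline: "continuous_on A (cardinal_bspline (Suc q))"
proof -
  have "continuous_on UNIV (cardinal_bspline (Suc q))"
  proof (induction q)
    case 0
    have "cardinal_bspline (Suc 0) = (\<lambda>x. max 0 (min x (2 - x)))" using cardinal_bspline_1 by auto
    then show ?case by (simp add: continuous_intros)
  next
    case (Suc q)
    have "cardinal_bspline (Suc (Suc q)) = (\<lambda>x. x / real (Suc (Suc q)) * cardinal_bspline (Suc q) x +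
       (real (Suc (Suc q)) + 1 - x) / real (Suc (Suc q)) * cardinal_bspline (Suc q) (x - 1))"
      by (rule ext) (simp add: cardinal_bspline.simps(2))
    moreover have "continuous_on UNIV (\<lambda>x. cardinal_bspline (Suc q) (x - 1))"
      by (rule continuous_on_compose2[OF Suc]) (auto intro!: continuous_intros)
    ultimately show ?case using Suc by (simp add: continuous_intros)
  qed
  then show ?thesis by (rule continuous_on_subset) simp
qed

lemma shifted_cardinal_bspline_has_derivative:
  assumes "(cardinal_bspline q has_real_derivative D) (at (x - a))"
  shows "((\<lambda>z. cardinal_bspline q (z - a)) has_real_derivative D) (at x)"
  using assms DERIV_shift[of "cardinal_bspline q" D x "- a"] by simp

text \<open>Degree 1 has corners at integers, but elsewhere the recursion can be differentiated term
  by term. What the product rule leaves is a multiple of the claimed difference, by the recursion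
  one degree lower at x and at x - 1 (\<open>e1\<close>, \<open>e2\<close>).\<close>

lemma cardinal_bspline_has_derivative_nonint:
  "x \<notin> \<int> \<Longrightarrow> (cardinal_bspline (Suc q) has_real_derivative
     cardinal_bspline q x - cardinal_bspline q (x - 1)) (at x)"
proof (induction q arbitrary: x)
  case 0
  have d0: "(cardinal_bspline 0 has_real_derivative 0) (at y)" if "y \<notin> \<int>" for y
  proof -
    have y: "y \<noteq> 0" "y \<noteq> 1" using that by auto
    have "\<forall>\<^sub>F z in nhds y. cardinal_bspline 0 z = cardinal_bspline 0 y"
    proof -
      consider "y < 0" | "0 < y \<and> y < 1" | "y > 1" using y by linarith
      then show ?thesis
      proof cases
        case 1
        then have "\<forall>\<^sub>F z in nhds y. z < 0" by (intro eventually_nhds_in_open[of "{..<0}", simplified]) auto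
        then show ?thesis by eventually_elim (use 1 in auto)
      next
        case 2
        then have "\<forall>\<^sub>F z in nhds y. 0 < z \<and> z < 1"
          using eventually_nhds_in_open[of "{0<..<1}" y] by auto
        then show ?thesis by eventually_elim (use 2 in auto)
      next
        case 3
        then have "\<forall>\<^sub>F z in nhds y. z > 1" by (intro eventually_nhds_in_open[of "{1<..}", simplified]) auto
        then show ?thesis by eventually_elim (use 3 in auto)
      qed
    qed
    then have "(cardinal_bspline 0 has_real_derivative 0) (at y) \<longleftrightarrow>
      ((\<lambda>z. cardinal_bspline 0 y) has_real_derivative 0) (at y)"
      by (intro DERIV_cong_ev) auto
    then show ?thesis by simp
  qed
  have x1: "x - 1 \<notin> \<int>" using 0 by (metis Ints_1 Ints_add diff_add_cancel)
  have "((\<lambda>z. cardinal_bspline 0 (z - 1)) has_real_derivative 0) (at x)"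
    by (rule shifted_cardinal_bspline_has_derivative[OF d0[OF x1]])
  note d = d0[OF 0] this
  have "((\<lambda>z. z * cardinal_bspline 0 z + (2 - z) * cardinal_bspline 0 (z - 1)) has_real_derivative
     cardinal_bspline 0 x - cardinal_bspline 0 (x - 1)) (at x)"
    by (rule derivative_eq_intros d refl)+ simp
  moreover have "cardinal_bspline (Suc 0) = (\<lambda>z. z * cardinal_bspline 0 z + (2 - z) * cardinal_bspline 0 (z - 1))"
    by (rule ext) (simp add: cardinal_bspline.simps(2))
  ultimately show ?case by simp
next
  case (Suc q)
  define m where "m = real (Suc q)"
  have m: "m > 0" by (simp add: m_def)
  have x1: "x - 1 \<notin> \<int>" using Suc.prems by (metis Ints_1 Ints_add diff_add_cancel)
  let ?B = "cardinal_bspline (Suc q)" and ?C = "cardinal_bspline q"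
  have d1: "(?B has_real_derivative ?C x - ?C (x - 1)) (at x)" using Suc by blast
  then have d2: "((\<lambda>z. ?B (z - 1)) has_real_derivative ?C (x - 1) - ?C (x - 2)) (at x)"
    using shifted_cardinal_bspline_has_derivative[OF Suc.IH[OF x1]] by simp
  have e1: "m * ?B x = x * ?C x + (m + 1 - x) * ?C (x - 1)"
  proof -
    have "?B x = x / m * ?C x + (m + 1 - x) / m * ?C (x - 1)" by (simp add: cardinal_bspline.simps(2) m_def)
    from arg_cong[OF this, of "\<lambda>v. m * v"] show ?thesis using m by (simp add: distrib_left)
  qed
  have e2: "m * ?B (x - 1) = (x - 1) * ?C (x - 1) + (m + 2 - x) * ?C (x - 2)"
  proof -
    have "?B (x - 1) = (x - 1) / m * ?C (x - 1) + (m + 2 - x) / m * ?C (x - 2)"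
      by (simp add: cardinal_bspline.simps(2) m_def)
    from arg_cong[OF this, of "\<lambda>v. m * v"] show ?thesis using m by (simp add: distrib_left)
  qed
  have eq: "cardinal_bspline (Suc (Suc q)) = (\<lambda>z. (z * ?B z + (m + 2 - z) * ?B (z - 1)) / (m + 1))"
    by (rule ext) (simp add: m_def add_divide_distrib add.commute cardinal_bspline.simps(2)[of "Suc q"])
  have "((\<lambda>z. (z * ?B z + (m + 2 - z) * ?B (z - 1)) / (m + 1)) has_real_derivative
     (?B x + x * (?C x - ?C (x - 1)) + (- ?B (x - 1) + (m + 2 - x) * (?C (x - 1) - ?C (x - 2)))) / (m + 1)) (at x)"
    by (rule derivative_eq_intros d1 d2 refl)+ (use m in \<open>simp_all add: mult.commute\<close>)
  moreover have "?B x + x * (?C x - ?C (x - 1)) + (- ?B (x - 1) + (m + 2 - x) * (?C (x - 1) - ?C (x - 2)))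
     = (m + 1) * (?B x - ?B (x - 1))"
    using e1 e2 by (simp add: algebra_simps)
  ultimately show ?case unfolding eq[symmetric] using m by simp
qed

lemma finite_Ints_atLeastAtMost: "finite (\<int> \<inter> {a..b :: real})"
proof -
  have "\<int> \<inter> {a..b} \<subseteq> real_of_int ` {\<lceil>a\<rceil>..\<lfloor>b\<rfloor>}"
    by (auto simp: Ints_def le_floor_iff ceiling_le_iff)
  then show ?thesis by (rule finite_subset) simp
qed

(* Telescoping: the sum of the unit translates of the next spline is a primitive. *)
lemma cardinal_bspline_has_integral:
  "(cardinal_bspline q has_integral cardinal_bspline (Suc q) x) {x - 1..x}"
proof -
  \<comment> \<open>From the M-th translate on, everything vanishes on the interval, so the
    telescoping sum is finite.\<close>
  obtain M :: nat where M: "real M > x" using reals_Archimedean2 by blast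
  define P where "P y = (\<Sum>i<M. cardinal_bspline (Suc q) (y - real i))" for y
  have c: "continuous_on {x - 1..x} P" unfolding P_def
    by (intro continuous_intros continuous_on_compose2[OF continuous_on_cardinal_bspline[of UNIV q]]) auto
  have d: "(P has_vector_derivative cardinal_bspline q y) (at y)" if y: "y \<in> {x - 1..x} - (\<int> \<inter> {x - 1..x})" for y
  proof -
    have ni: "y - real i \<notin> \<int>" for i
    proof
      assume "y - real i \<in> \<int>"
      then have "y - real i + real i \<in> \<int>" by (intro Ints_add) auto
      with y show False by auto
    qed
    have "(P has_real_derivative (\<Sum>i<M. cardinal_bspline q (y - real i) - cardinal_bspline q (y - real i - 1))) (at y)"
      unfolding P_def
      by (intro DERIV_sum shifted_cardinal_bspline_has_derivative cardinal_bspline_has_derivative_nonint ni)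
    also have "(\<Sum>i<M. cardinal_bspline q (y - real i) - cardinal_bspline q (y - real i - 1)) =
       cardinal_bspline q y - cardinal_bspline q (y - real M)"
      using sum_lessThan_telescope'[of "\<lambda>i. cardinal_bspline q (y - real i)" M]
      by (simp add: algebra_simps)
    also have "cardinal_bspline q (y - real M) = 0" using y M by (intro cardinal_bspline_eq_0) auto
    finally show ?thesis by (simp add: has_real_derivative_iff_has_vector_derivative)
  qed
  have "(cardinal_bspline q has_integral (P x - P (x - 1))) {x - 1..x}"
    by (rule fundamental_theorem_of_calculus_strong[OF finite_Ints_atLeastAtMost _ d c]) auto
  moreover have "P x - P (x - 1) = cardinal_bspline (Suc q) x"
  proof -
    have "P x - P (x - 1) = (\<Sum>i<M. cardinal_bspline (Suc q) (x - real i) - cardinal_bspline (Suc q) (x - real (Suc i)))"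
      unfolding P_def by (simp add: sum_subtractf algebra_simps)
    also have "\<dots> = cardinal_bspline (Suc q) x - cardinal_bspline (Suc q) (x - real M)"
      using sum_lessThan_telescope'[of "\<lambda>i. cardinal_bspline (Suc q) (x - real i)" M]
      by (simp del: of_nat_Suc)
    also have "cardinal_bspline (Suc q) (x - real M) = 0" using M by (intro cardinal_bspline_eq_0) auto
    finally show ?thesis by simp
  qed
  ultimately show ?thesis by simp
qed

text \<open>Near any point f is a constant plus an integral of h, since the finitely many integers
  do no harm to the fundamental theorem for continuous f. Continuity of h then gives the derivative
  at the integers as well.\<close>

lemma has_real_derivative_fill_finite:
  fixes f h :: "real \<Rightarrow> real"
  assumes f: "continuous_on UNIV f" and h: "continuous_on UNIV h"
    and d: "\<And>x. x \<notin> \<int> \<Longrightarrow> (f has_real_derivative h x) (at x)"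
  shows "(f has_real_derivative h x) (at x)"
proof -
  have eq: "f y = f (x - 1) + integral {x - 1..y} h" if "y \<in> {x - 1..x + 1}" for y
  proof -
    have "(h has_integral (f y - f (x - 1))) {x - 1..y}"
    proof (rule fundamental_theorem_of_calculus_strong[OF finite_Ints_atLeastAtMost[of "x - 1" "x + 1"]])
      show "(f has_vector_derivative h z) (at z)" if "z \<in> {x - 1..y} - \<int> \<inter> {x - 1..x + 1}" for z
        using that d[of z] \<open>y \<in> _\<close> by (auto simp: has_real_derivative_iff_has_vector_derivative)
      show "continuous_on {x - 1..y} f" by (rule continuous_on_subset[OF f]) simp
    qed (use that in auto)
    from integral_unique[OF this] show ?thesis by linarith
  qed
  have "((\<lambda>y. integral {x - 1..y} h) has_real_derivative h x) (at x within {x - 1..x + 1})"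
    by (rule integral_has_real_derivative[OF continuous_on_subset[OF h]]) auto
  from DERIV_add[OF DERIV_const this, of "f (x - 1)"]
  have d: "((\<lambda>y. f (x - 1) + integral {x - 1..y} h) has_real_derivative h x) (at x within {x - 1..x + 1})"
    by simp
  have "(f has_real_derivative h x) (at x within {x - 1..x + 1})"
    unfolding has_field_derivative_def
    by (rule has_derivative_transform[OF _ eq d[unfolded has_field_derivative_def]]) auto
  then show ?thesis using at_within_interior[of x "{x - 1..x + 1}"] by auto
qed

lemma cardinal_bspline_has_derivative:
  "(cardinal_bspline (Suc (Suc q)) has_real_derivative
     cardinal_bspline (Suc q) x - cardinal_bspline (Suc q) (x - 1)) (at x)"
proof (rule has_real_derivative_fill_finite[where h = "\<lambda>x. cardinal_bspline (Suc q) x - cardinal_bspline (Suc q) (x - 1)"])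
  have "continuous_on UNIV (\<lambda>x. cardinal_bspline (Suc q) (x - 1))"
    by (rule continuous_on_compose2[OF continuous_on_cardinal_bspline[of UNIV q]]) (auto intro: continuous_intros)
  then show "continuous_on UNIV (\<lambda>x. cardinal_bspline (Suc q) x - cardinal_bspline (Suc q) (x - 1))"
    by (intro continuous_on_diff continuous_on_cardinal_bspline)
qed (rule continuous_on_cardinal_bspline cardinal_bspline_has_derivative_nonint, assumption?)+

section \<open>Reflection and convolution of cardinal B-splines\<close>

lemma cardinal_bspline_symmetric: "cardinal_bspline (Suc q) (real q + 2 - x) = cardinal_bspline (Suc q) x"
proof (induction q arbitrary: x)
  case 0
  show ?case using cardinal_bspline_1[of x] cardinal_bspline_1[of "2 - x"]
    by (simp add: min.commute)
next
  case (Suc q)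
  have "cardinal_bspline (Suc q) (real q + 3 - x) = cardinal_bspline (Suc q) (x - 1)"
    using Suc[of "x - 1"] by (simp add: algebra_simps)
  moreover have "cardinal_bspline (Suc q) (real q + 2 - x) = cardinal_bspline (Suc q) x" using Suc .
  moreover have "cardinal_bspline (Suc (Suc q)) z = z / (real q + 2) * cardinal_bspline (Suc q) z +
      (real q + 3 - z) / (real q + 2) * cardinal_bspline (Suc q) (z - 1)" for z
    by (simp add: cardinal_bspline.simps(2)[of "Suc q"] add.commute)
  note this[of x] this[of "real q + 3 - x"]
  moreover have "real q + 3 - x - 1 = real q + 2 - x" "real (Suc q) + 2 - x = real q + 3 - x" by auto
  ultimately show ?case by (simp only:) simp
qed

lemma cardinal_bspline_convolution_0:
  "(\<integral>\<^sup>+t. ennreal (cardinal_bspline 0 t) * ennreal (cardinal_bspline q (x - t)) \<partial>lborel) = ennreal (cardinal_bspline (Suc q) x)"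
proof -
  let ?f = "\<lambda>s. indicator {x - 1..x} s * cardinal_bspline q s"
  have "((\<lambda>s. if s \<in> {x - 1..x} then cardinal_bspline q s else 0) has_integral cardinal_bspline (Suc q) x) UNIV"
    unfolding has_integral_restrict_UNIV by (rule cardinal_bspline_has_integral)
  moreover have "(\<lambda>s. if s \<in> {x - 1..x} then cardinal_bspline q s else 0) = ?f" by auto
  ultimately have "(?f has_integral cardinal_bspline (Suc q) x) UNIV" by simp
  then have "(\<integral>\<^sup>+s. ennreal (?f s) \<partial>lborel) = ennreal (cardinal_bspline (Suc q) x)"
    by (intro nn_integral_has_integral_lborel) (auto simp: cardinal_bspline_nonneg)
  also have "(\<integral>\<^sup>+s. ennreal (?f s) \<partial>lborel) = (\<integral>\<^sup>+t. ennreal (?f (x + (-1) * t)) \<partial>lborel)"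
    by (subst nn_integral_real_affine[where c = "-1" and t = x]) auto
  also have "\<dots> = (\<integral>\<^sup>+t. ennreal (cardinal_bspline 0 t) * ennreal (cardinal_bspline q (x - t)) \<partial>lborel)"
  proof (rule nn_integral_cong_AE)
    \<comment> \<open>The substitution turns the closed interval into {0..1}, while the spline of
      degree 0 lives on {0..<1}; they differ at t = 1 only.\<close>
    have "AE t in lborel. t \<noteq> (1::real)" by (rule AE_lborel_singleton)
    then show "AE t in lborel. ennreal (?f (x + (-1) * t)) =
      ennreal (cardinal_bspline 0 t) * ennreal (cardinal_bspline q (x - t))"
      by eventually_elim (auto simp: indicator_def)
  qed
  finally show ?thesis by simp
qed

text \<open>Associativity of convolution: degree p + 1 is the unit indicator convolved with degree
  p, and Tonelli moves the indicator outside. With nonnegative integrals the exchange requires no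
  integrability.\<close>

lemma cardinal_bspline_convolution:
  "(\<integral>\<^sup>+x. ennreal (cardinal_bspline p x) * ennreal (cardinal_bspline q (y - x)) \<partial>lborel) = ennreal (cardinal_bspline (Suc (p + q)) y)"
proof (induction p arbitrary: y)
  case 0
  show ?case using cardinal_bspline_convolution_0 by simp
next
  case (Suc p)
  let ?I = "\<lambda>t. ennreal (cardinal_bspline 0 t)"
  note sym = cardinal_bspline_convolution_0
  have "(\<integral>\<^sup>+x. ennreal (cardinal_bspline (Suc p) x) * ennreal (cardinal_bspline q (y - x)) \<partial>lborel) =
    (\<integral>\<^sup>+x. (\<integral>\<^sup>+t. ?I t * ennreal (cardinal_bspline p (x - t)) * ennreal (cardinal_bspline q (y - x)) \<partial>lborel) \<partial>lborel)"
    unfolding sym[symmetric] by (intro nn_integral_cong nn_integral_multc[symmetric]) measurable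
  also have "\<dots> = (\<integral>\<^sup>+t. (\<integral>\<^sup>+x. ?I t * ennreal (cardinal_bspline p (x - t)) * ennreal (cardinal_bspline q (y - x)) \<partial>lborel) \<partial>lborel)"
    by (rule lborel_pair.Fubini') measurable
  also have "\<dots> = (\<integral>\<^sup>+t. ?I t * (\<integral>\<^sup>+x. ennreal (cardinal_bspline p (x - t)) * ennreal (cardinal_bspline q (y - x)) \<partial>lborel) \<partial>lborel)"
    unfolding mult.assoc by (intro nn_integral_cong nn_integral_cmult) measurable
  also have "\<dots> = (\<integral>\<^sup>+t. ?I t * ennreal (cardinal_bspline (Suc (p + q)) (y - t)) \<partial>lborel)"
  proof (intro nn_integral_cong arg_cong2[where f = "(*)"] refl)
    fix t
    have "(\<integral>\<^sup>+x. ennreal (cardinal_bspline p (x - t)) * ennreal (cardinal_bspline q (y - x)) \<partial>lborel) =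
      (\<integral>\<^sup>+x. ennreal (cardinal_bspline p x) * ennreal (cardinal_bspline q (y - t - x)) \<partial>lborel)"
      by (subst nn_integral_real_affine[where c = 1 and t = t]) (auto simp: algebra_simps)
    also have "\<dots> = ennreal (cardinal_bspline (Suc (p + q)) (y - t))" by (rule Suc)
    finally show "(\<integral>\<^sup>+x. ennreal (cardinal_bspline p (x - t)) * ennreal (cardinal_bspline q (y - x)) \<partial>lborel) =
      ennreal (cardinal_bspline (Suc (p + q)) (y - t))" .
  qed
  also have "\<dots> = ennreal (cardinal_bspline (Suc (Suc p + q)) y)" unfolding sym by simp
  finally show ?case .
qed

section \<open>Gram coefficients and the symbols\<close>

text \<open>By \<open>has_bochner_integral_gram\<close> this is the inner product of two degree p
  splines whose integer shifts differ by k. Integer arguments allow an entry (i, j) of a Toeplitz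
  matrix to be written with i - j.\<close>

definition gram :: "nat \<Rightarrow> int \<Rightarrow> real" where
  "gram p k = cardinal_bspline (Suc (2 * p)) (real p + 1 - of_int k)"

text \<open>The inner product of the derivatives of two splines of degree p + 1, not p: a derivative
  is a difference of splines one degree lower, and two such differences produce the negative second
  difference of \<open>gram\<close>. Stiffness for degree p therefore appears as
  \<open>stiff (p - 1)\<close>.\<close>

definition stiff :: "nat \<Rightarrow> int \<Rightarrow> real" where
  "stiff p k = 2 * gram p k - gram p (k - 1) - gram p (k + 1)"

text \<open>For even coefficients, the only ones used, this is the ordinary Fourier polynomial,
  since the sine terms cancel.\<close>

definition toeplitz_symbol :: "(int \<Rightarrow> real) \<Rightarrow> nat \<Rightarrow> real \<Rightarrow> real" where
  "toeplitz_symbol c p \<theta> = (\<Sum>k\<in>{- int p..int p}. c k * cos (of_int k * \<theta>))"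

lemma gram_even: "gram p (- k) = gram p k"
  using cardinal_bspline_symmetric[of "2 * p" "real p + 1 - of_int k"] unfolding gram_def
  by (simp add: algebra_simps)

lemma gram_eq_0: "\<bar>k\<bar> > int p \<Longrightarrow> gram p k = 0"
  unfolding gram_def by (rule cardinal_bspline_Suc_eq_0) linarith

lemma stiff_even: "stiff p (- k) = stiff p k"
  using gram_even[of p k] gram_even[of p "k - 1"] gram_even[of p "k + 1"] by (simp add: stiff_def)

lemma stiff_eq_0: "\<bar>k\<bar> > int (Suc p) \<Longrightarrow> stiff p k = 0"
  unfolding stiff_def by (simp add: gram_eq_0)

text \<open>The two excluded points are the jumps of the indicator and matter for p = 0, which is
  needed for the stiffness of linear splines. Under integrals they disappear.\<close>

lemma cardinal_bspline_reflect:
  "z \<noteq> 0 \<Longrightarrow> z \<noteq> 1 \<Longrightarrow> cardinal_bspline p (real p + 1 - z) = cardinal_bspline p z"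
  using cardinal_bspline_symmetric[of "p - 1" z] by (cases p) (auto simp: indicator_def add.commute)

text \<open>Reflecting one factor turns the correlation into a convolution, whose value is a spline
  of degree 2p + 1.\<close>

lemma has_bochner_integral_cardinal_bspline_prod:
  "has_bochner_integral lborel (\<lambda>x. cardinal_bspline p (x - a) * cardinal_bspline p (x - b))
     (cardinal_bspline (Suc (2 * p)) (real p + 1 - (a - b)))"
proof (rule has_bochner_integral_nn_integral)
  have "(\<integral>\<^sup>+x. ennreal (cardinal_bspline p (x - a) * cardinal_bspline p (x - b)) \<partial>lborel) =
     (\<integral>\<^sup>+x. ennreal (cardinal_bspline p x * cardinal_bspline p (x - (b - a))) \<partial>lborel)"
    by (subst nn_integral_real_affine[where c = 1 and t = a]) (auto simp: algebra_simps)
  also have "\<dots> = (\<integral>\<^sup>+x. ennreal (cardinal_bspline p x) * ennreal (cardinal_bspline p (real p + 1 - (a - b) - x)) \<partial>lborel)"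
  proof (rule nn_integral_cong_AE)
    have "AE x in lborel. x \<noteq> b - a" "AE x in lborel. x \<noteq> b - a + 1" by (rule AE_lborel_singleton)+
    then show "AE x in lborel. ennreal (cardinal_bspline p x * cardinal_bspline p (x - (b - a))) =
      ennreal (cardinal_bspline p x) * ennreal (cardinal_bspline p (real p + 1 - (a - b) - x))"
    proof eventually_elim
      case (elim x)
      have "real p + 1 - (x - (b - a)) = real p + 1 - (a - b) - x" by simp
      with elim cardinal_bspline_reflect[of "x - (b - a)" p] show ?case
        by (simp add: ennreal_mult cardinal_bspline_nonneg)
    qed
  qed
  also have "\<dots> = ennreal (cardinal_bspline (Suc (2 * p)) (real p + 1 - (a - b)))"
    by (simp add: cardinal_bspline_convolution mult_2)
  finally show "(\<integral>\<^sup>+x. ennreal (cardinal_bspline p (x - a) * cardinal_bspline p (x - b)) \<partial>lborel) =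
    ennreal (cardinal_bspline (Suc (2 * p)) (real p + 1 - (a - b)))" .
qed (auto simp: cardinal_bspline_nonneg)

lemma has_bochner_integral_gram:
  "has_bochner_integral lborel (\<lambda>x. cardinal_bspline p (x - of_int a) * cardinal_bspline p (x - of_int b)) (gram p (a - b))"
  using has_bochner_integral_cardinal_bspline_prod[of p "of_int a" "of_int b"] by (simp add: gram_def)

definition cardinal_bspline_diff :: "nat \<Rightarrow> real \<Rightarrow> real" where
  "cardinal_bspline_diff p x = cardinal_bspline p x - cardinal_bspline p (x - 1)"

lemma has_bochner_integral_stiff:
  "has_bochner_integral lborel (\<lambda>x. cardinal_bspline_diff p (x - of_int a) * cardinal_bspline_diff p (x - of_int b)) (stiff p (a - b))"
proof -
  let ?B = "\<lambda>a x. cardinal_bspline p (x - of_int a)"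
  have "has_bochner_integral lborel
    (\<lambda>x. (?B a x * ?B b x - ?B a x * ?B (b + 1) x) - (?B (a + 1) x * ?B b x - ?B (a + 1) x * ?B (b + 1) x))
    ((gram p (a - b) - gram p (a - (b + 1))) - (gram p (a + 1 - b) - gram p (a + 1 - (b + 1))))"
    by (intro has_bochner_integral_diff has_bochner_integral_gram)
  moreover have "(\<lambda>x. (?B a x * ?B b x - ?B a x * ?B (b + 1) x) - (?B (a + 1) x * ?B b x - ?B (a + 1) x * ?B (b + 1) x)) =
    (\<lambda>x. cardinal_bspline_diff p (x - of_int a) * cardinal_bspline_diff p (x - of_int b))"
    by (rule ext) (simp add: cardinal_bspline_diff_def algebra_simps)
  moreover have "(gram p (a - b) - gram p (a - (b + 1))) - (gram p (a + 1 - b) - gram p (a + 1 - (b + 1))) = stiff p (a - b)"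
    by (simp add: stiff_def algebra_simps)
  ultimately show ?thesis by simp
qed

lemma toeplitz_symbol_even:
  assumes "\<And>k. c (- k) = c k"
  shows "toeplitz_symbol c p \<theta> = c 0 + 2 * (\<Sum>k = 1..p. c (int k) * cos (real k * \<theta>))"
proof (induction p)
  case (Suc p)
  have "{- int (Suc p)..int (Suc p)} = insert (int (Suc p)) (insert (- int (Suc p)) {- int p..int p})" by auto
  then have "toeplitz_symbol c (Suc p) \<theta> = 2 * c (int (Suc p)) * cos (real (Suc p) * \<theta>) + toeplitz_symbol c p \<theta>"
    using assms[of "int (Suc p)"] cos_minus[of "real (Suc p) * \<theta>"]
    unfolding toeplitz_symbol_def by (simp add: algebra_simps)
  then show ?case using Suc by (simp add: algebra_simps)
qed (simp add: toeplitz_symbol_def)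

lemma g_symbol_eq: "g_symbol p \<theta> = toeplitz_symbol (gram p) p \<theta>"
  unfolding toeplitz_symbol_even[of "gram p", OF gram_even] by (simp add: g_symbol_def gram_def)

text \<open>Each derivative is a difference one degree lower. Degree 2p + 3 is high enough for both
  derivatives to exist at integers.\<close>

lemma deriv2_cardinal_bspline:
  "deriv (deriv (cardinal_bspline (2 * Suc p + 1))) (real (Suc p) + 1 - of_int k) = - stiff p k"
proof -
  have n: "2 * Suc p + 1 = Suc (Suc (Suc (2 * p)))" by simp
  have 1: "deriv (cardinal_bspline (Suc (Suc (Suc (2 * p))))) =
    (\<lambda>x. cardinal_bspline (Suc (Suc (2 * p))) x - cardinal_bspline (Suc (Suc (2 * p))) (x - 1))"
    by (rule ext) (rule DERIV_imp_deriv[OF cardinal_bspline_has_derivative])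
  let ?z = "real (Suc p) + 1 - of_int k"
  let ?C = "cardinal_bspline (Suc (2 * p))"
  have "deriv (deriv (cardinal_bspline (2 * Suc p + 1))) ?z = (?C ?z - ?C (?z - 1)) - (?C (?z - 1) - ?C (?z - 1 - 1))"
    unfolding n 1
    by (intro DERIV_imp_deriv DERIV_diff cardinal_bspline_has_derivative shifted_cardinal_bspline_has_derivative)
  then show ?thesis by (simp add: stiff_def gram_def algebra_simps)
qed

lemma f_symbol_eq: "f_symbol (Suc p) \<theta> = toeplitz_symbol (stiff p) (Suc p) \<theta>"
proof -
  have a: "deriv (deriv (cardinal_bspline (2 * Suc p + 1))) (real (Suc p) + 1 - real k) = - stiff p (int k)" for k
    using deriv2_cardinal_bspline[of p "int k"] by simp
  have "deriv (deriv (cardinal_bspline (2 * Suc p + 1))) (real (Suc p) + 1) = - stiff p 0"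
    using deriv2_cardinal_bspline[of p 0] by simp
  then show ?thesis
    unfolding toeplitz_symbol_even[of "stiff p", OF stiff_even] f_symbol_def a by (simp add: sum_negf)
qed

text \<open>A second difference of the coefficients multiplies the symbol by 2 - 2 cos \<theta>. The
  window grows by one on each side because the shifted coefficients reach beyond the band of
  \<open>gram\<close>.\<close>

lemma toeplitz_symbol_stiff:
  "toeplitz_symbol (stiff p) (Suc p) \<theta> = (2 - 2 * cos \<theta>) * toeplitz_symbol (gram p) p \<theta>"
proof -
  let ?I = "{- int (Suc p)..int (Suc p)}"
  let ?J = "{- int p..int p}"
  have shift: "(\<Sum>k\<in>?I. gram p (k - s) * cos (of_int k * \<theta>)) = (\<Sum>k\<in>?J. gram p k * cos (of_int (k + s) * \<theta>))"
    if "\<bar>s\<bar> \<le> 1" for s :: int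
  proof -
    have "(\<Sum>k\<in>?J. gram p k * cos (of_int (k + s) * \<theta>)) = (\<Sum>k\<in>(\<lambda>k. k + s) ` ?J. gram p (k - s) * cos (of_int k * \<theta>))"
      by (subst sum.reindex) (auto simp: inj_on_def)
    also have "\<dots> = (\<Sum>k\<in>?I. gram p (k - s) * cos (of_int k * \<theta>))"
    proof (rule sum.mono_neutral_left)
      show "(\<lambda>k. k + s) ` ?J \<subseteq> ?I" using that by auto
      show "\<forall>k\<in>?I - (\<lambda>k. k + s) ` ?J. gram p (k - s) * cos (of_int k * \<theta>) = 0"
      proof
        fix k assume k: "k \<in> ?I - (\<lambda>k. k + s) ` ?J"
        have "\<not> \<bar>k - s\<bar> \<le> int p"
        proof
          assume "\<bar>k - s\<bar> \<le> int p"
          then have "k \<in> (\<lambda>k. k + s) ` ?J" by (intro image_eqI[of _ _ "k - s"]) auto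
          with k show False by auto
        qed
        then show "gram p (k - s) * cos (of_int k * \<theta>) = 0" by (simp add: gram_eq_0)
      qed
    qed simp
    finally show ?thesis by simp
  qed
  have "toeplitz_symbol (stiff p) (Suc p) \<theta> =
    2 * (\<Sum>k\<in>?I. gram p (k - 0) * cos (of_int k * \<theta>)) - (\<Sum>k\<in>?I. gram p (k - 1) * cos (of_int k * \<theta>))
      - (\<Sum>k\<in>?I. gram p (k - (- 1)) * cos (of_int k * \<theta>))"
    unfolding toeplitz_symbol_def stiff_def
    by (simp add: left_diff_distrib sum_subtractf sum_distrib_left mult.assoc)
  also have "\<dots> = (\<Sum>k\<in>?J. gram p k * (2 * cos (of_int k * \<theta>) - cos (of_int (k + 1) * \<theta>) - cos (of_int (k + - 1) * \<theta>)))"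
    by (subst (1 2 3) shift) (simp_all add: right_diff_distrib sum_subtractf sum_distrib_left mult_ac)
  also have "\<dots> = (\<Sum>k\<in>?J. (2 - 2 * cos \<theta>) * (gram p k * cos (of_int k * \<theta>)))"
    by (rule sum.cong) (auto simp: cos_add cos_diff algebra_simps)
  finally show ?thesis by (simp add: toeplitz_symbol_def sum_distrib_left)
qed

text \<open>Differentiation in x lowers the degree by one and brings out a factor 1 - z. For z
  \<noteq> 1, vanishing on the whole interval would thus be inherited by the lower degree, down to
  degree 0, where the sum is 1. For z = 1 all terms are positive.\<close>

lemma cardinal_bspline_fourier_nonzero:
  fixes z :: complex
  shows "\<exists>x\<in>{0<..<1}. (\<Sum>k\<le>q. of_real (cardinal_bspline q (x + real k)) * z ^ k) \<noteq> 0"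
proof (cases "z = 1")
  case True
  let ?s = "\<Sum>k\<le>q. cardinal_bspline q (1 / 2 + real k)"
  have "?s > 0" by (rule sum_pos) (auto intro!: cardinal_bspline_pos)
  then have "(of_real ?s :: complex) \<noteq> 0" by (simp only: of_real_eq_0_iff)
  then show ?thesis using True by (intro bexI[of _ "1 / 2"]) auto
next
  case False
  show ?thesis
  proof (induction q)
    case 0
    show ?case by (intro bexI[of _ "1 / 2"]) auto
  next
    case (Suc q)
    define Z where "Z x = (\<Sum>k\<le>Suc q. of_real (cardinal_bspline (Suc q) (x + real k)) * z ^ k)" for x
    define Y where "Y x = (\<Sum>k\<le>q. of_real (cardinal_bspline q (x + real k)) * z ^ k)" for x
    have d: "(Z has_vector_derivative (1 - z) * Y x) (at x)" if x: "0 < x" "x < 1" for x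
    proof -
      have ni: "x + real k \<notin> \<int>" for k
      proof
        assume "x + real k \<in> \<int>"
        then have "x + real k - real k \<in> \<int>" by (intro Ints_diff) auto
        then obtain j where "x = of_int j" by (auto elim!: Ints_cases)
        with x show False by auto
      qed
      have "((\<lambda>y. cardinal_bspline (Suc q) (y - (- real k))) has_real_derivative
          cardinal_bspline q (x + real k) - cardinal_bspline q (x + real k - 1)) (at x)" for k
        using cardinal_bspline_has_derivative_nonint[OF ni[of k], of q]
        by (intro shifted_cardinal_bspline_has_derivative) simp
      then have "((\<lambda>y. complex_of_real (cardinal_bspline (Suc q) (y + real k))) has_vector_derivative
          of_real (cardinal_bspline q (x + real k) - cardinal_bspline q (x + real k - 1))) (at x)" for k
        by (intro has_vector_derivative_of_real) (simp add: has_real_derivative_iff_has_vector_derivative)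
      then have "(Z has_vector_derivative
        (\<Sum>k\<le>Suc q. of_real (cardinal_bspline q (x + real k) - cardinal_bspline q (x + real k - 1)) * z ^ k)) (at x)"
        unfolding Z_def by (intro has_vector_derivative_sum has_vector_derivative_mult_left)
      also have "(\<Sum>k\<le>Suc q. of_real (cardinal_bspline q (x + real k) - cardinal_bspline q (x + real k - 1)) * z ^ k) =
        (\<Sum>k\<le>Suc q. of_real (cardinal_bspline q (x + real k)) * z ^ k) -
        (\<Sum>k\<le>Suc q. of_real (cardinal_bspline q (x + real k - 1)) * z ^ k)"
        by (simp only: of_real_diff left_diff_distrib sum_subtractf)
      also have "(\<Sum>k\<le>Suc q. of_real (cardinal_bspline q (x + real k)) * z ^ k) = Y x"
        using x by (simp add: Y_def cardinal_bspline_eq_0)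
      also have "(\<Sum>k\<le>Suc q. of_real (cardinal_bspline q (x + real k - 1)) * z ^ k) =
        of_real (cardinal_bspline q (x - 1)) + (\<Sum>k\<le>q. of_real (cardinal_bspline q (x + real k)) * z ^ Suc k)"
        by (subst sum.atMost_Suc_shift) (simp add: add_ac)
      also have "cardinal_bspline q (x - 1) = 0" using x by (simp add: cardinal_bspline_eq_0)
      finally show ?thesis by (simp add: Y_def algebra_simps sum_distrib_left sum_subtractf)
    qed
    obtain x where x: "0 < x" "x < 1" "Y x \<noteq> 0" using Suc by (auto simp: Y_def)
    have "\<not> (\<forall>y\<in>{0<..<1}. Z y = 0)"
    proof
      assume 0: "\<forall>y\<in>{0<..<1}. Z y = 0"
      have "(Z has_vector_derivative 0) (at x)"
        by (rule has_vector_derivative_transform_within_open[of "\<lambda>_. 0" _ _ "{0<..<1}"]) (use x 0 in auto)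
      then have "(1 - z) * Y x = 0" using d[OF x(1,2)] by (metis vector_derivative_unique_at)
      then show False using False x by simp
    qed
    then show ?case by (auto simp: Z_def)
  qed
qed

lemma integral_unit_pieces:
  fixes h :: "real \<Rightarrow> real"
  assumes "continuous_on UNIV h"
  shows "integral {0..real m} h = integral {0..1} (\<lambda>x. \<Sum>l<m. h (x + real l))"
proof -
  have "integral {0..real m} h = (\<Sum>l<m. integral {0..1} (\<lambda>x. h (x + real l)))"
  proof (induction m)
    case (Suc m)
    have "integral {0..real (Suc m)} h = integral {0..real m} h + integral {real m..real (Suc m)} h"
      by (rule Henstock_Kurzweil_Integration.integral_combine[symmetric])
        (auto intro!: integrable_continuous_real continuous_on_subset[OF assms])
    also have "integral {real m..real (Suc m)} h = integral {0..1} (\<lambda>x. h (x + real m))"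
      using integral_shift_real_ivl[of "real m" "real m" "real (Suc m)" h] by simp
    finally show ?case using Suc by simp
  qed simp
  also have "\<dots> = integral {0..1} (\<lambda>x. \<Sum>l<m. h (x + real l))"
    by (intro integral_sum[symmetric] integrable_continuous_real continuous_on_compose2[OF assms])
      (auto intro!: continuous_intros)
  finally show ?thesis .
qed

(* The symbol is the integral over one period of the squared modulus of the spline's lattice Fourier series. *)
lemma toeplitz_symbol_gram_pos: "toeplitz_symbol (gram p) p \<theta> > 0"
proof (cases p)
  case 0
  then show ?thesis
    using cardinal_bspline_pos[of 1 1] by (simp add: toeplitz_symbol_def gram_def)
next
  case (Suc p')
  let ?B = "cardinal_bspline p"
  have contB: "continuous_on A (\<lambda>x. ?B (x + a))" for A a
    unfolding Suc by (rule continuous_on_compose2[OF continuous_on_cardinal_bspline[of UNIV]]) (auto intro: continuous_intros)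
  \<comment> \<open>The integral of h over the line is the symbol; since h lives on [0, p + 1], it
    can be folded onto one period.\<close>
  define h where "h x = (\<Sum>d\<in>{- int p..int p}. ?B x * ?B (x + of_int d) * cos (of_int d * \<theta>))" for x
  have conth: "continuous_on UNIV h"
    unfolding h_def using contB[of UNIV 0] by (intro continuous_intros contB) auto
  have "has_bochner_integral lborel h (toeplitz_symbol (gram p) p \<theta>)"
    unfolding h_def toeplitz_symbol_def
  proof (intro has_bochner_integral_sum has_bochner_integral_mult_left)
    fix d assume "cos (of_int d * \<theta>) \<noteq> 0"
    show "has_bochner_integral lborel (\<lambda>x. ?B x * ?B (x + of_int d)) (gram p d)"
      using has_bochner_integral_gram[of p 0 "- d"] by simp
  qed
  then have "(h has_integral toeplitz_symbol (gram p) p \<theta>) UNIV"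
    using has_integral_integral_lborel[of h] by (simp add: has_bochner_integral_iff)
  moreover have "h x = 0" if "x \<notin> {0..real (Suc p)}" for x
    using that by (auto simp: h_def cardinal_bspline_eq_0)
  then have "h = (\<lambda>x. if x \<in> {0..real (Suc p)} then h x else 0)" by auto
  ultimately have "(h has_integral toeplitz_symbol (gram p) p \<theta>) {0..real (Suc p)}"
    using has_integral_restrict_UNIV[of "{0..real (Suc p)}" h] by metis
  then have eq: "toeplitz_symbol (gram p) p \<theta> = integral {0..1} (\<lambda>x. \<Sum>l<Suc p. h (x + real l))"
    using integral_unit_pieces[OF conth, of "Suc p"] by (simp add: integral_unique)
  define Z where "Z x = (\<Sum>k\<le>p. of_real (?B (x + real k)) * cis \<theta> ^ k)" for x
  have Z2: "(\<Sum>l<Suc p. h (x + real l)) = (cmod (Z x))\<^sup>2" if x: "0 \<le> x" "x < 1" for x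
  proof -
    let ?b = "\<lambda>k :: nat. ?B (x + real k)"
    have inner: "h (x + real l) = (\<Sum>k\<le>p. ?b l * ?b k * cos ((real k - real l) * \<theta>))" if "l \<le> p" for l
    proof -
      \<comment> \<open>Substituting d = k - l; indices k outside 0, ..., p contribute nothing
        because x lies in [0, 1).\<close>
      have "h (x + real l) = (\<Sum>k\<in>(\<lambda>d. d + int l) ` {- int p..int p}. ?b l * ?B (x + of_int k) * cos ((of_int k - real l) * \<theta>))"
        unfolding h_def by (subst sum.reindex) (auto simp: inj_on_def algebra_simps)
      also have "\<dots> = (\<Sum>k\<in>int ` {..p}. ?b l * ?B (x + of_int k) * cos ((of_int k - real l) * \<theta>))"
      proof (rule sum.mono_neutral_right)
        show "int ` {..p} \<subseteq> (\<lambda>d. d + int l) ` {- int p..int p}"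
        proof
          fix k assume "k \<in> int ` {..p}"
          then show "k \<in> (\<lambda>d. d + int l) ` {- int p..int p}"
            using that by (intro image_eqI[of _ _ "k - int l"]) auto
        qed
        show "\<forall>k\<in>(\<lambda>d. d + int l) ` {- int p..int p} - int ` {..p}. ?b l * ?B (x + of_int k) * cos ((of_int k - real l) * \<theta>) = 0"
        proof
          fix k assume k: "k \<in> (\<lambda>d. d + int l) ` {- int p..int p} - int ` {..p}"
          have "k < 0 \<or> k > int p"
          proof (rule ccontr)
            assume "\<not> (k < 0 \<or> k > int p)"
            then have "k \<in> int ` {..p}" by (intro image_eqI[of _ _ "nat k"]) auto
            with k show False by auto
          qed
          then have "x + of_int k < 0 \<or> x + of_int k \<ge> real p + 1" using x by linarith
          then show "?b l * ?B (x + of_int k) * cos ((of_int k - real l) * \<theta>) = 0" by (simp add: cardinal_bspline_eq_0)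
        qed
      qed simp
      also have "\<dots> = (\<Sum>k\<le>p. ?b l * ?b k * cos ((real k - real l) * \<theta>))"
        by (subst sum.reindex) auto
      finally show ?thesis .
    qed
    have re: "Re (Z x) = (\<Sum>k\<le>p. ?b k * cos (real k * \<theta>))" and im: "Im (Z x) = (\<Sum>k\<le>p. ?b k * sin (real k * \<theta>))"
      by (simp_all add: Z_def Complex.DeMoivre)
    have "(cmod (Z x))\<^sup>2 = (\<Sum>l\<le>p. \<Sum>k\<le>p. ?b l * ?b k * (cos (real k * \<theta>) * cos (real l * \<theta>) + sin (real k * \<theta>) * sin (real l * \<theta>)))"
      unfolding cmod_power2 re im power2_eq_square[of "sum _ _"] sum_product sum.distrib[symmetric]
      by (intro sum.cong refl) (simp add: algebra_simps)
    also have "\<dots> = (\<Sum>l\<le>p. \<Sum>k\<le>p. ?b l * ?b k * cos ((real k - real l) * \<theta>))"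
      by (simp add: cos_diff left_diff_distrib)
    also have "\<dots> = (\<Sum>l<Suc p. h (x + real l))"
      by (simp add: inner lessThan_Suc_atMost)
    finally show ?thesis by simp
  qed
  have contS: "continuous_on {0..1} (\<lambda>x. \<Sum>l<Suc p. h (x + real l))"
    by (intro continuous_intros continuous_on_compose2[OF conth]) auto
  have contZ: "continuous_on {0..1} (\<lambda>x. (cmod (Z x))\<^sup>2)"
    unfolding Z_def by (intro continuous_intros contB)
  have sym: "toeplitz_symbol (gram p) p \<theta> = integral {0..1} (\<lambda>x. (cmod (Z x))\<^sup>2)"
    unfolding eq by (rule integral_spike[of "{1}"]) (use Z2 in auto)
  have "toeplitz_symbol (gram p) p \<theta> \<ge> 0"
    unfolding sym by (rule Henstock_Kurzweil_Integration.integral_nonneg) (auto intro: integrable_continuous_real contZ)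
  moreover have "toeplitz_symbol (gram p) p \<theta> \<noteq> 0"
  proof
    assume "toeplitz_symbol (gram p) p \<theta> = 0"
    then have "\<forall>x\<in>{0..1}. (cmod (Z x))\<^sup>2 = 0"
      using integral_eq_0_iff[OF contZ] sym by auto
    then show False using cardinal_bspline_fourier_nonzero[of p "cis \<theta>"] by (auto simp: Z_def)
  qed
  ultimately show ?thesis by simp
qed

section \<open>Sign and continuity of the symbols\<close>

lemma continuous_on_toeplitz_symbol: "continuous_on A (toeplitz_symbol c p)"
  unfolding toeplitz_symbol_def by (intro continuous_intros)

lemma g_symbol_pos: "g_symbol p \<theta> > 0"
  by (simp add: g_symbol_eq toeplitz_symbol_gram_pos)

text \<open>Together with the positivity of every g symbol this gives the sign of e_p: nonnegative,
  and zero on [0, pi] only at 0.\<close>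

lemma f_symbol_factorization: "f_symbol (Suc p) \<theta> = (2 - 2 * cos \<theta>) * g_symbol p \<theta>"
  by (simp add: f_symbol_eq g_symbol_eq toeplitz_symbol_stiff)

lemma e_symbol_0: "p \<ge> 1 \<Longrightarrow> e_symbol p 0 = 0"
  using f_symbol_factorization[of "p - 1" 0] by (simp add: e_symbol_def)

lemma e_symbol_nonneg: "p \<ge> 1 \<Longrightarrow> e_symbol p \<theta> \<ge> 0"
  using f_symbol_factorization[of "p - 1" \<theta>] g_symbol_pos[of "p - 1" \<theta>] g_symbol_pos[of p \<theta>] cos_le_one[of \<theta>]
  by (simp add: e_symbol_def)

lemma e_symbol_pos:
  assumes "p \<ge> 1" "0 < \<theta>" "\<theta> \<le> pi"
  shows "e_symbol p \<theta> > 0"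
proof -
  have "cos \<theta> < cos 0" using assms by (intro cos_monotone_0_pi) auto
  then show ?thesis
    using assms f_symbol_factorization[of "p - 1" \<theta>] g_symbol_pos[of "p - 1" \<theta>] g_symbol_pos[of p \<theta>]
    by (simp add: e_symbol_def)
qed

lemma continuous_on_g_symbol: "continuous_on A (g_symbol p)"
  unfolding g_symbol_eq[abs_def] by (rule continuous_on_toeplitz_symbol)

lemma continuous_on_f_symbol: "continuous_on A (f_symbol p)"
  unfolding f_symbol_def by (intro continuous_intros)

lemma continuous_on_e_symbol: "continuous_on A (e_symbol p)"
  unfolding e_symbol_def
  by (intro continuous_on_divide continuous_on_f_symbol continuous_on_g_symbol ballI) (metis g_symbol_pos less_irrefl)

section \<open>B-splines on open knot vectors\<close>

text \<open>A class closed under sums and products and contained in the integrable functions, so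
  integrability of an integrand can be read off its shape. Measurability is relative to [0, 1]
  because phi' is known to be continuous only there.\<close>

definition bounded_measurable :: "(real \<Rightarrow> real) \<Rightarrow> bool" where
  "bounded_measurable f \<longleftrightarrow> f \<in> borel_measurable (lebesgue_on {0..1}) \<and> (\<exists>C. \<forall>x\<in>{0..1}. \<bar>f x\<bar> \<le> C)"

lemma bounded_measurable_mult:
  assumes "bounded_measurable f" "bounded_measurable g"
  shows "bounded_measurable (\<lambda>x. f x * g x)"
proof -
  obtain C D where "\<forall>x\<in>{0..1}. \<bar>f x\<bar> \<le> C" "\<forall>x\<in>{0..1}. \<bar>g x\<bar> \<le> D"
    using assms by (auto simp: bounded_measurable_def)
  then have "\<forall>x\<in>{0..1}. \<bar>f x * g x\<bar> \<le> \<bar>C\<bar> * \<bar>D\<bar>"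
    unfolding abs_mult by (intro ballI mult_mono) (auto intro: order_trans[OF _ abs_ge_self])
  then show ?thesis using assms unfolding bounded_measurable_def by (auto intro: borel_measurable_times)
qed

lemma bounded_measurable_add:
  assumes "bounded_measurable f" "bounded_measurable g"
  shows "bounded_measurable (\<lambda>x. f x + g x)"
proof -
  obtain C D where "\<forall>x\<in>{0..1}. \<bar>f x\<bar> \<le> C" "\<forall>x\<in>{0..1}. \<bar>g x\<bar> \<le> D"
    using assms by (auto simp: bounded_measurable_def)
  then have "\<forall>x\<in>{0..1}. \<bar>f x + g x\<bar> \<le> C + D" by (auto intro: order_trans[OF abs_triangle_ineq] add_mono)
  then show ?thesis using assms unfolding bounded_measurable_def by (auto intro: borel_measurable_add)
qed

lemma bounded_measurable_const: "bounded_measurable (\<lambda>_. c)"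
  by (auto simp: bounded_measurable_def)

lemma bounded_measurable_sum:
  "(\<And>a. a \<in> A \<Longrightarrow> bounded_measurable (f a)) \<Longrightarrow> bounded_measurable (\<lambda>x. \<Sum>a\<in>A. f a x)"
  by (induction A rule: infinite_finite_induct) (auto intro: bounded_measurable_const bounded_measurable_add)

lemma bounded_measurable_continuous:
  assumes "continuous_on {0..1} f"
  shows "bounded_measurable f"
proof -
  have "bounded (f ` {0..1})" using assms by (intro compact_imp_bounded compact_continuous_image) auto
  then have "\<exists>C. \<forall>x\<in>{0..1}. \<bar>f x\<bar> \<le> C" by (auto simp: bounded_iff)
  moreover have "f \<in> borel_measurable (lebesgue_on {0..1})"
    using assms by (intro continuous_imp_measurable_on_sets_lebesgue) auto
  ultimately show ?thesis by (simp add: bounded_measurable_def)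
qed

lemma bounded_measurable_borel:
  assumes "f \<in> borel_measurable borel" "\<And>x. x \<in> {0..1} \<Longrightarrow> \<bar>f x\<bar> \<le> C"
  shows "bounded_measurable f"
proof -
  have "f \<in> borel_measurable lebesgue" using assms(1) by (intro measurable_completion) simp
  then have "f \<in> borel_measurable (lebesgue_on {0..1})" by (rule measurable_restrict_space1)
  then show ?thesis using assms(2) unfolding bounded_measurable_def by blast
qed

lemma bounded_measurable_integrable_lebesgue_on:
  assumes "bounded_measurable f"
  shows "integrable (lebesgue_on {0..1}) f"
proof -
  obtain C where C: "\<forall>x\<in>{0..1}. \<bar>f x\<bar> \<le> C" using assms by (auto simp: bounded_measurable_def)
  interpret finite_measure "lebesgue_on {0..1::real}" by (intro finite_measure_lebesgue_on) auto
  show ?thesis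
    by (rule integrable_const_bound[of _ C]) (use assms C in \<open>auto simp: bounded_measurable_def\<close>)
qed

lemma bounded_measurable_integrable:
  "bounded_measurable f \<Longrightarrow> f integrable_on {0..1}"
  by (intro integrable_on_lebesgue_on bounded_measurable_integrable_lebesgue_on) auto

text \<open>The link from matrices to functions: later estimates compare integrands pointwise rather
  than matrix entries.\<close>

lemma bilinear_form_integral:
  assumes "finite A" "bounded_measurable F" "\<And>a. a \<in> A \<Longrightarrow> bounded_measurable (f a)"
  shows "(\<Sum>a\<in>A. \<Sum>b\<in>A. integral {0..1} (\<lambda>x. F x * f a x * f b x) * w a * w b) =
    integral {0..1} (\<lambda>x. F x * (\<Sum>a\<in>A. w a * f a x)\<^sup>2)"
proof -
  have i: "bounded_measurable (\<lambda>x. F x * f a x * f b x)" if "a \<in> A" "b \<in> A" for a b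
    by (intro bounded_measurable_mult assms that)
  have "(\<Sum>a\<in>A. \<Sum>b\<in>A. integral {0..1} (\<lambda>x. F x * f a x * f b x) * w a * w b) =
    (\<Sum>a\<in>A. \<Sum>b\<in>A. integral {0..1} (\<lambda>x. F x * f a x * f b x * (w a * w b)))"
    unfolding integral_mult_left by (simp only: mult.assoc)
  also have "\<dots> = (\<Sum>a\<in>A. integral {0..1} (\<lambda>x. \<Sum>b\<in>A. F x * f a x * f b x * (w a * w b)))"
    by (intro sum.cong integral_sum[symmetric] bounded_measurable_integrable bounded_measurable_mult
        bounded_measurable_const assms) auto
  also have "\<dots> = integral {0..1} (\<lambda>x. \<Sum>a\<in>A. \<Sum>b\<in>A. F x * f a x * f b x * (w a * w b))"
    by (intro integral_sum[symmetric] bounded_measurable_integrable bounded_measurable_sum bounded_measurable_mult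
        bounded_measurable_const assms) auto
  also have "(\<lambda>x. \<Sum>a\<in>A. \<Sum>b\<in>A. F x * f a x * f b x * (w a * w b)) = (\<lambda>x. F x * (\<Sum>a\<in>A. w a * f a x)\<^sup>2)"
    by (rule ext) (simp add: power2_eq_square sum_product sum_distrib_left mult_ac)
  finally show ?thesis .
qed

section \<open>Support, positivity and independence of the B-splines\<close>

lemma knot_mono: "i \<le> j \<Longrightarrow> knot n p i \<le> knot n p j"
  by (auto simp: knot_def divide_right_mono)

lemma knot_less: "p \<le> j \<Longrightarrow> j < p + n \<Longrightarrow> knot n p j < knot n p (Suc j)"
  by (auto simp: knot_def divide_strict_right_mono divide_less_eq Suc_diff_le)

lemma knot_pos: "p < j \<Longrightarrow> n \<ge> 1 \<Longrightarrow> knot n p j > 0"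
  by (auto simp: knot_def)

lemma bspline_eq_0: "x < knot n p j \<or> x \<ge> knot n p (j + q + 1) \<Longrightarrow> bspline n p q j x = 0"
proof (induction q arbitrary: j)
  case (Suc q)
  have "x < knot n p (j + 1) \<or> x \<ge> knot n p (j + 1 + q + 1)" "x < knot n p j \<or> x \<ge> knot n p (j + q + 1)"
    using Suc.prems knot_mono[of j "j + 1" n p] knot_mono[of "j + q + 1" "j + Suc q + 1" n p] by auto
  then show ?case using Suc.IH[of j] Suc.IH[of "j + 1"] by simp
qed auto

lemma bspline_pos:
  assumes "knot n p j < x" "x < knot n p (j + 1)"
  shows "bspline n p q j x > 0"
proof (induction q)
  case (Suc q)
  have "bspline n p q (j + 1) x = 0" using assms by (intro bspline_eq_0) auto
  moreover have "knot n p (j + 1) \<le> knot n p (j + Suc q)" by (rule knot_mono) simp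
  ultimately show ?case using assms Suc by simp
qed (use assms in auto)

lemma bounded_measurable_bspline: "bounded_measurable (bspline n p q j)"
proof (induction q arbitrary: j)
  case 0
  have "bspline n p 0 j = indicator {knot n p j..<knot n p (j + 1)}" by auto
  then show ?case by (intro bounded_measurable_borel[of _ 1]) (auto simp: indicator_def)
next
  case (Suc q)
  have "bspline n p (Suc q) j = (\<lambda>t. ((t - knot n p j) / (knot n p (j + Suc q) - knot n p j)) * bspline n p q j t +
     ((knot n p (j + Suc q + 1) - t) / (knot n p (j + Suc q + 1) - knot n p (j + 1))) * bspline n p q (j + 1) t)"
    by (rule ext) simp
  moreover have "bounded_measurable (\<lambda>t. (t - a) / c)" "bounded_measurable (\<lambda>t. (a - t) / c)" for a c
    unfolding divide_inverse by (rule bounded_measurable_continuous, intro continuous_intros)+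
  ultimately show ?case
    using bounded_measurable_add[OF bounded_measurable_mult[OF _ Suc] bounded_measurable_mult[OF _ Suc]] by presburger
qed

text \<open>In the recursion the first summand gains a factor x, and the second has a factor that is
  1 at 0. Both reach the order j + q - p at 0 with positive leading coefficients, so nothing
  cancels. For q = p the order is j, which is different for different splines.\<close>

lemma bspline_first_interval:
  assumes "n \<ge> 1" "j \<le> p" "p \<le> j + q"
  shows "\<exists>r. poly r 0 > 0 \<and> (\<forall>x\<in>{0..<knot n p (Suc p)}. bspline n p q j x = x ^ (j + q - p) * poly r x)"
  using assms(2,3)
proof (induction q arbitrary: j)
  case 0
  then have "j = p" by simp
  then show ?case by (intro exI[of _ 1]) (auto simp: knot_def)
next
  case (Suc q)
  have j0: "knot n p j = 0" using Suc.prems by (simp add: knot_def)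
  define T where "T = knot n p (j + Suc q + 1)"
  have T: "T > 0" using Suc.prems assms(1) unfolding T_def by (intro knot_pos) auto
  show ?case
  proof (cases "p \<le> j + q")
    case True
    define U where "U = knot n p (j + Suc q)"
    have U: "U > 0" using True assms(1) unfolding U_def by (intro knot_pos) auto
    obtain r where r: "poly r 0 > 0" "\<And>x. x \<in> {0..<knot n p (Suc p)} \<Longrightarrow> bspline n p q j x = x ^ (j + q - p) * poly r x"
      using Suc.IH[OF Suc.prems(1) True] by blast
    have e: "Suc (j + q) - p = Suc (j + q - p)" using True by simp
    show ?thesis
    proof (cases "j = p")
      case True
      have "bspline n p q (j + 1) x = 0" if "x \<in> {0..<knot n p (Suc p)}" for x
        by (rule bspline_eq_0) (use that True in auto)
      then show ?thesis
        using r U by (intro exI[of _ "Polynomial.smult (1 / U) r"]) (auto simp: e j0 U_def)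
    next
      case False
      then have j1: "j + 1 \<le> p" using Suc.prems by simp
      then have k1: "knot n p (j + 1) = 0" by (simp add: knot_def)
      obtain r' where r': "poly r' 0 > 0"
        "\<And>x. x \<in> {0..<knot n p (Suc p)} \<Longrightarrow> bspline n p q (j + 1) x = x ^ (j + 1 + q - p) * poly r' x"
        using Suc.IH[OF j1] True by auto
      show ?thesis
      proof (intro exI[of _ "Polynomial.smult (1 / U) r + [:1, - 1 / T:] * r'"] conjI ballI)
        show "poly (Polynomial.smult (1 / U) r + [:1, - 1 / T:] * r') 0 > 0" using r r' U by (simp add: add_pos_pos)
        fix x assume x: "x \<in> {0..<knot n p (Suc p)}"
        have "bspline n p (Suc q) j x = x / U * (x ^ (j + q - p) * poly r x) + (T - x) / T * (x ^ Suc (j + q - p) * poly r' x)"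
          using r(2)[OF x] r'(2)[OF x] j0 k1 by (simp add: U_def T_def e)
        also have "\<dots> = x ^ (j + Suc q - p) * poly (Polynomial.smult (1 / U) r + [:1, - 1 / T:] * r') x"
          using U T by (simp add: e field_simps)
        finally show "bspline n p (Suc q) j x = x ^ (j + Suc q - p) * poly (Polynomial.smult (1 / U) r + [:1, - 1 / T:] * r') x" .
      qed
    qed
  next
    \<comment> \<open>All knots of N_j^q are 0 here, so that spline vanishes and only the second
      summand of the recursion remains.\<close>
    case False
    then have pj: "p = j + q + 1" using Suc.prems by simp
    have j1: "j + 1 \<le> p" using pj by simp
    then have k1: "knot n p (j + 1) = 0" by (simp add: knot_def)
    obtain r where r: "poly r 0 > 0"
      "\<And>x. x \<in> {0..<knot n p (Suc p)} \<Longrightarrow> bspline n p q (j + 1) x = x ^ (j + 1 + q - p) * poly r x"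
      using Suc.IH[OF j1] pj by auto
    have z: "bspline n p q j x = 0" if "x \<in> {0..<knot n p (Suc p)}" for x
      by (rule bspline_eq_0) (use that pj in \<open>auto simp: knot_def\<close>)
    show ?thesis
    proof (intro exI[of _ "[:1, - 1 / T:] * r"] conjI ballI)
      show "poly ([:1, - 1 / T:] * r) 0 > 0" using r by simp
      fix x assume x: "x \<in> {0..<knot n p (Suc p)}"
      have "bspline n p (Suc q) j x = (T - x) / T * poly r x"
        using r(2)[OF x] z[OF x] k1 pj by (simp add: T_def)
      also have "\<dots> = x ^ (j + Suc q - p) * poly ([:1, - 1 / T:] * r) x"
        using T pj by (simp add: field_simps)
      finally show "bspline n p (Suc q) j x = x ^ (j + Suc q - p) * poly ([:1, - 1 / T:] * r) x" .
    qed
  qed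
qed

text \<open>Vanishing almost everywhere is exploited through zeros: a nonzero polynomial cannot have
  infinitely many, and on the later knot intervals a single zero suffices.\<close>

lemma infinite_zeros_of_AE_zero:
  fixes s :: "real \<Rightarrow> real"
  assumes "negligible {x\<in>{0..1}. s x \<noteq> 0}" "0 \<le> a" "a < b" "b \<le> 1"
  shows "infinite {x\<in>{a<..<b}. s x = 0}"
proof
  assume "finite {x\<in>{a<..<b}. s x = 0}"
  then have "negligible ({x\<in>{a<..<b}. s x = 0} \<union> {x\<in>{0..1}. s x \<noteq> 0})"
    using assms(1) by (intro negligible_Un[OF negligible_finite])
  then have "negligible (box a b)"
    by (rule negligible_subset) (use assms in \<open>auto simp: box_real\<close>)
  then have "box a b = {}" unfolding negligible_interval .
  then show False using assms(3) by simp
qed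

(* On the first knot interval the splines vanish at 0 to pairwise different orders; the remaining coefficients
   are removed one knot interval at a time, from left to right. *)
lemma bspline_independent:
  assumes n: "n \<ge> 1"
    and zero: "negligible {x\<in>{0..1}. (\<Sum>i<n + p - 2. w i * bspline n p p (i + 1) x) \<noteq> 0}"
    and i: "i < n + p - 2"
  shows "w i = 0"
proof -
  define N where "N = n + p - 2"
  define s where "s x = (\<Sum>i<N. w i * bspline n p p (i + 1) x)" for x
  have s0: "negligible {x\<in>{0..1}. s x \<noteq> 0}" using zero by (simp add: s_def N_def)
  have "knot n p p < knot n p (Suc p)" using n by (intro knot_less) auto
  then have k: "0 < knot n p (Suc p)" by (simp add: knot_def)
  have k1: "knot n p j \<le> 1" for j using n by (auto simp: knot_def)
  have k0: "knot n p j \<ge> 0" for j by (auto simp: knot_def)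
  define I where "I = {i. i < N \<and> i + 1 \<le> p}"
  have fI: "finite I" by (simp add: I_def)
  have "\<forall>i\<in>I. \<exists>r. poly r 0 > 0 \<and> (\<forall>x\<in>{0..<knot n p (Suc p)}. bspline n p p (i + 1) x = x ^ (i + 1) * poly r x)"
  proof
    fix i assume "i \<in> I"
    then show "\<exists>r. poly r 0 > 0 \<and> (\<forall>x\<in>{0..<knot n p (Suc p)}. bspline n p p (i + 1) x = x ^ (i + 1) * poly r x)"
      using bspline_first_interval[OF n, of "i + 1" p p] by (auto simp: I_def)
  qed
  then obtain r where r: "\<And>i. i \<in> I \<Longrightarrow> poly (r i) 0 > 0"
    "\<And>i x. i \<in> I \<Longrightarrow> x \<in> {0..<knot n p (Suc p)} \<Longrightarrow> bspline n p p (i + 1) x = x ^ (i + 1) * poly (r i) x"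
    by metis
  define P where "P = (\<Sum>i\<in>I. Polynomial.smult (w i) (monom 1 (i + 1) * r i))"
  have sP: "s x = poly P x" if "x \<in> {0<..<knot n p (Suc p)}" for x
  proof -
    have "s x = (\<Sum>i\<in>I. w i * bspline n p p (i + 1) x)"
      unfolding s_def
    proof (rule sum.mono_neutral_right)
      show "\<forall>i\<in>{..<N} - I. w i * bspline n p p (i + 1) x = 0"
      proof
        fix i assume "i \<in> {..<N} - I"
        then have "knot n p (Suc p) \<le> knot n p (i + 1)" by (intro knot_mono) (auto simp: I_def)
        then have "bspline n p p (i + 1) x = 0" using that by (intro bspline_eq_0) auto
        then show "w i * bspline n p p (i + 1) x = 0" by simp
      qed
    qed (auto simp: I_def)
    also have "\<dots> = poly P x"
      unfolding P_def poly_sum using that r(2) by (intro sum.cong) (auto simp: poly_monom)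
    finally show ?thesis .
  qed
  have "infinite {x\<in>{0<..<knot n p (Suc p)}. s x = 0}"
    by (rule infinite_zeros_of_AE_zero[OF s0]) (use k k1 in auto)
  moreover have "{x\<in>{0<..<knot n p (Suc p)}. s x = 0} \<subseteq> {x. poly P x = 0}" using sP by auto
  ultimately have P0: "P = 0" using poly_roots_finite finite_subset by blast
  have w0: "w i = 0" if "i \<in> I" for i
  proof (rule ccontr)
    assume "w i \<noteq> 0"
    then have ne: "\<exists>i. i \<in> I \<and> w i \<noteq> 0" using that by blast
    define m where "m = (LEAST i. i \<in> I \<and> w i \<noteq> 0)"
    have m: "m \<in> I" "w m \<noteq> 0" using LeastI_ex[OF ne] by (auto simp: m_def)
    have least: "w j = 0" if "j \<in> I" "j < m" for j using not_less_Least[of j] that unfolding m_def by blast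
    \<comment> \<open>Terms with i < m have weight 0 and terms with i > m begin at a higher power of
      x, so only w m is seen.\<close>
    have "coeff P (m + 1) = (\<Sum>i\<in>I. if i = m then w m * poly (r m) 0 else 0)"
      unfolding P_def coeff_sum
    proof (rule sum.cong)
      fix i assume i: "i \<in> I"
      show "coeff (Polynomial.smult (w i) (monom 1 (i + 1) * r i)) (m + 1) = (if i = m then w m * poly (r m) 0 else 0)"
        using least[OF i] by (cases "i < m") (auto simp: coeff_monom_mult poly_0_coeff_0)
    qed simp
    also have "\<dots> = w m * poly (r m) 0" using fI m by simp
    finally show False using P0 m r(1)[OF m(1)] by simp
  qed
  have "w i = 0" if "i < N" for i
    using that
  proof (induction i rule: less_induct)
    case (less i)
    show ?case
    proof (cases "i \<in> I")
      case False
      then have ip: "p \<le> i + 1" "i + 1 < p + n" using less.prems by (auto simp: I_def N_def)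
      have "infinite {x\<in>{knot n p (i + 1)<..<knot n p (Suc (i + 1))}. s x = 0}"
        by (rule infinite_zeros_of_AE_zero[OF s0 k0 knot_less[OF ip] k1])
      then obtain x where x: "knot n p (i + 1) < x" "x < knot n p (i + 1 + 1)" "s x = 0"
        using not_finite_existsD by fastforce
      \<comment> \<open>On the knot interval where spline i + 1 begins, the earlier splines already
        have weight 0 and the later ones have not begun.\<close>
      have "s x = (\<Sum>k\<in>{i}. w k * bspline n p p (k + 1) x)"
        unfolding s_def
      proof (rule sum.mono_neutral_right)
        show "\<forall>k\<in>{..<N} - {i}. w k * bspline n p p (k + 1) x = 0"
        proof
          fix k assume kk: "k \<in> {..<N} - {i}"
          show "w k * bspline n p p (k + 1) x = 0"
          proof (cases "k < i")
            case False
            then have "knot n p (i + 1 + 1) \<le> knot n p (k + 1)" using kk by (intro knot_mono) auto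
            then have "bspline n p p (k + 1) x = 0" using x by (intro bspline_eq_0) auto
            then show ?thesis by simp
          qed (use less kk in auto)
        qed
      qed (use less.prems in auto)
      then show ?thesis using x bspline_pos[OF x(1,2), of p] by auto
    qed (rule w0)
  qed
  then show ?thesis using i by (simp add: N_def)
qed

text \<open>The bounds on j and q keep every knot that occurs among t_p, ..., t_(p+n), and these are
  exactly the points i / n.\<close>

lemma bspline_uniform:
  assumes "n \<ge> 1" "p \<le> j" "j + q + 1 \<le> p + n"
  shows "bspline n p q j x = cardinal_bspline q (real n * x - real (j - p))"
  using assms(2,3)
proof (induction q arbitrary: j)
  case 0
  have n: "real n > 0" using assms(1) by simp
  have "knot n p j = real (j - p) / real n" "knot n p (j + 1) = (real (j - p) + 1) / real n"
    using 0 n by (auto simp: knot_def Suc_diff_le)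
  moreover have "real (j - p) / real n \<le> x \<longleftrightarrow> 0 \<le> real n * x - real (j - p)"
    "x < (real (j - p) + 1) / real n \<longleftrightarrow> real n * x - real (j - p) < 1"
    using n by (auto simp: field_simps)
  ultimately show ?case by (simp add: indicator_def)
next
  case (Suc q)
  have n: "real n > 0" using assms(1) by simp
  have k: "knot n p i = (real i - real p) / real n" if "p \<le> i" "i \<le> p + n" for i
    using that n by (cases "i = p + n") (auto simp: knot_def of_nat_diff)
  let ?y = "real n * x - real (j - p)"
  have a: "real (j + 1 - p) = real (j - p) + 1" using Suc.prems by (simp add: Suc_diff_le)
  have jp: "real (j - p) = real j - real p" using Suc.prems by (simp add: of_nat_diff)
  have "bspline n p q j x = cardinal_bspline q ?y" "bspline n p q (j + 1) x = cardinal_bspline q (?y - 1)"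
    using Suc.IH[of j] Suc.IH[of "j + 1"] Suc.prems a by (auto simp: algebra_simps)
  moreover have "(x - knot n p j) / (knot n p (j + Suc q) - knot n p j) = ?y / real (Suc q)"
  proof -
    have "x - knot n p j = ?y / real n" "knot n p (j + Suc q) - knot n p j = real (Suc q) / real n"
      using Suc.prems n by (simp_all add: k jp diff_divide_distrib add_divide_distrib)
    then show ?thesis using n by simp
  qed
  moreover have "(knot n p (j + Suc q + 1) - x) / (knot n p (j + Suc q + 1) - knot n p (j + 1)) =
      (real (Suc q) + 1 - ?y) / real (Suc q)"
  proof -
    have "knot n p (j + Suc q + 1) - x = (real (Suc q) + 1 - ?y) / real n"
      "knot n p (j + Suc q + 1) - knot n p (j + 1) = real (Suc q) / real n"
      using Suc.prems n by (simp_all add: k jp add_divide_distrib diff_divide_distrib)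
    then show ?thesis using n by simp
  qed
  ultimately show ?case by (simp only: bspline.simps cardinal_bspline.simps)
qed

lemma cardinal_bspline_le_1: "cardinal_bspline q x \<le> 1"
proof (induction q arbitrary: x)
  case (Suc q)
  have "((\<lambda>_. 1 :: real) has_integral 1) {x - 1..x}" using has_integral_const_real[of 1 "x - 1" x] by simp
  then show ?case using has_integral_le[OF cardinal_bspline_has_integral] Suc by blast
qed simp

section \<open>Toeplitz forms on sine vectors\<close>

(* Discrete Green identity: the vectors sin (j * \<alpha>) are eigenvectors of the discrete Dirichlet Laplacian,
   with distinct eigenvalues. *)
lemma sine_orthogonal:
  fixes S k l :: nat
  assumes "k \<in> {1..<S}" "l \<in> {1..<S}" "k \<noteq> l"
  shows "(\<Sum>j\<in>{1..<S}. sin (real j * (real k * pi / real S)) * sin (real j * (real l * pi / real S))) = 0"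
proof -
  define \<alpha> \<beta> where "\<alpha> = real k * pi / real S" and "\<beta> = real l * pi / real S"
  have S: "S > 0" using assms by auto
  \<comment> \<open>The discrete Wronskian of the two sine sequences; its boundary values vanish
    because both sines do at 0 and at S.\<close>
  define T where "T j = sin (real (Suc j) * \<alpha>) * sin (real j * \<beta>) - sin (real j * \<alpha>) * sin (real (Suc j) * \<beta>)" for j
  have step: "(2 * cos \<alpha> - 2 * cos \<beta>) * (sin (real (Suc j) * \<alpha>) * sin (real (Suc j) * \<beta>)) = T (Suc j) - T j" for j
  proof -
    have "sin (real (Suc (Suc j)) * x) + sin (real j * x) = 2 * cos x * sin (real (Suc j) * x)" for x
    proof -
      have "real (Suc (Suc j)) * x = real (Suc j) * x + x" "real j * x = real (Suc j) * x - x"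
        by (simp_all add: algebra_simps)
      then show ?thesis by (simp only: sin_add sin_diff) simp
    qed
    note rec = this
    have "(2 * a - 2 * b) * (x1 * y1) = (x2 * y1 - x1 * y2) - (x1 * y0 - x0 * y1)"
      if "x2 + x0 = 2 * a * x1" "y2 + y0 = 2 * b * y1" for a b x0 x1 x2 y0 y1 y2 :: real
    proof -
      have "(2 * a - 2 * b) * (x1 * y1) = (2 * a * x1) * y1 - x1 * (2 * b * y1)" by (simp add: algebra_simps)
      also have "\<dots> = (x2 + x0) * y1 - x1 * (y2 + y0)" by (simp only: that)
      finally show ?thesis by (simp add: algebra_simps)
    qed
    from this[OF rec[of \<alpha>] rec[of \<beta>]] show ?thesis unfolding T_def .
  qed
  have "(2 * cos \<alpha> - 2 * cos \<beta>) * (\<Sum>j\<in>{1..<S}. sin (real j * \<alpha>) * sin (real j * \<beta>)) =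
    (2 * cos \<alpha> - 2 * cos \<beta>) * (\<Sum>j<S - 1. sin (real (Suc j) * \<alpha>) * sin (real (Suc j) * \<beta>))"
    using S sum.shift_bounds_Suc_ivl[of "\<lambda>j. sin (real j * \<alpha>) * sin (real j * \<beta>)" 0 "S - 1"]
    by (simp add: atLeast0LessThan)
  also have "\<dots> = (\<Sum>j<S - 1. T (Suc j) - T j)" by (simp only: sum_distrib_left step)
  also have "\<dots> = T (S - 1) - T 0" by (rule sum_lessThan_telescope)
  also have "T 0 = 0" by (simp add: T_def)
  also have "T (S - 1) = 0"
  proof -
    have "real S * \<alpha> = real k * pi" "real S * \<beta> = real l * pi" using S by (simp_all add: \<alpha>_def \<beta>_def)
    then have "sin (real S * \<alpha>) = 0" "sin (real S * \<beta>) = 0" by (simp_all add: sin_npi)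
    then show ?thesis using S by (simp add: T_def)
  qed
  finally have "(2 * cos \<alpha> - 2 * cos \<beta>) * (\<Sum>j\<in>{1..<S}. sin (real j * \<alpha>) * sin (real j * \<beta>)) = 0" by simp
  moreover have "cos \<alpha> \<noteq> cos \<beta>"
  proof
    assume "cos \<alpha> = cos \<beta>"
    moreover have "0 \<le> \<alpha>" "\<alpha> \<le> pi" "0 \<le> \<beta>" "\<beta> \<le> pi"
      using assms S by (auto simp: \<alpha>_def \<beta>_def field_simps)
    ultimately have "\<alpha> = \<beta>" by (metis arccos_cos)
    then show False using assms S by (simp add: \<alpha>_def \<beta>_def)
  qed
  ultimately show ?thesis by (simp add: \<alpha>_def \<beta>_def)
qed

lemma sine_norm_pos:
  fixes S k :: nat
  assumes "k \<in> {1..<S}"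
  shows "(\<Sum>j\<in>{1..<S}. (sin (real j * (real k * pi / real S)))\<^sup>2) > 0"
proof (rule sum_pos2)
  show "1 \<in> {1..<S}" using assms by auto
  have "0 < real k * pi / real S" "real k * pi / real S < pi" using assms by (auto simp: field_simps)
  then have "sin (real k * pi / real S) > 0" by (rule sin_gt_zero)
  then show "0 < (sin (real 1 * (real k * pi / real S)))\<^sup>2" by simp
qed auto

text \<open>By the addition formula the deviation from an eigenvector is proportional to the sum of
  c d sin (d \<theta>), which vanishes because c is even.\<close>

lemma toeplitz_sine_eigen:
  assumes "\<And>k. c (- k) = c k"
  shows "(\<Sum>d\<in>{- int p..int p}. c d * sin (of_int (j - d) * \<theta>)) = toeplitz_symbol c p \<theta> * sin (of_int j * \<theta>)"
proof -
  have "(\<Sum>d\<in>{- int p..int p}. c d * sin (of_int d * \<theta>)) =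
    (\<Sum>d\<in>{- int p..int p}. c (- d) * sin (of_int (- d) * \<theta>))"
    by (rule sum.reindex_bij_witness[of _ uminus uminus]) auto
  also have "\<dots> = - (\<Sum>d\<in>{- int p..int p}. c d * sin (of_int d * \<theta>))"
    using assms by (simp add: sum_negf)
  finally have z: "(\<Sum>d\<in>{- int p..int p}. c d * sin (of_int d * \<theta>)) = 0" by simp
  have "(\<Sum>d\<in>{- int p..int p}. c d * sin (of_int (j - d) * \<theta>)) =
    (\<Sum>d\<in>{- int p..int p}. sin (of_int j * \<theta>) * (c d * cos (of_int d * \<theta>)) - cos (of_int j * \<theta>) * (c d * sin (of_int d * \<theta>)))"
    by (rule sum.cong) (auto simp: left_diff_distrib sin_diff right_diff_distrib)
  also have "\<dots> = sin (of_int j * \<theta>) * toeplitz_symbol c p \<theta>"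
    using z by (simp add: sum_subtractf toeplitz_symbol_def flip: sum_distrib_left)
  finally show ?thesis by (simp add: mult.commute)
qed

(* Since the vector vanishes within distance p of both ends, truncating the Toeplitz operator to the
   support does not change the quadratic form. *)
lemma toeplitz_form_sine:
  fixes S p :: nat and A :: "nat set" and c :: "int \<Rightarrow> real" and \<alpha> :: "nat \<Rightarrow> real"
  defines "\<theta> \<equiv> \<lambda>k. real k * pi / real S"
  defines "u \<equiv> \<lambda>j. \<Sum>k\<in>A. \<alpha> k * sin (real j * \<theta> k)"
  assumes A: "A \<subseteq> {1..<S}" and even: "\<And>k. c (- k) = c k" and band: "\<And>k. \<bar>k\<bar> > int p \<Longrightarrow> c k = 0"
    and zero: "\<And>j. j \<in> {1..<S} - {p + 1..<S - p} \<Longrightarrow> u j = 0"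
  shows "(\<Sum>i\<in>{p + 1..<S - p}. \<Sum>j\<in>{p + 1..<S - p}. c (int i - int j) * u i * u j) =
    (\<Sum>k\<in>A. toeplitz_symbol c p (\<theta> k) * (\<alpha> k)\<^sup>2 * (\<Sum>j\<in>{1..<S}. (sin (real j * \<theta> k))\<^sup>2))"
proof -
  let ?J = "{p + 1..<S - p}"
  have fA: "finite A" using A finite_subset by blast
  have row: "(\<Sum>j\<in>?J. c (int i - int j) * u j) = (\<Sum>k\<in>A. \<alpha> k * toeplitz_symbol c p (\<theta> k) * sin (real i * \<theta> k))"
    if i: "i \<in> ?J" for i
  proof -
    define U where "U j = (\<Sum>k\<in>A. \<alpha> k * sin (of_int j * \<theta> k))" for j :: int
    have Uu: "U (int j) = u j" for j by (simp add: U_def u_def)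
    have "(\<Sum>j\<in>?J. c (int i - int j) * u j) = (\<Sum>j\<in>int ` ?J. c (int i - j) * U j)"
      by (subst sum.reindex) (auto simp: Uu)
    also have "\<dots> = (\<Sum>j\<in>{1..int S - 1}. c (int i - j) * U j)"
    proof (rule sum.mono_neutral_left)
      show "int ` ?J \<subseteq> {1..int S - 1}" by auto
      show "\<forall>j\<in>{1..int S - 1} - int ` ?J. c (int i - j) * U j = 0"
      proof
        fix j assume j: "j \<in> {1..int S - 1} - int ` ?J"
        then obtain j' where j': "j = int j'" by (metis DiffE atLeastAtMost_iff int_one_le_iff_zero_less zero_le_imp_eq_int less_imp_le)
        have "j' \<in> {1..<S} - ?J" using j j' by auto
        then have "u j' = 0" by (rule zero)
        then show "c (int i - j) * U j = 0" using Uu j' by simp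
      qed
    qed simp
    \<comment> \<open>For i in the support the whole band i - p, ..., i + p lies inside 1, ..., S -
      1. This is the purpose of the margin p at both ends.\<close>
    also have "\<dots> = (\<Sum>j\<in>{int i - int p..int i + int p}. c (int i - j) * U j)"
      by (rule sum.mono_neutral_right) (use i band in auto)
    also have "\<dots> = (\<Sum>d\<in>{- int p..int p}. c d * U (int i - d))"
      by (rule sum.reindex_bij_witness[of _ "\<lambda>d. int i - d" "\<lambda>j. int i - j"]) auto
    also have "\<dots> = (\<Sum>k\<in>A. \<alpha> k * (\<Sum>d\<in>{- int p..int p}. c d * sin (of_int (int i - d) * \<theta> k)))"
      unfolding U_def sum_distrib_left by (subst sum.swap) (simp add: mult_ac)
    also have "\<dots> = (\<Sum>k\<in>A. \<alpha> k * toeplitz_symbol c p (\<theta> k) * sin (real i * \<theta> k))"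
      unfolding toeplitz_sine_eigen[of c, OF even] by (simp add: mult.assoc)
    finally show ?thesis .
  qed
  let ?s = "\<lambda>k j. sin (real j * \<theta> k)"
  have "(\<Sum>i\<in>?J. \<Sum>j\<in>?J. c (int i - int j) * u i * u j) = (\<Sum>i\<in>?J. u i * (\<Sum>j\<in>?J. c (int i - int j) * u j))"
    by (simp add: sum_distrib_left mult_ac)
  also have "\<dots> = (\<Sum>i\<in>?J. u i * (\<Sum>k\<in>A. \<alpha> k * toeplitz_symbol c p (\<theta> k) * ?s k i))"
    by (rule sum.cong) (use row in auto)
  also have "\<dots> = (\<Sum>i\<in>{1..<S}. u i * (\<Sum>k\<in>A. \<alpha> k * toeplitz_symbol c p (\<theta> k) * ?s k i))"
    by (rule sum.mono_neutral_left) (use zero in auto)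
  also have "\<dots> = (\<Sum>i\<in>{1..<S}. \<Sum>k\<in>A. \<Sum>l\<in>A. \<alpha> l * \<alpha> k * toeplitz_symbol c p (\<theta> k) * (?s l i * ?s k i))"
    unfolding u_def sum_product by (subst sum.swap) (simp add: mult_ac)
  also have "\<dots> = (\<Sum>k\<in>A. \<Sum>l\<in>A. \<Sum>i\<in>{1..<S}. \<alpha> l * \<alpha> k * toeplitz_symbol c p (\<theta> k) * (?s l i * ?s k i))"
    by (subst sum.swap) (intro sum.cong refl sum.swap)
  also have "\<dots> = (\<Sum>k\<in>A. \<Sum>l\<in>A. \<alpha> l * \<alpha> k * toeplitz_symbol c p (\<theta> k) * (\<Sum>i\<in>{1..<S}. ?s l i * ?s k i))"
    by (simp only: sum_distrib_left)
  also have "\<dots> = (\<Sum>k\<in>A. \<Sum>l\<in>A. if l = k then toeplitz_symbol c p (\<theta> k) * (\<alpha> k)\<^sup>2 * (\<Sum>j\<in>{1..<S}. (?s k j)\<^sup>2) else 0)"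
  proof (intro sum.cong refl)
    fix k l assume "k \<in> A" "l \<in> A"
    then have kl: "l \<in> {1..<S}" "k \<in> {1..<S}" using A by auto
    show "\<alpha> l * \<alpha> k * toeplitz_symbol c p (\<theta> k) * (\<Sum>i\<in>{1..<S}. ?s l i * ?s k i) =
      (if l = k then toeplitz_symbol c p (\<theta> k) * (\<alpha> k)\<^sup>2 * (\<Sum>j\<in>{1..<S}. (?s k j)\<^sup>2) else 0)"
      by (cases "l = k") (use sine_orthogonal[OF kl] in \<open>auto simp: \<theta>_def power2_eq_square\<close>)
  qed
  also have "\<dots> = (\<Sum>k\<in>A. toeplitz_symbol c p (\<theta> k) * (\<alpha> k)\<^sup>2 * (\<Sum>j\<in>{1..<S}. (?s k j)\<^sup>2))"
    using fA by simp
  finally show ?thesis .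
qed

text \<open>The form is a sum of squares weighted by symbol values and by positive norms of the sine
  vectors. The sign \<sigma> lets one statement serve both definite cases.\<close>

lemma toeplitz_form_sine_sign:
  fixes S p :: nat and A :: "nat set" and c :: "int \<Rightarrow> real" and \<alpha> :: "nat \<Rightarrow> real" and \<sigma> :: real
  defines "\<theta> \<equiv> \<lambda>k. real k * pi / real S"
  defines "u \<equiv> \<lambda>j. \<Sum>k\<in>A. \<alpha> k * sin (real j * \<theta> k)"
  assumes A: "A \<subseteq> {1..<S}" and even: "\<And>k. c (- k) = c k" and band: "\<And>k. \<bar>k\<bar> > int p \<Longrightarrow> c k = 0"
    and zero: "\<And>j. j \<in> {1..<S} - {p + 1..<S - p} \<Longrightarrow> u j = 0"
    and sign: "\<And>k. k \<in> A \<Longrightarrow> \<sigma> * toeplitz_symbol c p (\<theta> k) > 0"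
  shows "\<sigma> * (\<Sum>i\<in>{p + 1..<S - p}. \<Sum>j\<in>{p + 1..<S - p}. c (int i - int j) * u i * u j) \<ge> 0"
    and "\<exists>k\<in>A. \<alpha> k \<noteq> 0 \<Longrightarrow>
      \<sigma> * (\<Sum>i\<in>{p + 1..<S - p}. \<Sum>j\<in>{p + 1..<S - p}. c (int i - int j) * u i * u j) > 0"
proof -
  have fA: "finite A" using A finite_subset by blast
  define \<nu> where "\<nu> k = (\<Sum>j\<in>{1..<S}. (sin (real j * \<theta> k))\<^sup>2)" for k
  have \<nu>: "\<nu> k > 0" if "k \<in> A" for k using sine_norm_pos[of k S] A that by (auto simp: \<nu>_def \<theta>_def)
  have eq: "\<sigma> * (\<Sum>i\<in>{p + 1..<S - p}. \<Sum>j\<in>{p + 1..<S - p}. c (int i - int j) * u i * u j) =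
    (\<Sum>k\<in>A. (\<sigma> * toeplitz_symbol c p (\<theta> k)) * (\<alpha> k)\<^sup>2 * \<nu> k)"
    using toeplitz_form_sine[of A S c p \<alpha>, OF A even band] zero unfolding u_def \<theta>_def \<nu>_def
    by (simp add: sum_distrib_left mult.assoc)
  show "\<sigma> * (\<Sum>i\<in>{p + 1..<S - p}. \<Sum>j\<in>{p + 1..<S - p}. c (int i - int j) * u i * u j) \<ge> 0"
    unfolding eq
  proof (rule sum_nonneg)
    fix k assume "k \<in> A"
    then show "0 \<le> \<sigma> * toeplitz_symbol c p (\<theta> k) * (\<alpha> k)\<^sup>2 * \<nu> k"
      using sign[of k] \<nu>[of k] by (simp add: less_imp_le)
  qed
  assume "\<exists>k\<in>A. \<alpha> k \<noteq> 0"
  then obtain k where k: "k \<in> A" "\<alpha> k \<noteq> 0" by auto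
  show "\<sigma> * (\<Sum>i\<in>{p + 1..<S - p}. \<Sum>j\<in>{p + 1..<S - p}. c (int i - int j) * u i * u j) > 0"
    unfolding eq
  proof (rule sum_pos2[OF fA k(1)])
    show "0 < \<sigma> * toeplitz_symbol c p (\<theta> k) * (\<alpha> k)\<^sup>2 * \<nu> k" using sign \<nu> k by simp
    show "0 \<le> \<sigma> * toeplitz_symbol c p (\<theta> i) * (\<alpha> i)\<^sup>2 * \<nu> i" if "i \<in> A" for i
      using sign[OF that] \<nu>[OF that] by (simp add: less_imp_le)
  qed
qed

(* Otherwise some nonzero vector of the test space would satisfy the constraints and be orthogonal to all
   eigenvectors on whose span the form has the sign \<sigma>. *)
lemma eigenvalue_count_ge:
  fixes Q :: "nat \<Rightarrow> nat \<Rightarrow> real" and d :: "nat \<Rightarrow> real" and \<sigma> :: real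
  assumes diag: "\<And>w. (\<Sum>i<N. \<Sum>j<N. Q i j * w i * w j) = (\<Sum>i<N. (d i - t) * (\<Sum>j<N. q i j * w j)\<^sup>2)"
    and fin: "finite A" "finite E"
    and sign: "\<And>x. \<exists>a\<in>A. x a \<noteq> 0 \<Longrightarrow> (\<And>e. e \<in> E \<Longrightarrow> (\<Sum>a\<in>A. c e a * x a) = 0) \<Longrightarrow>
      \<sigma> * (\<Sum>i<N. \<Sum>j<N. Q i j * (\<Sum>a\<in>A. v a i * x a) * (\<Sum>a\<in>A. v a j * x a)) > 0"
  shows "card A \<le> card E + card {i\<in>{..<N}. \<sigma> * (d i - t) > 0}"
proof (rule ccontr)
  let ?I = "{i\<in>{..<N}. \<sigma> * (d i - t) > 0}"
  assume "\<not> ?thesis"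
  then have lt: "card (E <+> ?I) < card A" using fin by (simp add: card_Plus)
  \<comment> \<open>A single linear system collects the constraints E and the vanishing of the
    coordinates q i whose coefficient has the sign \<sigma>.\<close>
  define C where "C z a = (case z of Inl e \<Rightarrow> c e a | Inr i \<Rightarrow> \<Sum>j<N. q i j * v a j)" for z a
  have "finite (E <+> ?I)" using fin by simp
  from homogeneous_system_nontrivial_solution[OF this fin(1) lt, of C]
  obtain x where x: "\<exists>a\<in>A. x a \<noteq> 0" "\<And>z. z \<in> E <+> ?I \<Longrightarrow> (\<Sum>a\<in>A. C z a * x a) = 0" by auto
  define w where "w i = (\<Sum>a\<in>A. v a i * x a)" for i
  have E: "(\<Sum>a\<in>A. c e a * x a) = 0" if "e \<in> E" for e using x(2)[OF InlI[OF that]] by (simp add: C_def)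
  have I: "(\<Sum>j<N. q i j * w j) = 0" if "i \<in> ?I" for i
  proof -
    have "(\<Sum>j<N. q i j * w j) = (\<Sum>a\<in>A. (\<Sum>j<N. q i j * v a j) * x a)"
      unfolding w_def sum_distrib_left sum_distrib_right by (subst sum.swap) (simp add: mult.assoc)
    then show ?thesis using x(2)[OF InrI[OF that]] by (simp add: C_def)
  qed
  have "0 < \<sigma> * (\<Sum>i<N. \<Sum>j<N. Q i j * w i * w j)" unfolding w_def by (rule sign[OF x(1) E])
  also have "\<dots> = (\<Sum>i<N. (\<sigma> * (d i - t)) * (\<Sum>j<N. q i j * w j)\<^sup>2)"
    unfolding diag by (simp add: sum_distrib_left mult.assoc)
  also have "\<dots> \<le> 0"
  proof (rule sum_nonpos)
    fix i assume "i \<in> {..<N}"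
    then show "(\<sigma> * (d i - t)) * (\<Sum>j<N. q i j * w j)\<^sup>2 \<le> 0"
      using I[of i] by (cases "\<sigma> * (d i - t) > 0") (auto intro: mult_nonpos_nonneg)
  qed
  finally show False by simp
qed

section \<open>Freezing the coefficient on blocks\<close>

text \<open>For a + p + 1 \<le> n this is the spline N_(a+p), with support from a / n to (a + p + 1)
  / n. The shift a counts mesh cells, so block l begins at a = l * S.\<close>

definition scaled_spline :: "nat \<Rightarrow> nat \<Rightarrow> nat \<Rightarrow> real \<Rightarrow> real" where
  "scaled_spline p n a x = cardinal_bspline p (real n * x - real a)"

text \<open>An everywhere defined version of the derivative, which for p = 1 does not exist at all
  grid points.\<close>

definition scaled_spline_deriv :: "nat \<Rightarrow> nat \<Rightarrow> nat \<Rightarrow> real \<Rightarrow> real" where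
  "scaled_spline_deriv p n a x = real n * cardinal_bspline_diff (p - 1) (real n * x - real a)"

lemma scaled_spline_eq_0:
  "real n * x < real a \<or> real n * x \<ge> real (a + p + 1) \<Longrightarrow> scaled_spline p n a x = 0"
  unfolding scaled_spline_def by (rule cardinal_bspline_eq_0) auto

lemma scaled_spline_deriv_eq_0:
  assumes "p \<ge> 1" "real n * x < real a \<or> real n * x \<ge> real (a + p + 1)"
  shows "scaled_spline_deriv p n a x = 0"
  using assms unfolding scaled_spline_deriv_def cardinal_bspline_diff_def
  by (auto simp: cardinal_bspline_eq_0)

lemma bounded_measurable_scaled_spline: "bounded_measurable (scaled_spline p n a)"
  by (rule bounded_measurable_borel[of _ 1])
    (auto simp: scaled_spline_def[abs_def] abs_le_iff cardinal_bspline_le_1 intro: order_trans[OF _ cardinal_bspline_nonneg])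

lemma bounded_measurable_scaled_spline_deriv: "bounded_measurable (scaled_spline_deriv p n a)"
proof (rule bounded_measurable_borel[of _ "real n * 2"])
  have "\<bar>cardinal_bspline_diff q y\<bar> \<le> 2" for q y
    using cardinal_bspline_le_1[of q y] cardinal_bspline_le_1[of q "y - 1"]
      cardinal_bspline_nonneg[of q y] cardinal_bspline_nonneg[of q "y - 1"]
    unfolding cardinal_bspline_diff_def by linarith
  then show "\<bar>scaled_spline_deriv p n a x\<bar> \<le> real n * 2" for x
    unfolding scaled_spline_deriv_def abs_mult by (intro mult_mono) auto
qed (auto simp: scaled_spline_deriv_def[abs_def] cardinal_bspline_diff_def[abs_def])

lemma integral_scaled:
  assumes f: "has_bochner_integral lborel f I" and z: "\<And>y. y \<notin> {0..real n} \<Longrightarrow> f y = 0" and n: "n \<ge> 1"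
  shows "integral {0..1} (\<lambda>x. f (real n * x)) = I / real n"
proof -
  have "has_bochner_integral lborel (\<lambda>x. f (0 + real n * x)) (I /\<^sub>R \<bar>real n\<bar>)"
    using f n by (subst lborel_has_bochner_integral_real_affine_iff[symmetric]) auto
  then have i: "integrable lborel (\<lambda>x. f (real n * x))" "integral\<^sup>L lborel (\<lambda>x. f (real n * x)) = I / real n"
    by (auto simp: has_bochner_integral_iff divide_inverse mult.commute)
  have "((\<lambda>x. f (real n * x)) has_integral I / real n) UNIV"
    using has_integral_integral_lborel[OF i(1)] i(2) by simp
  moreover have "f (real n * x) = 0" if "x \<notin> {0..1}" for x
  proof (rule z)
    show "real n * x \<notin> {0..real n}" using that n by (auto simp: zero_le_mult_iff)
  qed
  then have "(\<lambda>x. f (real n * x)) = (\<lambda>x. if x \<in> {0..1} then f (real n * x) else 0)" by auto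
  ultimately have "((\<lambda>x. if x \<in> {0..1} then f (real n * x) else 0) has_integral I / real n) UNIV" by metis
  then show ?thesis unfolding has_integral_restrict_UNIV by (rule integral_unique)
qed

text \<open>One factor supported in [0, 1] already makes the integral over [0, 1] equal to the one
  over the line, so only a is constrained.\<close>

lemma integral_scaled_spline:
  assumes "n \<ge> 1" "a + p + 1 \<le> n"
  shows "integral {0..1} (\<lambda>x. scaled_spline p n a x * scaled_spline p n b x) = gram p (int a - int b) / real n"
proof -
  have "integral {0..1} (\<lambda>x. (\<lambda>y. cardinal_bspline p (y - of_int (int a)) * cardinal_bspline p (y - of_int (int b))) (real n * x)) =
    gram p (int a - int b) / real n"
  proof (rule integral_scaled[OF has_bochner_integral_gram _ assms(1)])
    fix y assume "y \<notin> {0..real n}"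
    then have "cardinal_bspline p (y - real a) = 0" using assms by (intro cardinal_bspline_eq_0) auto
    then show "cardinal_bspline p (y - of_int (int a)) * cardinal_bspline p (y - of_int (int b)) = 0" by simp
  qed
  then show ?thesis by (simp add: scaled_spline_def)
qed

lemma integral_scaled_spline_deriv:
  assumes "p \<ge> 1" "n \<ge> 1" "a + p + 1 \<le> n"
  shows "integral {0..1} (\<lambda>x. scaled_spline_deriv p n a x * scaled_spline_deriv p n b x) =
    real n * stiff (p - 1) (int a - int b)"
proof -
  let ?D = "cardinal_bspline_diff (p - 1)"
  have "integral {0..1} (\<lambda>x. (\<lambda>y. ?D (y - of_int (int a)) * ?D (y - of_int (int b))) (real n * x)) =
    stiff (p - 1) (int a - int b) / real n"
  proof (rule integral_scaled[OF has_bochner_integral_stiff _ assms(2)])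
    fix y assume "y \<notin> {0..real n}"
    then have "?D (y - real a) = 0" using assms unfolding cardinal_bspline_diff_def by (auto simp: cardinal_bspline_eq_0)
    then show "?D (y - of_int (int a)) * ?D (y - of_int (int b)) = 0" by simp
  qed
  then have e: "integral {0..1} (\<lambda>x. ?D (real n * x - real a) * ?D (real n * x - real b)) =
    stiff (p - 1) (int a - int b) / real n" by simp
  have "integral {0..1} (\<lambda>x. scaled_spline_deriv p n a x * scaled_spline_deriv p n b x) =
    integral {0..1} (\<lambda>x. (real n * real n) * (?D (real n * x - real a) * ?D (real n * x - real b)))"
    by (simp add: scaled_spline_deriv_def mult_ac)
  also have "\<dots> = (real n * real n) * (stiff (p - 1) (int a - int b) / real n)"
    unfolding integral_mult_right e ..
  finally show ?thesis using assms(2) by simp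
qed

lemma deriv_bspline_uniform:
  assumes "n \<ge> 1" "p \<ge> 1" "a + p + 1 \<le> n" "real n * x \<notin> \<int>"
  shows "deriv (bspline n p p (a + p)) x = scaled_spline_deriv p n a x"
proof -
  obtain q where q: "p = Suc q" using assms(2) by (cases p) auto
  have eq: "bspline n p p (a + p) = (\<lambda>x. cardinal_bspline p (real n * x - real a))"
    using bspline_uniform[OF assms(1), of p "a + p" p] assms(3) by auto
  have ni: "real n * x - real a \<notin> \<int>"
  proof
    assume "real n * x - real a \<in> \<int>"
    then have "real n * x - real a + real a \<in> \<int>" by (intro Ints_add) auto
    with assms(4) show False by simp
  qed
  have "((\<lambda>x. cardinal_bspline p (real n * x - real a)) has_real_derivative
    cardinal_bspline_diff q (real n * x - real a) * real n) (at x)"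
    unfolding q cardinal_bspline_diff_def
    by (rule DERIV_chain2[where f = "cardinal_bspline (Suc q)" and g = "\<lambda>x. real n * x - real a",
          OF cardinal_bspline_has_derivative_nonint[OF ni]])
      (auto intro!: derivative_eq_intros)
  then show ?thesis unfolding eq by (simp add: DERIV_imp_deriv scaled_spline_deriv_def q mult.commute)
qed

lemma bounded_measurable_diff:
  assumes "bounded_measurable f" "bounded_measurable g"
  shows "bounded_measurable (\<lambda>x. f x - g x)"
  using bounded_measurable_add[OF assms(1) bounded_measurable_mult[OF bounded_measurable_const[of "- 1"] assms(2)]]
  by simp

lemma sum_power2_disjoint:
  fixes y :: "'a \<Rightarrow> real"
  assumes "finite A" "\<And>a b. a \<in> A \<Longrightarrow> b \<in> A \<Longrightarrow> a \<noteq> b \<Longrightarrow> y a * y b = 0"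
  shows "(\<Sum>a\<in>A. y a)\<^sup>2 = (\<Sum>a\<in>A. (y a)\<^sup>2)"
proof -
  have "(\<Sum>a\<in>A. y a)\<^sup>2 = (\<Sum>a\<in>A. \<Sum>b\<in>A. y a * y b)" by (simp add: power2_eq_square sum_product)
  also have "\<dots> = (\<Sum>a\<in>A. \<Sum>b\<in>A. if b = a then (y a)\<^sup>2 else 0)"
    by (intro sum.cong refl) (use assms in \<open>auto simp: power2_eq_square\<close>)
  also have "\<dots> = (\<Sum>a\<in>A. (y a)\<^sup>2)" using assms(1) by simp
  finally show ?thesis .
qed

(* Freezing the coefficient \<psi> at a point where \<sigma> \<psi> is maximal over the block. *)
lemma block_form_bound:
  fixes \<psi> u :: "_ \<Rightarrow> real" and \<sigma> t :: real
  assumes p: "p \<ge> 1" and n: "n \<ge> 1" and t: "t \<ge> 0" and \<sigma>: "\<sigma> = 1 \<or> \<sigma> = - 1"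
    and cont: "continuous_on {0..1} \<psi>" and pos: "\<And>x. x \<in> {0..1} \<Longrightarrow> \<psi> x > 0"
    and \<xi>: "\<xi> \<in> {0..1}" and max: "\<And>x. x \<in> {0..1} \<Longrightarrow> real s \<le> real n * x \<Longrightarrow> real n * x \<le> real s + real S \<Longrightarrow> \<sigma> * \<psi> x \<le> \<sigma> * \<psi> \<xi>"
    and J: "finite J" "\<And>j. j \<in> J \<Longrightarrow> j + p + 1 \<le> S" and sS: "s + S \<le> n"
  shows "\<sigma> * (integral {0..1} (\<lambda>x. 1 / \<psi> x * (\<Sum>j\<in>J. u j * scaled_spline_deriv p n (s + j) x)\<^sup>2) -
      (real n)\<^sup>2 * t * integral {0..1} (\<lambda>x. \<psi> x * (\<Sum>j\<in>J. u j * scaled_spline p n (s + j) x)\<^sup>2)) \<ge>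
    real n * (\<sigma> * (\<Sum>i\<in>J. \<Sum>j\<in>J. (stiff (p - 1) (int i - int j) / \<psi> \<xi> - t * \<psi> \<xi> * gram p (int i - int j)) * u i * u j))"
proof -
  define y where "y x = (\<Sum>j\<in>J. u j * scaled_spline_deriv p n (s + j) x)" for x
  define z where "z x = (\<Sum>j\<in>J. u j * scaled_spline p n (s + j) x)" for x
  have bm\<psi>: "bounded_measurable \<psi>" "bounded_measurable (\<lambda>x. 1 / \<psi> x)"
  proof -
    show "bounded_measurable \<psi>" by (rule bounded_measurable_continuous[OF cont])
    have "\<forall>x\<in>{0..1}. \<psi> x \<noteq> 0" using pos by force
    then show "bounded_measurable (\<lambda>x. 1 / \<psi> x)"
      by (intro bounded_measurable_continuous continuous_on_divide continuous_on_const cont)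
  qed
  have bmy: "bounded_measurable y" "bounded_measurable z"
    unfolding y_def[abs_def] z_def[abs_def]
    by (intro bounded_measurable_sum bounded_measurable_mult bounded_measurable_const
        bounded_measurable_scaled_spline bounded_measurable_scaled_spline_deriv)+
  have bm2: "bounded_measurable (\<lambda>x. (y x)\<^sup>2)" "bounded_measurable (\<lambda>x. (z x)\<^sup>2)"
    unfolding power2_eq_square by (intro bounded_measurable_mult bmy)+
  have lin: "integral {0..1} (\<lambda>x. \<sigma> * (F x - L * G x)) = \<sigma> * (integral {0..1} F - L * integral {0..1} G)"
    if "bounded_measurable F" "bounded_measurable G" for F G L
  proof -
    have "integral {0..1} (\<lambda>x. F x - L * G x) = integral {0..1} F - integral {0..1} (\<lambda>x. L * G x)"
      by (intro integral_diff bounded_measurable_integrable bounded_measurable_mult bounded_measurable_const that)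
    then show ?thesis by (simp add: integral_mult_right)
  qed
  let ?L = "(real n)\<^sup>2 * t"
  have iy: "integral {0..1} (\<lambda>x. (y x)\<^sup>2) = real n * (\<Sum>i\<in>J. \<Sum>j\<in>J. stiff (p - 1) (int i - int j) * u i * u j)"
  proof -
    have "integral {0..1} (\<lambda>x. (y x)\<^sup>2) = (\<Sum>a\<in>J. \<Sum>b\<in>J.
      integral {0..1} (\<lambda>x. 1 * scaled_spline_deriv p n (s + a) x * scaled_spline_deriv p n (s + b) x) * u a * u b)"
      using bilinear_form_integral[OF J(1) bounded_measurable_const[of 1],
          of "\<lambda>j. scaled_spline_deriv p n (s + j)" u] bounded_measurable_scaled_spline_deriv
      by (simp add: y_def)
    also have "\<dots> = (\<Sum>a\<in>J. \<Sum>b\<in>J. real n * stiff (p - 1) (int a - int b) * u a * u b)"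
    proof (intro sum.cong refl)
      fix a b assume "a \<in> J" "b \<in> J"
      then show "integral {0..1} (\<lambda>x. 1 * scaled_spline_deriv p n (s + a) x * scaled_spline_deriv p n (s + b) x) * u a * u b =
        real n * stiff (p - 1) (int a - int b) * u a * u b"
        using J(2)[of a] sS integral_scaled_spline_deriv[OF p n, of "s + a" "s + b"] by simp
    qed
    finally show ?thesis by (simp add: sum_distrib_left mult.assoc)
  qed
  \<comment> \<open>With the factor n on the left, n^2 t times the integral becomes n t times the
    Gram form and matches the factor n in \<open>iy\<close>.\<close>
  have iz: "real n * integral {0..1} (\<lambda>x. (z x)\<^sup>2) = (\<Sum>i\<in>J. \<Sum>j\<in>J. gram p (int i - int j) * u i * u j)"
  proof -
    have "integral {0..1} (\<lambda>x. (z x)\<^sup>2) = (\<Sum>a\<in>J. \<Sum>b\<in>J.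
      integral {0..1} (\<lambda>x. 1 * scaled_spline p n (s + a) x * scaled_spline p n (s + b) x) * u a * u b)"
      using bilinear_form_integral[OF J(1) bounded_measurable_const[of 1],
          of "\<lambda>j. scaled_spline p n (s + j)" u] bounded_measurable_scaled_spline
      by (simp add: z_def)
    also have "\<dots> = (\<Sum>a\<in>J. \<Sum>b\<in>J. gram p (int a - int b) * u a * u b / real n)"
    proof (intro sum.cong refl)
      fix a b assume "a \<in> J" "b \<in> J"
      then show "integral {0..1} (\<lambda>x. 1 * scaled_spline p n (s + a) x * scaled_spline p n (s + b) x) * u a * u b =
        gram p (int a - int b) * u a * u b / real n"
        using J(2)[of a] sS integral_scaled_spline[OF n, of "s + a" p "s + b"] by simp
    qed
    finally show ?thesis using n by (simp flip: sum_divide_distrib)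
  qed
  have pt: "\<sigma> * (1 / \<psi> \<xi> * (y x)\<^sup>2 - ?L * (\<psi> \<xi> * (z x)\<^sup>2)) \<le> \<sigma> * (1 / \<psi> x * (y x)\<^sup>2 - ?L * (\<psi> x * (z x)\<^sup>2))"
    if x: "x \<in> {0..1}" for x
  proof (cases "real s \<le> real n * x \<and> real n * x \<le> real s + real S")
    case True
    have m: "\<sigma> * \<psi> x \<le> \<sigma> * \<psi> \<xi>" using max x True by blast
    have ps: "\<psi> x > 0" "\<psi> \<xi> > 0" using pos x \<xi> by auto
    from \<sigma> show ?thesis
    proof
      assume s1: "\<sigma> = 1"
      have "1 / \<psi> \<xi> * (y x)\<^sup>2 \<le> 1 / \<psi> x * (y x)\<^sup>2" using m ps s1 by (intro mult_right_mono) (auto simp: frac_le)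
      moreover have "?L * (\<psi> x * (z x)\<^sup>2) \<le> ?L * (\<psi> \<xi> * (z x)\<^sup>2)"
        using m s1 t by (intro mult_left_mono mult_right_mono) auto
      ultimately show ?thesis using s1 by simp
    next
      assume s1: "\<sigma> = - 1"
      have "1 / \<psi> x * (y x)\<^sup>2 \<le> 1 / \<psi> \<xi> * (y x)\<^sup>2" using m ps s1 by (intro mult_right_mono) (auto simp: frac_le)
      moreover have "?L * (\<psi> \<xi> * (z x)\<^sup>2) \<le> ?L * (\<psi> x * (z x)\<^sup>2)"
        using m s1 t by (intro mult_left_mono mult_right_mono) auto
      ultimately show ?thesis using s1 by simp
    qed
  next
    case False
    have out: "real n * x < real (s + j) \<or> real n * x \<ge> real (s + j + p + 1)" if "j \<in> J" for j
      using False J(2)[OF that] by auto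
    have "y x = 0" unfolding y_def by (intro sum.neutral ballI) (use out p scaled_spline_deriv_eq_0 in auto)
    moreover have "z x = 0" unfolding z_def by (intro sum.neutral ballI) (use out scaled_spline_eq_0 in auto)
    ultimately show ?thesis by simp
  qed
  have "integral {0..1} (\<lambda>x. \<sigma> * (1 / \<psi> \<xi> * (y x)\<^sup>2 - ?L * (\<psi> \<xi> * (z x)\<^sup>2))) \<le>
    integral {0..1} (\<lambda>x. \<sigma> * (1 / \<psi> x * (y x)\<^sup>2 - ?L * (\<psi> x * (z x)\<^sup>2)))"
  proof (rule integral_le)
    show "(\<lambda>x. \<sigma> * (1 / \<psi> \<xi> * (y x)\<^sup>2 - ?L * (\<psi> \<xi> * (z x)\<^sup>2))) integrable_on {0..1}"
      by (intro bounded_measurable_integrable bounded_measurable_mult bounded_measurable_diff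
          bounded_measurable_const bm\<psi> bm2)
    show "(\<lambda>x. \<sigma> * (1 / \<psi> x * (y x)\<^sup>2 - ?L * (\<psi> x * (z x)\<^sup>2))) integrable_on {0..1}"
      by (intro bounded_measurable_integrable bounded_measurable_mult bounded_measurable_diff
          bounded_measurable_const bm\<psi> bm2)
  qed (rule pt)
  also have "\<dots> = \<sigma> * (integral {0..1} (\<lambda>x. 1 / \<psi> x * (y x)\<^sup>2) - ?L * integral {0..1} (\<lambda>x. \<psi> x * (z x)\<^sup>2))"
    by (rule lin) (intro bounded_measurable_mult bm\<psi> bm2)+
  also have "integral {0..1} (\<lambda>x. \<sigma> * (1 / \<psi> \<xi> * (y x)\<^sup>2 - ?L * (\<psi> \<xi> * (z x)\<^sup>2))) =
    \<sigma> * (1 / \<psi> \<xi> * integral {0..1} (\<lambda>x. (y x)\<^sup>2) - ?L * (\<psi> \<xi> * integral {0..1} (\<lambda>x. (z x)\<^sup>2)))"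
    unfolding lin[OF bounded_measurable_mult[OF bounded_measurable_const bm2(1)]
        bounded_measurable_mult[OF bounded_measurable_const bm2(2)]]
    by (simp only: integral_mult_right)
  also have "\<dots> = real n * (\<sigma> * (1 / \<psi> \<xi> * (\<Sum>i\<in>J. \<Sum>j\<in>J. stiff (p - 1) (int i - int j) * u i * u j) -
      t * \<psi> \<xi> * (\<Sum>i\<in>J. \<Sum>j\<in>J. gram p (int i - int j) * u i * u j)))"
    unfolding iy iz[symmetric] by (simp add: algebra_simps power2_eq_square)
  also have "1 / \<psi> \<xi> * (\<Sum>i\<in>J. \<Sum>j\<in>J. stiff (p - 1) (int i - int j) * u i * u j) -
      t * \<psi> \<xi> * (\<Sum>i\<in>J. \<Sum>j\<in>J. gram p (int i - int j) * u i * u j) =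
    (\<Sum>i\<in>J. \<Sum>j\<in>J. (stiff (p - 1) (int i - int j) / \<psi> \<xi> - t * \<psi> \<xi> * gram p (int i - int j)) * u i * u j)"
    by (simp add: left_diff_distrib sum_subtractf sum_distrib_left mult.assoc)
  finally show ?thesis unfolding y_def z_def .
qed

lemma toeplitz_symbol_frozen:
  assumes "p \<ge> 1"
  shows "toeplitz_symbol (\<lambda>d. stiff (p - 1) d / c - t * c * gram p d) p \<theta> = f_symbol p \<theta> / c - t * c * g_symbol p \<theta>"
proof -
  have "f_symbol p \<theta> = toeplitz_symbol (stiff (p - 1)) p \<theta>" using assms f_symbol_eq[of "p - 1"] by simp
  then show ?thesis
    unfolding g_symbol_eq toeplitz_symbol_def
    by (simp add: left_diff_distrib sum_subtractf sum_distrib_left sum_divide_distrib mult.assoc)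
qed

lemma C01_dphi:
  assumes "\<phi> \<in> C01"
  shows "continuous_on {0..1} (dphi \<phi>)" and "\<And>x. x \<in> {0..1} \<Longrightarrow> dphi \<phi> x > 0"
  using assms unfolding C01_def C2_on_def by (auto intro: differentiable_imp_continuous_on)

text \<open>Spline a + p belongs to row a + p - 1, since spline 0 is left out and rows count from
  0.\<close>

lemma mass_matrix_uniform_entry:
  assumes \<phi>: "\<phi> \<in> C01" and n: "n \<ge> 1" and p: "p \<ge> 1" and ab: "a + p + 1 \<le> n" "b + p + 1 \<le> n"
  shows "mass_matrix p \<phi> n $$ (a + p - 1, b + p - 1) =
    integral {0..1} (\<lambda>x. dphi \<phi> x * scaled_spline p n a x * scaled_spline p n b x)"
proof -
  have e: "bspline n p p (c + p) x = scaled_spline p n c x" if "c + p + 1 \<le> n" for c x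
    using bspline_uniform[OF n, of p "c + p" p x] that by (simp add: scaled_spline_def)
  have "mass_matrix p \<phi> n $$ (a + p - 1, b + p - 1) =
    integral {0..1} (\<lambda>x. \<bar>dphi \<phi> x\<bar> * bspline n p p (a + p) x * bspline n p p (b + p) x)"
    using ab p by (simp add: mass_matrix_def)
  also have "\<dots> = integral {0..1} (\<lambda>x. dphi \<phi> x * scaled_spline p n a x * scaled_spline p n b x)"
  proof (rule Henstock_Kurzweil_Integration.integral_cong)
    fix x :: real assume "x \<in> {0..1}"
    then have "dphi \<phi> x > 0" by (rule C01_dphi[OF \<phi>])
    then show "\<bar>dphi \<phi> x\<bar> * bspline n p p (a + p) x * bspline n p p (b + p) x =
      dphi \<phi> x * scaled_spline p n a x * scaled_spline p n b x"
      by (simp add: e[OF ab(1)] e[OF ab(2)])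
  qed
  finally show ?thesis .
qed

lemma stiffness_matrix_uniform_entry:
  assumes \<phi>: "\<phi> \<in> C01" and n: "n \<ge> 1" and p: "p \<ge> 1" and ab: "a + p + 1 \<le> n" "b + p + 1 \<le> n"
  shows "stiffness_matrix p \<phi> n $$ (a + p - 1, b + p - 1) =
    integral {0..1} (\<lambda>x. 1 / dphi \<phi> x * scaled_spline_deriv p n a x * scaled_spline_deriv p n b x)"
proof -
  have "stiffness_matrix p \<phi> n $$ (a + p - 1, b + p - 1) =
    integral {0..1} (\<lambda>x. 1 / \<bar>dphi \<phi> x\<bar> * deriv (bspline n p p (a + p)) x * deriv (bspline n p p (b + p)) x)"
    using ab p by (simp add: stiffness_matrix_def)
  also have "\<dots> = integral {0..1} (\<lambda>x. 1 / dphi \<phi> x * scaled_spline_deriv p n a x * scaled_spline_deriv p n b x)"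
  proof (rule integral_spike)
    \<comment> \<open>At the grid points the value of \<open>deriv\<close> is not controlled, but
      they are finitely many.\<close>
    show "negligible ((\<lambda>y. y / real n) ` (\<int> \<inter> {0..real n}))"
      by (intro negligible_finite finite_imageI finite_Ints_atLeastAtMost)
    fix x assume x: "x \<in> {0..1} - (\<lambda>y. y / real n) ` (\<int> \<inter> {0..real n})"
    then have pos: "dphi \<phi> x > 0" by (intro C01_dphi[OF \<phi>]) auto
    have "real n * x \<notin> \<int>"
    proof
      assume "real n * x \<in> \<int>"
      then have "real n * x \<in> \<int> \<inter> {0..real n}" using x n by (auto intro: mult_left_le)
      then have "(real n * x) / real n \<in> (\<lambda>y. y / real n) ` (\<int> \<inter> {0..real n})" by (rule imageI)
      with x n show False by simp
    qed
    with pos show "1 / dphi \<phi> x * scaled_spline_deriv p n a x * scaled_spline_deriv p n b x =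
      1 / \<bar>dphi \<phi> x\<bar> * deriv (bspline n p p (a + p)) x * deriv (bspline n p p (b + p)) x"
      by (simp add: deriv_bspline_uniform[OF n p ab(1)] deriv_bspline_uniform[OF n p ab(2)])
  qed
  finally show ?thesis .
qed

(* Splines belonging to different blocks have disjoint supports. *)
lemma blocks_form_eq:
  fixes u :: "nat \<Rightarrow> nat \<Rightarrow> real"
  assumes \<phi>: "\<phi> \<in> C01" and n: "n \<ge> 1" and p: "p \<ge> 1" and mS: "m * S \<le> n"
    and J: "finite J" "\<And>j. j \<in> J \<Longrightarrow> j + p + 1 \<le> S"
  defines "B \<equiv> {..<m} \<times> J"
  defines "\<iota> \<equiv> \<lambda>(l, j). l * S + j + p - 1"
  shows "(\<Sum>a\<in>B. \<Sum>b\<in>B. (stiffness_matrix p \<phi> n $$ (\<iota> a, \<iota> b) - t * mass_matrix p \<phi> n $$ (\<iota> a, \<iota> b)) *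
      u (fst a) (snd a) * u (fst b) (snd b)) =
    (\<Sum>l<m. integral {0..1} (\<lambda>x. 1 / dphi \<phi> x * (\<Sum>j\<in>J. u l j * scaled_spline_deriv p n (l * S + j) x)\<^sup>2) -
      t * integral {0..1} (\<lambda>x. dphi \<phi> x * (\<Sum>j\<in>J. u l j * scaled_spline p n (l * S + j) x)\<^sup>2))"
proof -
  let ?\<psi> = "dphi \<phi>"
  let ?o = "\<lambda>a. fst a * S + snd a"
  have fB: "finite B" using J by (simp add: B_def)
  have bm: "bounded_measurable ?\<psi>" "bounded_measurable (\<lambda>x. 1 / ?\<psi> x)"
  proof -
    show "bounded_measurable ?\<psi>" by (rule bounded_measurable_continuous[OF C01_dphi(1)[OF \<phi>]])
    have "\<forall>x\<in>{0..1}. ?\<psi> x \<noteq> 0" using C01_dphi(2)[OF \<phi>] by force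
    then show "bounded_measurable (\<lambda>x. 1 / ?\<psi> x)"
      by (intro bounded_measurable_continuous continuous_on_divide continuous_on_const C01_dphi(1)[OF \<phi>])
  qed
  have inB: "?o a + p + 1 \<le> n" if "a \<in> B" for a
  proof -
    have "Suc (fst a) * S \<le> m * S" using that by (intro mult_le_mono1) (auto simp: B_def)
    then show ?thesis using J(2)[of "snd a"] that mS by (auto simp: B_def)
  qed
  \<comment> \<open>Kept general in the weight F and the functions h, so that it serves the
    stiffness form and the mass form.\<close>
  have split: "integral {0..1} (\<lambda>x. F x * (\<Sum>a\<in>B. u (fst a) (snd a) * h (?o a) x)\<^sup>2) =
      (\<Sum>l<m. integral {0..1} (\<lambda>x. F x * (\<Sum>j\<in>J. u l j * h (l * S + j) x)\<^sup>2))"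
    if F: "bounded_measurable F" and h: "\<And>c. bounded_measurable (h c)"
      and h0: "\<And>c x. real n * x < real c \<or> real n * x \<ge> real (c + p + 1) \<Longrightarrow> h c x = 0"
    for F :: "real \<Rightarrow> real" and h :: "nat \<Rightarrow> real \<Rightarrow> real"
  proof -
    define y where "y l x = (\<Sum>j\<in>J. u l j * h (l * S + j) x)" for l x
    \<comment> \<open>With half-open blocks, neighbouring sums are never nonzero at a common point,
      and the cross terms vanish everywhere.\<close>
    have supp: "y l x = 0" if "\<not> (real (l * S) \<le> real n * x \<and> real n * x < real (Suc l * S))" for l x
      unfolding y_def
    proof (intro sum.neutral ballI)
      fix j assume j: "j \<in> J"
      have "real (l * S + j + p + 1) \<le> real (Suc l * S)" using J(2)[OF j] by (intro of_nat_mono) simp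
      moreover have "real (l * S) \<le> real (l * S + j)" by (intro of_nat_mono) simp
      ultimately have "h (l * S + j) x = 0" using that by (intro h0) linarith
      then show "u l j * h (l * S + j) x = 0" by simp
    qed
    have disj: "y l x * y k x = 0" if "l < k" for l k x
    proof -
      have "Suc l * S \<le> k * S" using that by (intro mult_le_mono1) simp
      then have "real (Suc l * S) \<le> real (k * S)" by (rule of_nat_mono)
      then have "\<not> (real n * x < real (Suc l * S)) \<or> \<not> (real (k * S) \<le> real n * x)" by linarith
      then have "y l x = 0 \<or> y k x = 0" using supp by blast
      then show ?thesis by auto
    qed
    have disj': "y l x * y k x = 0" if "l \<noteq> k" for l k x
      using disj[of l k x] disj[of k l x] that by (cases "l < k") (auto simp: mult.commute)
    have "(\<Sum>a\<in>B. u (fst a) (snd a) * h (?o a) x) = (\<Sum>l<m. y l x)" for x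
      unfolding B_def y_def by (simp add: sum.cartesian_product case_prod_beta)
    then have "(\<Sum>a\<in>B. u (fst a) (snd a) * h (?o a) x)\<^sup>2 = (\<Sum>l<m. (y l x)\<^sup>2)" for x
      using sum_power2_disjoint[of "{..<m}" "\<lambda>l. y l x", OF _ disj'] by simp
    then have "integral {0..1} (\<lambda>x. F x * (\<Sum>a\<in>B. u (fst a) (snd a) * h (?o a) x)\<^sup>2) =
      integral {0..1} (\<lambda>x. \<Sum>l<m. F x * (y l x)\<^sup>2)" by (simp add: sum_distrib_left)
    also have "\<dots> = (\<Sum>l<m. integral {0..1} (\<lambda>x. F x * (y l x)\<^sup>2))"
    proof (rule integral_sum)
      fix l
      have "bounded_measurable (y l)" unfolding y_def[abs_def]
        by (intro bounded_measurable_sum bounded_measurable_mult bounded_measurable_const h)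
      then show "(\<lambda>x. F x * (y l x)\<^sup>2) integrable_on {0..1}"
        unfolding power2_eq_square by (intro bounded_measurable_integrable bounded_measurable_mult F)
    qed simp
    finally show ?thesis by (simp add: y_def)
  qed
  have K: "stiffness_matrix p \<phi> n $$ (\<iota> a, \<iota> b) =
      integral {0..1} (\<lambda>x. 1 / ?\<psi> x * scaled_spline_deriv p n (?o a) x * scaled_spline_deriv p n (?o b) x)"
    if "a \<in> B" "b \<in> B" for a b
    using stiffness_matrix_uniform_entry[OF \<phi> n p inB[OF that(1)] inB[OF that(2)]]
    by (simp add: \<iota>_def case_prod_beta)
  have M: "mass_matrix p \<phi> n $$ (\<iota> a, \<iota> b) =
      integral {0..1} (\<lambda>x. ?\<psi> x * scaled_spline p n (?o a) x * scaled_spline p n (?o b) x)"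
    if "a \<in> B" "b \<in> B" for a b
    using mass_matrix_uniform_entry[OF \<phi> n p inB[OF that(1)] inB[OF that(2)]]
    by (simp add: \<iota>_def case_prod_beta)
  let ?u = "\<lambda>a. u (fst a) (snd a)"
  have "(\<Sum>a\<in>B. \<Sum>b\<in>B. (stiffness_matrix p \<phi> n $$ (\<iota> a, \<iota> b) - t * mass_matrix p \<phi> n $$ (\<iota> a, \<iota> b)) * ?u a * ?u b) =
    (\<Sum>a\<in>B. \<Sum>b\<in>B. stiffness_matrix p \<phi> n $$ (\<iota> a, \<iota> b) * ?u a * ?u b) -
    t * (\<Sum>a\<in>B. \<Sum>b\<in>B. mass_matrix p \<phi> n $$ (\<iota> a, \<iota> b) * ?u a * ?u b)"
    by (simp add: left_diff_distrib sum_subtractf sum_distrib_left mult.assoc)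
  also have "(\<Sum>a\<in>B. \<Sum>b\<in>B. stiffness_matrix p \<phi> n $$ (\<iota> a, \<iota> b) * ?u a * ?u b) =
    (\<Sum>a\<in>B. \<Sum>b\<in>B. integral {0..1} (\<lambda>x. 1 / ?\<psi> x * scaled_spline_deriv p n (?o a) x * scaled_spline_deriv p n (?o b) x) * ?u a * ?u b)"
    by (intro sum.cong refl) (simp only: K)
  also have "\<dots> = integral {0..1} (\<lambda>x. 1 / ?\<psi> x * (\<Sum>a\<in>B. ?u a * scaled_spline_deriv p n (?o a) x)\<^sup>2)"
    by (rule bilinear_form_integral[OF fB bm(2) bounded_measurable_scaled_spline_deriv])
  also have "\<dots> = (\<Sum>l<m. integral {0..1} (\<lambda>x. 1 / ?\<psi> x * (\<Sum>j\<in>J. u l j * scaled_spline_deriv p n (l * S + j) x)\<^sup>2))"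
    by (rule split[OF bm(2) bounded_measurable_scaled_spline_deriv scaled_spline_deriv_eq_0[OF p]])
  also have "(\<Sum>a\<in>B. \<Sum>b\<in>B. mass_matrix p \<phi> n $$ (\<iota> a, \<iota> b) * ?u a * ?u b) =
    (\<Sum>a\<in>B. \<Sum>b\<in>B. integral {0..1} (\<lambda>x. ?\<psi> x * scaled_spline p n (?o a) x * scaled_spline p n (?o b) x) * ?u a * ?u b)"
    by (intro sum.cong refl) (simp only: M)
  also have "\<dots> = integral {0..1} (\<lambda>x. ?\<psi> x * (\<Sum>a\<in>B. ?u a * scaled_spline p n (?o a) x)\<^sup>2)"
    by (rule bilinear_form_integral[OF fB bm(1) bounded_measurable_scaled_spline])
  also have "\<dots> = (\<Sum>l<m. integral {0..1} (\<lambda>x. ?\<psi> x * (\<Sum>j\<in>J. u l j * scaled_spline p n (l * S + j) x)\<^sup>2))"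
    by (rule split[OF bm(1) bounded_measurable_scaled_spline scaled_spline_eq_0])
  finally show ?thesis by (simp add: sum_subtractf sum_distrib_left)
qed

section \<open>Counting eigenvalues by positive cells\<close>

lemma negligible_support_of_integral_0:
  assumes bm: "bounded_measurable f" and nonneg: "\<And>x. x \<in> {0..1} \<Longrightarrow> f x \<ge> 0" and zero: "integral {0..1} f = 0"
  shows "negligible {x\<in>{0..1}. f x \<noteq> 0}"
proof -
  have int: "integrable (lebesgue_on {0..1}) f" by (rule bounded_measurable_integrable_lebesgue_on[OF bm])
  have "integral\<^sup>L (lebesgue_on {0..1}) f = 0"
    using lebesgue_integral_eq_integral[OF int] zero by simp
  moreover have "AE x in lebesgue_on {0..1}. 0 \<le> f x" by (rule AE_I2) (use nonneg in auto)
  ultimately have "AE x in lebesgue_on {0..1}. f x = 0"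
    using integral_nonneg_eq_0_iff_AE[OF int] by simp
  then have "AE x in lebesgue. x \<in> {0..1} \<longrightarrow> f x = 0"
    by (subst (asm) AE_restrict_space_iff) auto
  then obtain Z where Z: "{x \<in> space lebesgue. \<not> (x \<in> {0..1} \<longrightarrow> f x = 0)} \<subseteq> Z" "emeasure lebesgue Z = 0" "Z \<in> sets lebesgue"
    by (rule AE_E)
  then have "Z \<in> null_sets lebesgue" by auto
  then have "negligible Z" by (simp add: negligible_iff_null_sets)
  then show ?thesis by (rule negligible_subset) (use Z(1) in auto)
qed

text \<open>As phi' is positive, a vanishing form forces the spline to vanish almost everywhere, and
  independence applies. Here the boundary splines have to be included.\<close>

lemma mass_matrix_posdef:
  assumes \<phi>: "\<phi> \<in> C01" and n: "n \<ge> 1" and w: "\<exists>i<n + p - 2. w i \<noteq> 0"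
  shows "(\<Sum>i<n + p - 2. \<Sum>j<n + p - 2. mass_matrix p \<phi> n $$ (i, j) * w i * w j) > 0"
proof -
  let ?N = "n + p - 2" and ?\<psi> = "\<lambda>x. \<bar>dphi \<phi> x\<bar>"
  define s where "s x = (\<Sum>i<?N. w i * bspline n p p (i + 1) x)" for x
  have bm\<psi>: "bounded_measurable ?\<psi>"
    by (intro bounded_measurable_continuous continuous_on_rabs C01_dphi(1)[OF \<phi>])
  have bms: "bounded_measurable s"
    unfolding s_def[abs_def]
    by (intro bounded_measurable_sum bounded_measurable_mult bounded_measurable_const bounded_measurable_bspline)
  have bm: "bounded_measurable (\<lambda>x. ?\<psi> x * (s x)\<^sup>2)"
    unfolding power2_eq_square by (intro bounded_measurable_mult bm\<psi> bms)
  have "(\<Sum>i<?N. \<Sum>j<?N. mass_matrix p \<phi> n $$ (i, j) * w i * w j) =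
    (\<Sum>i<?N. \<Sum>j<?N. integral {0..1} (\<lambda>x. ?\<psi> x * bspline n p p (i + 1) x * bspline n p p (j + 1) x) * w i * w j)"
    by (intro sum.cong refl) (simp add: mass_matrix_def)
  also have "\<dots> = integral {0..1} (\<lambda>x. ?\<psi> x * (s x)\<^sup>2)"
    unfolding s_def
    by (rule bilinear_form_integral[OF finite_lessThan bm\<psi> bounded_measurable_bspline])
  finally have eq: "(\<Sum>i<?N. \<Sum>j<?N. mass_matrix p \<phi> n $$ (i, j) * w i * w j) = integral {0..1} (\<lambda>x. ?\<psi> x * (s x)\<^sup>2)" .
  have "integral {0..1} (\<lambda>x. ?\<psi> x * (s x)\<^sup>2) \<ge> 0"
    by (intro Henstock_Kurzweil_Integration.integral_nonneg bounded_measurable_integrable bm) auto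
  moreover have "integral {0..1} (\<lambda>x. ?\<psi> x * (s x)\<^sup>2) \<noteq> 0"
  proof
    assume "integral {0..1} (\<lambda>x. ?\<psi> x * (s x)\<^sup>2) = 0"
    then have "negligible {x\<in>{0..1}. ?\<psi> x * (s x)\<^sup>2 \<noteq> 0}"
      by (intro negligible_support_of_integral_0[OF bm]) auto
    moreover have "{x\<in>{0..1}. ?\<psi> x * (s x)\<^sup>2 \<noteq> 0} = {x\<in>{0..1}. s x \<noteq> 0}"
      using C01_dphi(2)[OF \<phi>] by force
    ultimately have "negligible {x\<in>{0..1}. s x \<noteq> 0}" by simp
    then have "w i = 0" if "i < ?N" for i
      unfolding s_def by (rule bspline_independent[OF n _ that])
    with w show False by auto
  qed
  ultimately show ?thesis unfolding eq by simp
qed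

lemma transpose_symmetric_mat:
  "(\<And>i j. f (i, j) = f (j, i)) \<Longrightarrow> transpose_mat (Matrix.mat N N f) = Matrix.mat N N f"
  by (rule eq_matI) auto

lemma eigenvalues_L_decomposition:
  assumes \<phi>: "\<phi> \<in> C01" and n: "n \<ge> 1"
  obtains d :: "nat \<Rightarrow> real" and q :: "nat \<Rightarrow> nat \<Rightarrow> real"
  where "eigenvalues_L p \<phi> n = image_mset d (mset_set {..<n + p - 2})"
    and "\<And>t w. (\<Sum>i<n + p - 2. \<Sum>j<n + p - 2. (stiffness_matrix p \<phi> n $$ (i, j) - t * mass_matrix p \<phi> n $$ (i, j)) * w i * w j) =
      (\<Sum>i<n + p - 2. (d i - t) * (\<Sum>j<n + p - 2. q i j * w j)\<^sup>2)"
proof -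
  have M: "mass_matrix p \<phi> n \<in> carrier_mat (n + p - 2) (n + p - 2)"
    "transpose_mat (mass_matrix p \<phi> n) = mass_matrix p \<phi> n"
    unfolding mass_matrix_def by (rule mat_carrier, rule transpose_symmetric_mat) (simp only: prod.case mult_ac)
  have K: "stiffness_matrix p \<phi> n \<in> carrier_mat (n + p - 2) (n + p - 2)"
    "transpose_mat (stiffness_matrix p \<phi> n) = stiffness_matrix p \<phi> n"
    unfolding stiffness_matrix_def by (rule mat_carrier, rule transpose_symmetric_mat) (simp only: prod.case mult_ac)
  obtain d q where dq: "proots (char_poly (the (mat_inverse (mass_matrix p \<phi> n)) * stiffness_matrix p \<phi> n)) =
      image_mset d (mset_set {..<n + p - 2})"
    "\<And>t w. (\<Sum>i<n + p - 2. \<Sum>j<n + p - 2. (stiffness_matrix p \<phi> n $$ (i, j) - t * mass_matrix p \<phi> n $$ (i, j)) * w i * w j) =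
      (\<Sum>i<n + p - 2. (d i - t) * (\<Sum>j<n + p - 2. q i j * w j)\<^sup>2)"
    by (rule pencil_spectral_decomposition[OF M K mass_matrix_posdef[OF \<phi> n]]) auto
  show ?thesis
    by (rule that[of d q]) (simp_all only: eigenvalues_L_def L_matrix_def dq)
qed

(* \<sigma> = 1 is used to count eigenvalues above n^2 t, \<sigma> = -1 to count those below. *)
definition positive_cells ::
  "nat \<Rightarrow> (real \<Rightarrow> real) \<Rightarrow> real \<Rightarrow> real \<Rightarrow> nat \<Rightarrow> nat \<Rightarrow> (nat \<Rightarrow> real) \<Rightarrow> (nat \<times> nat) set" where
  "positive_cells p \<psi> \<sigma> t S m \<xi> = {(l, k). l < m \<and> k \<in> {1..<S} \<and>
     \<sigma> * (f_symbol p (real k * pi / real S) / \<psi> (\<xi> l) - t * \<psi> (\<xi> l) * g_symbol p (real k * pi / real S)) > 0}"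

lemma finite_positive_cells: "finite (positive_cells p \<psi> \<sigma> t S m \<xi>)"
  by (rule finite_subset[of _ "{..<m} \<times> {1..<S}"]) (auto simp: positive_cells_def)

lemma card_positive_cells_le:
  assumes \<phi>: "\<phi> \<in> C01" and n: "n \<ge> 1" and p: "p \<ge> 1" and S: "S \<ge> 1" and mS: "m * S \<le> n"
    and t: "t \<ge> 0" and \<sigma>: "\<sigma> = 1 \<or> \<sigma> = - 1"
    and \<xi>: "\<And>l. l < m \<Longrightarrow> \<xi> l \<in> {0..1}"
    and max: "\<And>l x. l < m \<Longrightarrow> x \<in> {0..1} \<Longrightarrow> real (l * S) \<le> real n * x \<Longrightarrow> real n * x \<le> real (l * S) + real S \<Longrightarrow>
      \<sigma> * dphi \<phi> x \<le> \<sigma> * dphi \<phi> (\<xi> l)"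
    and diag: "\<And>w. (\<Sum>i<n + p - 2. \<Sum>j<n + p - 2. (stiffness_matrix p \<phi> n $$ (i, j) -
        ((real n)\<^sup>2 * t) * mass_matrix p \<phi> n $$ (i, j)) * w i * w j) =
      (\<Sum>i<n + p - 2. (d i - (real n)\<^sup>2 * t) * (\<Sum>j<n + p - 2. q i j * w j)\<^sup>2)"
  shows "card (positive_cells p (dphi \<phi>) \<sigma> t S m \<xi>) \<le> m * (2 * p) + card {i\<in>{..<n + p - 2}. \<sigma> * (d i - (real n)\<^sup>2 * t) > 0}"
proof -
  define N where "N = n + p - 2"
  define A where "A = positive_cells p (dphi \<phi>) \<sigma> t S m \<xi>"
  define Q where "Q i j = stiffness_matrix p \<phi> n $$ (i, j) - ((real n)\<^sup>2 * t) * mass_matrix p \<phi> n $$ (i, j)" for i j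
  define \<theta> where "\<theta> k = real k * pi / real S" for k
  define J where "J = {p + 1..<S - p}"
  define E where "E = {..<m} \<times> ({1..p} \<union> {S - p..<S})"
  define B where "B = {..<m} \<times> J"
  define \<iota> where "\<iota> = (\<lambda>(l, j). l * S + j + p - 1)"
  define c where "c e a = (if fst a = fst e then sin (real (snd e) * \<theta> (snd a)) else 0)" for e a :: "nat \<times> nat"
  \<comment> \<open>Row i holds position (i + 1 - p) mod S of block (i + 1 - p) div S, which inverts
    \<iota>. Rows with i + 1 < p belong to boundary splines and are cut off before the truncated
    subtraction.\<close>
  define v where "v a i = (if p \<le> i + 1 then c ((i + 1 - p) div S, (i + 1 - p) mod S) a else 0)" for a :: "nat \<times> nat" and i
  have finA: "finite A" by (simp add: A_def finite_positive_cells)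
  have finE: "finite E" by (simp add: E_def)
  have finJ: "finite J" by (simp add: J_def)
  have sign: "\<sigma> * (\<Sum>i<N. \<Sum>j<N. Q i j * (\<Sum>a\<in>A. v a i * x a) * (\<Sum>a\<in>A. v a j * x a)) > 0"
    if x: "\<exists>a\<in>A. x a \<noteq> 0" and constr: "\<And>e. e \<in> E \<Longrightarrow> (\<Sum>a\<in>A. c e a * x a) = 0" for x
  proof -
    define u where "u l j = (\<Sum>a\<in>A. c (l, j) a * x a)" for l j
    define Al where "Al l = {k. (l, k) \<in> A}" for l
    have u_eq: "u l j = (\<Sum>k\<in>Al l. x (l, k) * sin (real j * \<theta> k))" for l j
    proof -
      have "u l j = (\<Sum>a\<in>Pair l ` Al l. c (l, j) a * x a)"
        unfolding u_def by (rule sum.mono_neutral_right[OF finA]) (auto simp: Al_def c_def)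
      also have "\<dots> = (\<Sum>k\<in>Al l. x (l, k) * sin (real j * \<theta> k))"
        by (subst sum.reindex) (auto simp: inj_on_def c_def mult.commute)
      finally show ?thesis .
    qed
    have Al: "Al l \<subseteq> {1..<S}" for l by (auto simp: Al_def A_def positive_cells_def)
    have u0: "u l j = 0" if "l < m" "j \<in> {1..<S} - J" for l j
      unfolding u_def using that by (intro constr) (auto simp: E_def J_def)
    \<comment> \<open>Position 0 of a block is not among the constraints, but every sine vanishes
      there.\<close>
    have u00: "u l 0 = 0" for l by (simp add: u_eq)
    have um: "u l j = 0" if "\<not> l < m" for l j
    proof -
      have "Al l = {}" using that by (auto simp: Al_def A_def positive_cells_def)
      then show ?thesis by (simp add: u_eq)
    qed
    define W where "W i = (if p \<le> i + 1 then u ((i + 1 - p) div S) ((i + 1 - p) mod S) else 0)" for i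
    have vW: "(\<Sum>a\<in>A. v a i * x a) = W i" for i by (simp add: v_def W_def u_def)
    have \<iota>_less: "\<iota> b < N" if bB: "b \<in> B" for b
    proof -
      obtain l j where b: "b = (l, j)" "l < m" "j + p < S" "j > p"
        using bB by (cases b) (auto simp: B_def J_def less_diff_conv)
      have "Suc l * S \<le> m * S" using b by (intro mult_le_mono1) simp
      then have "l * S + S \<le> n" using mS by simp
      then show ?thesis using b p by (simp add: \<iota>_def N_def)
    qed
    have \<iota>_inv: "(\<iota> (l, j) + 1 - p) div S = l" "(\<iota> (l, j) + 1 - p) mod S = j" "p \<le> \<iota> (l, j) + 1"
      if "(l, j) \<in> B" for l j
    proof -
      have "\<iota> (l, j) + 1 - p = l * S + j" "p \<le> \<iota> (l, j) + 1" "j < S"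
        using p that by (auto simp: \<iota>_def B_def J_def)
      then show "(\<iota> (l, j) + 1 - p) div S = l" "(\<iota> (l, j) + 1 - p) mod S = j" "p \<le> \<iota> (l, j) + 1"
        by (simp_all add: div_mult_self3 del: mult_Suc)
    qed
    have inj: "inj_on \<iota> B"
      by (rule inj_onI) (metis \<iota>_inv(1,2) surj_pair)
    have W_\<iota>: "W (\<iota> b) = u (fst b) (snd b)" if "b \<in> B" for b
      using \<iota>_inv[of "fst b" "snd b"] that by (simp add: W_def)
    \<comment> \<open>A row outside the image of B lies at a constrained position, at position 0,
      past the last block, or among the left boundary splines.\<close>
    have W0: "W i = 0" if "i < N" "i \<notin> \<iota> ` B" for i
    proof (cases "p \<le> i + 1")
      case True
      define l j where "l = (i + 1 - p) div S" and "j = (i + 1 - p) mod S"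
      have "i + 1 - p = l * S + j" by (simp add: l_def j_def)
      then have i: "i = \<iota> (l, j)" using True p by (simp add: \<iota>_def)
      have jS: "j < S" using S by (simp add: j_def)
      have "u l j = 0"
      proof (cases "l < m")
        case True
        have "(l, j) \<notin> B" using i that by auto
        then have "j \<notin> J" using True by (auto simp: B_def)
        then show ?thesis using u0[OF True, of j] u00[of l] jS by (cases "j = 0") auto
      qed (rule um)
      then show ?thesis using True by (simp add: W_def l_def j_def)
    qed (simp add: W_def)
    have "(\<Sum>i<N. \<Sum>j<N. Q i j * W i * W j) = (\<Sum>i\<in>\<iota> ` B. \<Sum>j\<in>\<iota> ` B. Q i j * W i * W j)"
    proof -
      have sub: "\<iota> ` B \<subseteq> {..<N}" using \<iota>_less by auto
      have "(\<Sum>j<N. Q i j * W i * W j) = (\<Sum>j\<in>\<iota> ` B. Q i j * W i * W j)" for i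
        by (rule sum.mono_neutral_right) (use sub W0 in auto)
      moreover have "(\<Sum>i<N. \<Sum>j\<in>\<iota> ` B. Q i j * W i * W j) = (\<Sum>i\<in>\<iota> ` B. \<Sum>j\<in>\<iota> ` B. Q i j * W i * W j)"
        by (rule sum.mono_neutral_right) (use sub W0 in auto)
      ultimately show ?thesis by simp
    qed
    also have "\<dots> = (\<Sum>a\<in>B. \<Sum>b\<in>B. Q (\<iota> a) (\<iota> b) * u (fst a) (snd a) * u (fst b) (snd b))"
      by (simp add: sum.reindex[OF inj] W_\<iota>)
    also have "\<dots> = (\<Sum>l<m. integral {0..1} (\<lambda>x. 1 / dphi \<phi> x * (\<Sum>j\<in>J. u l j * scaled_spline_deriv p n (l * S + j) x)\<^sup>2) -
      ((real n)\<^sup>2 * t) * integral {0..1} (\<lambda>x. dphi \<phi> x * (\<Sum>j\<in>J. u l j * scaled_spline p n (l * S + j) x)\<^sup>2))"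
      unfolding Q_def B_def \<iota>_def
      by (rule blocks_form_eq[OF \<phi> n p mS finJ]) (auto simp: J_def)
    finally have form: "(\<Sum>i<N. \<Sum>j<N. Q i j * W i * W j) = \<dots>" .
    define C where "C l k = stiff (p - 1) k / dphi \<phi> (\<xi> l) - t * dphi \<phi> (\<xi> l) * gram p k" for l k
    define T where "T l = \<sigma> * (\<Sum>i\<in>J. \<Sum>j\<in>J. C l (int i - int j) * u l i * u l j)" for l
    have bound: "real n * T l \<le> \<sigma> * (integral {0..1} (\<lambda>x. 1 / dphi \<phi> x * (\<Sum>j\<in>J. u l j * scaled_spline_deriv p n (l * S + j) x)\<^sup>2) -
      ((real n)\<^sup>2 * t) * integral {0..1} (\<lambda>x. dphi \<phi> x * (\<Sum>j\<in>J. u l j * scaled_spline p n (l * S + j) x)\<^sup>2))"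
      if l: "l < m" for l
      unfolding T_def C_def
    proof (rule block_form_bound[OF p n t \<sigma> C01_dphi[OF \<phi>] \<xi>[OF l] max[OF l] finJ])
      have "Suc l * S \<le> m * S" using l by (intro mult_le_mono1) simp
      then show "l * S + S \<le> n" using mS by simp
    qed (auto simp: J_def)
    have Ceven: "C l (- k) = C l k" for l k by (simp add: C_def stiff_even gram_even)
    have Cband: "C l k = 0" if "\<bar>k\<bar> > int p" for l k
      using that p stiff_eq_0[of "p - 1" k] gram_eq_0[of p k] by (simp add: C_def)
    have Csign: "\<sigma> * toeplitz_symbol (C l) p (real k * pi / real S) > 0" if "k \<in> Al l" for l k
      using that unfolding C_def[abs_def] toeplitz_symbol_frozen[OF p]
      by (simp add: Al_def A_def positive_cells_def)
    have z: "(\<Sum>k\<in>Al l. x (l, k) * sin (real j * (real k * pi / real S))) = 0"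
      if "l < m" "j \<in> {1..<S} - {p + 1..<S - p}" for l j
      using u0[of l j] that by (simp add: u_eq J_def \<theta>_def)
    have T_nonneg: "T l \<ge> 0" if "l < m" for l
      using toeplitz_form_sine_sign(1)[of "Al l" S "C l" p "\<lambda>k. x (l, k)" \<sigma>, OF Al Ceven Cband z[OF that] Csign]
      by (simp add: T_def u_eq J_def \<theta>_def)
    \<comment> \<open>One block with a nonzero coefficient suffices, because all other blocks
      contribute with the right sign or not at all.\<close>
    obtain l k where lk: "(l, k) \<in> A" "x (l, k) \<noteq> 0" using x by auto
    then have l: "l < m" by (simp add: A_def positive_cells_def)
    have T_pos: "T l > 0"
      using toeplitz_form_sine_sign(2)[of "Al l" S "C l" p "\<lambda>k. x (l, k)" \<sigma>, OF Al Ceven Cband z[OF l] Csign] lk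
      by (force simp: T_def u_eq J_def \<theta>_def Al_def)
    have "0 < real n * (\<Sum>l<m. T l)" using n T_pos T_nonneg l by (intro mult_pos_pos sum_pos2[of _ l]) auto
    also have "\<dots> \<le> \<sigma> * (\<Sum>i<N. \<Sum>j<N. Q i j * W i * W j)"
      unfolding form sum_distrib_left by (intro sum_mono) (use bound in auto)
    finally show ?thesis by (simp add: vW)
  qed
  have "card A \<le> card E + card {i\<in>{..<N}. \<sigma> * (d i - (real n)\<^sup>2 * t) > 0}"
    by (rule eigenvalue_count_ge[where Q = Q and q = q, OF _ finA finE sign])
      (use diag in \<open>auto simp: Q_def N_def\<close>)
  moreover have "card E \<le> m * (2 * p)"
  proof -
    have "card ({1..p} \<union> {S - p..<S}) \<le> card {1..p} + card {S - p..<S}" by (rule card_Un_le)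
    also have "\<dots> \<le> 2 * p" by simp
    finally show ?thesis unfolding E_def card_cartesian_product by simp
  qed
  ultimately show ?thesis unfolding A_def N_def by linarith
qed

section \<open>Measure of the positive cells\<close>

text \<open>The upper edges are omitted to fit half-open cells. The strict inequality makes
  membership stable under small displacements of the point.\<close>

definition level_set :: "nat \<Rightarrow> (real \<Rightarrow> real) \<Rightarrow> real \<Rightarrow> real \<Rightarrow> (real \<times> real) set" where
  "level_set p \<phi> \<sigma> t = {z \<in> {0..<1} \<times> {0..<pi}. \<sigma> * (omega p \<phi> z - t) > 0}"

lemma omega_sign_iff:
  assumes "\<phi> \<in> C01" "x \<in> {0..1}"
  shows "\<sigma> * (f_symbol p \<theta> / dphi \<phi> x - t * dphi \<phi> x * g_symbol p \<theta>) > 0 \<longleftrightarrow> \<sigma> * (omega p \<phi> (x, \<theta>) - t) > 0"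
proof -
  let ?c = "dphi \<phi> x" and ?g = "g_symbol p \<theta>"
  have c: "?c > 0" using C01_dphi(2)[OF assms] .
  have g: "?g > 0" by (rule g_symbol_pos)
  define P where "P = ?c * ?g"
  have P: "P > 0" using c g by (simp add: P_def)
  have "f_symbol p \<theta> / ?c - t * ?c * ?g = P * (omega p \<phi> (x, \<theta>) - t)"
    using c g by (simp add: P_def omega_def e_symbol_def field_simps power2_eq_square)
  then have "\<sigma> * (f_symbol p \<theta> / ?c - t * ?c * ?g) = P * (\<sigma> * (omega p \<phi> (x, \<theta>) - t))" by simp
  then show ?thesis using P by (simp only: zero_less_mult_iff) auto
qed

lemma continuous_on_omega:
  assumes "\<phi> \<in> C01"
  shows "continuous_on ({0..1} \<times> UNIV) (omega p \<phi>)"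
proof -
  have "continuous_on ({0..1} \<times> UNIV) (\<lambda>z. e_symbol p (snd z) / (dphi \<phi> (fst z))\<^sup>2)"
  proof (intro continuous_on_divide continuous_on_power)
    show "continuous_on ({0..1} \<times> UNIV) (\<lambda>z. e_symbol p (snd z))"
      by (rule continuous_on_compose2[OF continuous_on_e_symbol[of UNIV]]) (auto intro: continuous_intros)
    show "continuous_on ({0..1} \<times> UNIV) (\<lambda>z. dphi \<phi> (fst z))"
      by (rule continuous_on_compose2[OF C01_dphi(1)[OF assms]]) (auto intro!: continuous_on_fst continuous_on_id)
    show "\<forall>z\<in>{0..1} \<times> UNIV. (dphi \<phi> (fst z))\<^sup>2 \<noteq> 0"
      using C01_dphi(2)[OF assms] by force
  qed
  moreover have "omega p \<phi> = (\<lambda>z. e_symbol p (snd z) / (dphi \<phi> (fst z))\<^sup>2)"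
    by (auto simp: omega_def)
  ultimately show ?thesis by simp
qed

text \<open>Width S / n times height pi / S is the area pi / n, whatever S is, so counting cells
  measures area. The sampled frequency k pi / S is the omitted upper edge; k - 1 is meaningful
  because k \<ge> 1 in all uses.\<close>

definition cell :: "nat \<Rightarrow> nat \<Rightarrow> nat \<times> nat \<Rightarrow> (real \<times> real) set" where
  "cell n S = (\<lambda>(l, k). {real (l * S) / real n..<real (l * S + S) / real n} \<times>
     {real (k - 1) * pi / real S..<real k * pi / real S})"

lemma half_open_interval_index:
  fixes x :: real and i j :: nat
  assumes "real i \<le> x" "x < real i + 1" "real j \<le> x" "x < real j + 1"
  shows "i = j"
  using assms by linarith

lemma emeasure_cells:
  assumes n: "n \<ge> 1" and S: "S \<ge> 1" and A: "finite A" "\<And>l k. (l, k) \<in> A \<Longrightarrow> k \<ge> 1"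
  shows "(\<Union>a\<in>A. cell n S a) \<in> sets lborel"
    and "emeasure lborel (\<Union>a\<in>A. cell n S a) = ennreal (real (card A) * pi / real n)"
proof -
  have sets: "cell n S a \<in> sets lborel" for a
    unfolding cell_def by (cases a) (auto intro!: borel_Times)
  then show "(\<Union>a\<in>A. cell n S a) \<in> sets lborel" using A by auto
  have em: "emeasure lborel (cell n S (l, k)) = ennreal (pi / real n)" if "(l, k) \<in> A" for l k
  proof -
    have k: "k \<ge> 1" using A that by auto
    have "emeasure lborel (cell n S (l, k)) = emeasure (lborel \<Otimes>\<^sub>M lborel)
      ({real (l * S) / real n..<real (l * S + S) / real n} \<times> {real (k - 1) * pi / real S..<real k * pi / real S})"
      by (simp add: cell_def lborel_prod)
    also have "\<dots> = emeasure lborel {real (l * S) / real n..<real (l * S + S) / real n} *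
      emeasure lborel {real (k - 1) * pi / real S..<real k * pi / real S}"
      by (rule lborel.emeasure_pair_measure_Times) auto
    also have "emeasure lborel {real (l * S) / real n..<real (l * S + S) / real n} = ennreal (real S / real n)"
      using n by (subst emeasure_lborel_Ico) (auto simp: divide_right_mono diff_divide_distrib[symmetric])
    also have "emeasure lborel {real (k - 1) * pi / real S..<real k * pi / real S} = ennreal (pi / real S)"
    proof -
      have "real k * pi / real S - real (k - 1) * pi / real S = pi / real S"
        using k by (simp add: of_nat_diff left_diff_distrib diff_divide_distrib)
      moreover have "real (k - 1) * pi / real S \<le> real k * pi / real S"
        by (intro divide_right_mono mult_right_mono) auto
      ultimately show ?thesis by simp
    qed
    also have "ennreal (real S / real n) * ennreal (pi / real S) = ennreal (pi / real n)"
      using S by (simp add: ennreal_mult[symmetric])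
    finally show ?thesis .
  qed
  have disj: "disjoint_family_on (cell n S) A"
    unfolding disjoint_family_on_def
  proof (intro ballI impI)
    fix a b assume ab: "a \<in> A" "b \<in> A" "a \<noteq> b"
    obtain l k where a: "a = (l, k)" by (cases a)
    obtain l' k' where b: "b = (l', k')" by (cases b)
    have k: "k \<ge> 1" "k' \<ge> 1" using A ab a b by auto
    show "cell n S a \<inter> cell n S b = {}"
    proof (rule ccontr)
      assume "cell n S a \<inter> cell n S b \<noteq> {}"
      then obtain x \<theta> where z: "(x, \<theta>) \<in> cell n S (l, k)" "(x, \<theta>) \<in> cell n S (l', k')" using a b by auto
      have n0: "real n > 0" and S0: "real S > 0" using n S by auto
      have x: "real l \<le> x * real n / real S \<and> x * real n / real S < real l + 1"
        if "(x, \<theta>) \<in> cell n S (l, k)" for l k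
        using that n0 S0 by (auto simp: cell_def field_simps)
      have th: "real (k - 1) \<le> \<theta> * real S / pi \<and> \<theta> * real S / pi < real (k - 1) + 1"
        if "(x, \<theta>) \<in> cell n S (l, k)" "k \<ge> 1" for l k
        using that S0 by (auto simp: cell_def field_simps of_nat_diff)
      have "l = l'" using half_open_interval_index x[OF z(1)] x[OF z(2)] by blast
      moreover have "k - 1 = k' - 1" using half_open_interval_index th[OF z(1) k(1)] th[OF z(2) k(2)] by blast
      ultimately show False using ab a b k by auto
    qed
  qed
  have "emeasure lborel (\<Union>a\<in>A. cell n S a) = (\<Sum>a\<in>A. emeasure lborel (cell n S a))"
    using sets disj A by (intro sum_emeasure[symmetric]) auto
  also have "\<dots> = (\<Sum>a\<in>A. ennreal (pi / real n))" by (intro sum.cong) (auto simp: em)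
  also have "\<dots> = ennreal (real (card A) * pi / real n)"
    by (simp add: ennreal_of_nat_eq_real_of_nat ennreal_mult[symmetric])
  finally show "emeasure lborel (\<Union>a\<in>A. cell n S a) = ennreal (real (card A) * pi / real n)" .
qed

text \<open>The intersections of the tails increase to a set containing E. Only membership of single
  points is asked for, hence no uniformity in z.\<close>

lemma eventually_emeasure_gt:
  assumes U: "\<And>n. U n \<in> sets M" and E: "E \<in> sets M" and sub: "\<And>z. z \<in> E \<Longrightarrow> eventually (\<lambda>n. z \<in> U n) sequentially"
    and c: "c < emeasure M E"
  shows "eventually (\<lambda>n. c < emeasure M (U n)) sequentially"
proof -
  define V where "V n = (\<Inter>k\<in>{n..}. U k)" for n
  have V: "V n \<in> sets M" for n unfolding V_def by (intro sets.countable_INT') (use U in auto)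
  have inc: "incseq V" unfolding V_def incseq_def by auto
  have "(\<lambda>n. emeasure M (V n)) \<longlonglongrightarrow> emeasure M (\<Union>n. V n)"
    by (rule Lim_emeasure_incseq) (use V inc in auto)
  moreover have "E \<subseteq> (\<Union>n. V n)"
    using sub by (force simp: V_def eventually_sequentially)
  then have "emeasure M E \<le> emeasure M (\<Union>n. V n)"
    using V by (intro emeasure_mono) auto
  with c have "c < emeasure M (\<Union>n. V n)" by simp
  ultimately have "eventually (\<lambda>n. c < emeasure M (V n)) sequentially" by (rule order_tendstoD(1))
  then show ?thesis
  proof eventually_elim
    case (elim n)
    have "emeasure M (V n) \<le> emeasure M (U n)" by (rule emeasure_mono) (use U in \<open>auto simp: V_def\<close>)
    with elim show ?case by simp
  qed
qed

text \<open>In the cell containing z, the point where omega is sampled is within S / n and pi / S of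
  z in the two coordinates. By continuity the sign at z is eventually the sign at the
  sample.\<close>

lemma point_in_positive_cell:
  fixes S :: "nat \<Rightarrow> nat" and \<xi> :: "nat \<Rightarrow> nat \<Rightarrow> real"
  assumes \<phi>: "\<phi> \<in> C01" and S: "filterlim S at_top sequentially" "(\<lambda>n. real (S n) / real n) \<longlonglongrightarrow> 0"
    and \<xi>: "\<And>n l. l < n div S n \<Longrightarrow> \<xi> n l \<in> {0..1} \<and> real (l * S n) \<le> real n * \<xi> n l \<and> real n * \<xi> n l \<le> real (l * S n) + real (S n)"
    and z: "z \<in> level_set p \<phi> \<sigma> t"
  shows "eventually (\<lambda>n. z \<in> (\<Union>a\<in>positive_cells p (dphi \<phi>) \<sigma> t (S n) (n div S n) (\<xi> n). cell n (S n) a)) sequentially"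
proof -
  obtain x \<theta> where z_eq: "z = (x, \<theta>)" by (cases z)
  have x: "0 \<le> x" "x < 1" and th: "0 \<le> \<theta>" "\<theta> < pi" and pos: "\<sigma> * (omega p \<phi> (x, \<theta>) - t) > 0"
    using z by (auto simp: level_set_def z_eq)
  have cont: "continuous_on ({0..1} \<times> UNIV) (\<lambda>w. \<sigma> * (omega p \<phi> w - t))"
    by (intro continuous_intros continuous_on_omega[OF \<phi>])
  obtain \<delta> where \<delta>: "\<delta> > 0" "\<And>w. w \<in> {0..1} \<times> UNIV \<Longrightarrow> dist w (x, \<theta>) < \<delta> \<Longrightarrow>
      dist (\<sigma> * (omega p \<phi> w - t)) (\<sigma> * (omega p \<phi> (x, \<theta>) - t)) < \<sigma> * (omega p \<phi> (x, \<theta>) - t)"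
    using cont[unfolded continuous_on_iff, rule_format, of "(x, \<theta>)" "\<sigma> * (omega p \<phi> (x, \<theta>) - t)"] x pos by auto
  have near: "\<sigma> * (omega p \<phi> (x', \<theta>') - t) > 0" if "x' \<in> {0..1}" "\<bar>x' - x\<bar> < \<delta> / 2" "\<bar>\<theta>' - \<theta>\<bar> < \<delta> / 2" for x' \<theta>'
  proof -
    have "dist (x', \<theta>') (x, \<theta>) \<le> \<bar>x' - x\<bar> + \<bar>\<theta>' - \<theta>\<bar>"
      by (simp add: dist_Pair_Pair dist_real_def sqrt_sum_squares_le_sum_abs)
    then have "dist (x', \<theta>') (x, \<theta>) < \<delta>" using that by linarith
    then have "dist (\<sigma> * (omega p \<phi> (x', \<theta>') - t)) (\<sigma> * (omega p \<phi> (x, \<theta>) - t)) < \<sigma> * (omega p \<phi> (x, \<theta>) - t)"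
      using that by (intro \<delta>) auto
    then show ?thesis by (simp add: dist_real_def)
  qed
  have Sinf: "filterlim (\<lambda>n. real (S n)) at_top sequentially"
    by (rule filterlim_compose[OF filterlim_real_sequentially S(1)])
  have piS: "(\<lambda>n. pi / real (S n)) \<longlonglongrightarrow> 0"
    by (rule tendsto_divide_0[OF tendsto_const filterlim_at_top_imp_at_infinity[OF Sinf]])
  \<comment> \<open>The bound 1 - x keeps the block of x among the n div S complete ones; in the
    same way pi - \<theta> below keeps k < S.\<close>
  define \<eta> where "\<eta> = min (\<delta> / 2) (1 - x)"
  have \<eta>: "\<eta> > 0" using \<delta> x by (simp add: \<eta>_def)
  have "eventually (\<lambda>n. real (S n) / real n < \<eta>) sequentially" by (rule order_tendstoD(2)[OF S(2) \<eta>])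
  moreover have "eventually (\<lambda>n. pi / real (S n) < min (\<delta> / 2) (pi - \<theta>)) sequentially"
    by (rule order_tendstoD(2)[OF piS]) (use \<delta> th in auto)
  moreover have "eventually (\<lambda>n. S n \<ge> 1) sequentially" using S(1) by (simp add: filterlim_at_top)
  moreover have "eventually (\<lambda>n. n \<ge> (1::nat)) sequentially" by (rule eventually_ge_at_top)
  ultimately show ?thesis
  proof eventually_elim
    case (elim n)
    define s where "s = S n"
    have n0: "real n > 0" and s0: "real s > 0" using elim by (auto simp: s_def)
    have sn: "real s / real n < \<delta> / 2" "real s / real n < 1 - x" using elim by (auto simp: \<eta>_def s_def)
    have ps: "pi / real s < \<delta> / 2" "pi / real s < pi - \<theta>" using elim by (auto simp: s_def)
    define l where "l = nat \<lfloor>x * real n / real s\<rfloor>"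
    define \<kappa> where "\<kappa> = nat \<lfloor>\<theta> * real s / pi\<rfloor>"
    \<comment> \<open>Cell k covers the frequencies from (k - 1) pi / S to k pi / S.\<close>
    define k where "k = Suc \<kappa>"
    have l: "real l \<le> x * real n / real s" "x * real n / real s < real l + 1"
      using x n0 s0 by (auto simp: l_def)
    have k: "real \<kappa> \<le> \<theta> * real s / pi" "\<theta> * real s / pi < real \<kappa> + 1"
      using th s0 by (auto simp: \<kappa>_def)
    have rk: "real k * pi = real \<kappa> * pi + pi" by (simp add: k_def distrib_right)
    have lx: "real (l * s) \<le> real n * x" "real n * x < real (l * s) + real s"
      using l s0 by (auto simp: field_simps)
    have kth: "real \<kappa> * pi \<le> \<theta> * real s" "\<theta> * real s < real k * pi"
      using k by (auto simp: field_simps k_def)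
    have lm: "l < n div s"
    proof -
      have "real s < (1 - x) * real n" using sn(2) n0 by (simp add: field_simps)
      then have "real (l * s) + real s < real n" using lx by (simp add: algebra_simps)
      then have "real (Suc l * s) \<le> real n" by (simp add: algebra_simps)
      then have "Suc l * s \<le> n" by (simp only: of_nat_le_iff)
      moreover have "0 < s" using s0 by simp
      ultimately have "Suc l \<le> n div s" by (simp only: less_eq_div_iff_mult_less_eq)
      then show ?thesis by simp
    qed
    have kS: "k \<in> {1..<s}"
    proof -
      have "pi < (pi - \<theta>) * real s" using ps(2) s0 by (simp add: field_simps)
      then have "real k * pi < real s * pi" using kth rk unfolding left_diff_distrib mult.commute[of pi] by linarith
      then have "k < s" by simp
      then show ?thesis by (simp add: k_def)
    qed
    have \<xi>': "\<xi> n l \<in> {0..1}" "real (l * s) \<le> real n * \<xi> n l" "real n * \<xi> n l \<le> real (l * s) + real s"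
      using \<xi>[of l n] lm by (auto simp: s_def)
    have "\<bar>real n * \<xi> n l - real n * x\<bar> \<le> real s" using \<xi>' lx by linarith
    then have "\<bar>\<xi> n l - x\<bar> * real n \<le> real s"
      unfolding right_diff_distrib[symmetric] abs_mult by (simp add: mult.commute)
    then have "\<bar>\<xi> n l - x\<bar> \<le> real s / real n" using n0 by (simp add: field_simps)
    then have d1: "\<bar>\<xi> n l - x\<bar> < \<delta> / 2" using sn(1) by linarith
    have "real k * pi / real s - \<theta> \<le> pi / real s"
      using kth(1) s0 unfolding rk by (simp add: field_simps)
    moreover have "\<theta> \<le> real k * pi / real s" using kth(2) s0 by (simp add: field_simps)
    ultimately
    have d2: "\<bar>real k * pi / real s - \<theta>\<bar> < \<delta> / 2" using ps(1) by linarith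
    have "\<sigma> * (omega p \<phi> (\<xi> n l, real k * pi / real s) - t) > 0" by (rule near[OF \<xi>'(1) d1 d2])
    then have "(l, k) \<in> positive_cells p (dphi \<phi>) \<sigma> t (S n) (n div S n) (\<xi> n)"
      using omega_sign_iff[OF \<phi> \<xi>'(1)] lm kS by (auto simp: positive_cells_def s_def)
    moreover have "z \<in> cell n (S n) (l, k)"
      using lx kth n0 s0 by (auto simp: cell_def z_eq s_def[symmetric] k_def field_simps)
    ultimately show ?case by blast
  qed
qed

section \<open>The asymptotic eigenvalue distribution\<close>

lemma omega_level_open:
  assumes "\<phi> \<in> C01"
  shows "\<exists>T. open T \<and> {z \<in> {0..1} \<times> UNIV. \<sigma> * (omega p \<phi> z - t) > 0} = ({0..1} \<times> UNIV) \<inter> T"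
proof -
  have c: "continuous_on ({0..1} \<times> UNIV) (\<lambda>w. \<sigma> * (omega p \<phi> w - t))"
    by (intro continuous_intros continuous_on_omega[OF assms])
  have "openin (top_of_set ({0..1} \<times> UNIV)) (({0..1} \<times> UNIV) \<inter> (\<lambda>w. \<sigma> * (omega p \<phi> w - t)) -` {0<..})"
    by (rule continuous_openin_preimage_gen[OF c open_greaterThan])
  then obtain T where T: "open T" "({0..1} \<times> UNIV) \<inter> (\<lambda>w. \<sigma> * (omega p \<phi> w - t)) -` {0<..} = ({0..1} \<times> UNIV) \<inter> T"
    unfolding openin_open by blast
  have eq: "{z \<in> {0..1} \<times> UNIV. \<sigma> * (omega p \<phi> z - t) > 0} = ({0..1} \<times> UNIV) \<inter> (\<lambda>w. \<sigma> * (omega p \<phi> w - t)) -` {0<..}"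
    unfolding vimage_def greaterThan_iff by (simp only: Collect_conj_eq Collect_mem_eq)
  show ?thesis unfolding eq T(2) by (intro exI[of _ T] conjI T(1) refl)
qed

lemma sets_level_set:
  assumes "\<phi> \<in> C01"
  shows "level_set p \<phi> \<sigma> t \<in> sets borel"
proof -
  from omega_level_open[OF assms, of \<sigma> p t]
  obtain T where T: "open T \<and> {z \<in> {0..1} \<times> UNIV. \<sigma> * (omega p \<phi> z - t) > 0} = ({0..1} \<times> UNIV) \<inter> T" ..
  note T = T[THEN conjunct1] T[THEN conjunct2]
  have "level_set p \<phi> \<sigma> t = ({0..<1} \<times> {0..<pi}) \<inter> {z \<in> {0..1} \<times> UNIV. \<sigma> * (omega p \<phi> z - t) > 0}"
    by (auto simp: level_set_def)
  also have "\<dots> = ({0..<1} \<times> {0..<pi}) \<inter> T" unfolding T(2) by auto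
  also have "\<dots> \<in> sets borel" using T(1) by (intro sets.Int borel_Times) auto
  finally show ?thesis .
qed

lemma emeasure_level_set_finite: "emeasure lborel (level_set p \<phi> \<sigma> t) < \<infinity>"
proof (rule emeasure_bounded_finite)
  have "bounded (cbox (0::real, 0::real) (1, pi))" by (rule bounded_cbox)
  then show "bounded (level_set p \<phi> \<sigma> t)"
    by (rule bounded_subset) (auto simp: level_set_def cbox_Pair_eq)
qed

lemma block_maximum_exists:
  assumes "\<phi> \<in> C01" "n \<ge> 1" "l < n div S"
  shows "\<exists>\<xi>. \<xi> \<in> {0..1} \<and> real (l * S) \<le> real n * \<xi> \<and> real n * \<xi> \<le> real (l * S) + real S \<and>
    (\<forall>x\<in>{0..1}. real (l * S) \<le> real n * x \<longrightarrow> real n * x \<le> real (l * S) + real S \<longrightarrow>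
      \<sigma> * dphi \<phi> x \<le> \<sigma> * dphi \<phi> \<xi>)"
proof -
  have n0: "real n > 0" using assms by simp
  have "Suc l \<le> n div S" using assms by simp
  then have "Suc l * S \<le> n div S * S" by (rule mult_le_mono1)
  also have "\<dots> \<le> n" by simp
  finally have le: "real (l * S) + real S \<le> real n" by (simp add: algebra_simps flip: of_nat_add of_nat_mult)
  let ?I = "{real (l * S) / real n..(real (l * S) + real S) / real n}"
  have I: "x \<in> ?I \<longleftrightarrow> real (l * S) \<le> real n * x \<and> real n * x \<le> real (l * S) + real S" for x
    using n0 by (simp add: field_simps)
  have sub: "?I \<subseteq> {0..1}"
  proof
    fix x assume x: "x \<in> ?I"
    have "0 \<le> real (l * S) / real n" "(real (l * S) + real S) / real n \<le> 1" using le n0 by (auto simp: field_simps)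
    with x show "x \<in> {0..1}" unfolding atLeastAtMost_iff by linarith
  qed
  have "continuous_on ?I (\<lambda>x. \<sigma> * dphi \<phi> x)"
    by (intro continuous_intros continuous_on_subset[OF C01_dphi(1)[OF assms(1)] sub])
  moreover have "?I \<noteq> {}" using n0 by (simp add: divide_right_mono)
  ultimately obtain \<xi> where "\<xi> \<in> ?I" "\<forall>x\<in>?I. \<sigma> * dphi \<phi> x \<le> \<sigma> * dphi \<phi> \<xi>"
    using continuous_attains_sup[of ?I "\<lambda>x. \<sigma> * dphi \<phi> x"] by auto
  then show ?thesis using sub I by blast
qed

lemma filterlim_floor_sqrt: "filterlim (\<lambda>n. nat \<lfloor>sqrt (real n)\<rfloor>) at_top sequentially"
  unfolding filterlim_at_top
proof
  fix Z :: nat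
  show "eventually (\<lambda>n. Z \<le> nat \<lfloor>sqrt (real n)\<rfloor>) sequentially"
    using eventually_ge_at_top[of "Z\<^sup>2"]
  proof eventually_elim
    case (elim n)
    then have "(real Z)\<^sup>2 \<le> real n" by (simp flip: of_nat_power)
    then have "real Z \<le> sqrt (real n)" by (rule real_le_rsqrt)
    then show ?case by (rule le_nat_floor)
  qed
qed

lemma floor_sqrt_ratio: "(\<lambda>n. real (nat \<lfloor>sqrt (real n)\<rfloor>) / real n) \<longlonglongrightarrow> 0"
proof (rule tendsto_sandwich[of "\<lambda>_. 0" _ _ "\<lambda>n. 1 / sqrt (real n)"])
  have "filterlim (\<lambda>n. sqrt (real n)) at_top sequentially"
    by (rule filterlim_compose[OF sqrt_at_top filterlim_real_sequentially])
  then show "(\<lambda>n. 1 / sqrt (real n)) \<longlonglongrightarrow> 0"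
    by (intro tendsto_divide_0[OF tendsto_const filterlim_at_top_imp_at_infinity])
  show "\<forall>\<^sub>F n in sequentially. real (nat \<lfloor>sqrt (real n)\<rfloor>) / real n \<le> 1 / sqrt (real n)"
    using eventually_ge_at_top[of "1 :: nat"]
  proof eventually_elim
    case (elim n)
    have "real (nat \<lfloor>sqrt (real n)\<rfloor>) \<le> sqrt (real n)" by (simp add: of_nat_floor)
    then have "real (nat \<lfloor>sqrt (real n)\<rfloor>) / real n \<le> sqrt (real n) / real n" by (rule divide_right_mono) simp
    also have "\<dots> = 1 / sqrt (real n)" using elim by (simp add: field_simps)
    finally show ?case .
  qed
qed auto

lemma size_filter_image_mset_set:
  "size (filter_mset P (image_mset d (mset_set {..<N :: nat}))) = card {i\<in>{..<N}. P (d i)}"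
  by (simp add: filter_mset_image_mset o_def)

lemma size_eigenvalues_L: "\<phi> \<in> C01 \<Longrightarrow> n \<ge> 1 \<Longrightarrow> size (eigenvalues_L p \<phi> n) = n + p - 2"
  by (rule eigenvalues_L_decomposition[of \<phi> n p]) auto

text \<open>After scaling by pi / n the constraints of all blocks cost at most 2 p pi / S, which
  tends to 0 (\<open>cards\<close>). What remains is the area of the positive cells.\<close>

lemma eigenvalue_counting_liminf:
  assumes \<phi>: "\<phi> \<in> C01" and p: "p \<ge> 1" and t: "t \<ge> 0" and \<sigma>: "\<sigma> = 1 \<or> \<sigma> = - 1"
    and c: "c < measure lborel (level_set p \<phi> \<sigma> t)"
  shows "\<forall>\<^sub>F n in sequentially.
    c < real (size {#l \<in># eigenvalues_L p \<phi> n. \<sigma> * (l - (real n)\<^sup>2 * t) > 0#}) * pi / real n"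
proof -
  define R where "R n = real (size {#l \<in># eigenvalues_L p \<phi> n. \<sigma> * (l - (real n)\<^sup>2 * t) > 0#}) * pi / real n" for n
  define S where "S n = nat \<lfloor>sqrt (real n)\<rfloor>" for n
  have S: "filterlim S at_top sequentially" "(\<lambda>n. real (S n) / real n) \<longlonglongrightarrow> 0"
    using filterlim_floor_sqrt floor_sqrt_ratio by (auto simp: S_def[abs_def])
  define P where "P n l x \<longleftrightarrow> x \<in> {0..1} \<and> real (l * S n) \<le> real n * x \<and> real n * x \<le> real (l * S n) + real (S n) \<and>
    (\<forall>y\<in>{0..1}. real (l * S n) \<le> real n * y \<longrightarrow> real n * y \<le> real (l * S n) + real (S n) \<longrightarrow>
      \<sigma> * dphi \<phi> y \<le> \<sigma> * dphi \<phi> x)" for n l x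
  define \<xi> where "\<xi> n l = (SOME x. P n l x)" for n l
  have P: "P n l (\<xi> n l)" if l: "l < n div S n" for n l
  proof -
    have "n \<ge> 1" using l by (cases n) auto
    from block_maximum_exists[OF \<phi> this l, of \<sigma>] have "\<exists>x. P n l x" by (simp only: P_def)
    then show ?thesis unfolding \<xi>_def by (rule someI_ex)
  qed
  have \<xi>: "\<xi> n l \<in> {0..1} \<and> real (l * S n) \<le> real n * \<xi> n l \<and> real n * \<xi> n l \<le> real (l * S n) + real (S n)"
    if "l < n div S n" for n l
    using P[OF that] unfolding P_def by blast
  have \<xi>max: "\<sigma> * dphi \<phi> x \<le> \<sigma> * dphi \<phi> (\<xi> n l)"
    if "l < n div S n" "x \<in> {0..1}" "real (l * S n) \<le> real n * x" "real n * x \<le> real (l * S n) + real (S n)" for n l x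
    using P[OF that(1)] that unfolding P_def by blast
  define A where "A n = positive_cells p (dphi \<phi>) \<sigma> t (S n) (n div S n) (\<xi> n)" for n
  \<comment> \<open>The empty set in the degenerate cases keeps U n measurable for every n.\<close>
  define U where "U n = (if S n \<ge> 1 \<and> n \<ge> 1 then (\<Union>a\<in>A n. cell n (S n) a) else {})" for n
  have finA: "finite (A n)" for n by (simp add: A_def finite_positive_cells)
  have Ak: "k \<ge> 1" if "(l, k) \<in> A n" for n l k using that by (auto simp: A_def positive_cells_def)
  have ev: "\<forall>\<^sub>F n in sequentially. S n \<ge> 1 \<and> n \<ge> 1"
    using S(1) eventually_ge_at_top[of "1::nat"] by (auto simp: filterlim_at_top intro: eventually_conj)
  have cards: "real (card (A n)) * pi / real n \<le> 2 * real p * pi / real (S n) + R n" if n: "S n \<ge> 1" "n \<ge> 1" for n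
  proof -
    obtain d q where dq: "eigenvalues_L p \<phi> n = image_mset d (mset_set {..<n + p - 2})"
      "\<And>t w. (\<Sum>i<n + p - 2. \<Sum>j<n + p - 2. (stiffness_matrix p \<phi> n $$ (i, j) - t * mass_matrix p \<phi> n $$ (i, j)) * w i * w j) =
      (\<Sum>i<n + p - 2. (d i - t) * (\<Sum>j<n + p - 2. q i j * w j)\<^sup>2)"
      by (rule eigenvalues_L_decomposition[OF \<phi> n(2), of p], rule that)
    define m where "m = n div S n"
    have mS: "m * S n \<le> n" by (simp add: m_def)
    have "card (A n) \<le> m * (2 * p) + card {i\<in>{..<n + p - 2}. \<sigma> * (d i - (real n)\<^sup>2 * t) > 0}"
      unfolding A_def m_def
      by (rule card_positive_cells_le[OF \<phi> n(2) p n(1) mS[unfolded m_def] t \<sigma> _ \<xi>max dq(2)]) (use \<xi> in auto)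
    then have "real (card (A n)) \<le> real (m * (2 * p)) + real (card {i\<in>{..<n + p - 2}. \<sigma> * (d i - (real n)\<^sup>2 * t) > 0})"
      by (simp flip: of_nat_add del: of_nat_mult)
    also have "card {i\<in>{..<n + p - 2}. \<sigma> * (d i - (real n)\<^sup>2 * t) > 0} =
      size {#l \<in># eigenvalues_L p \<phi> n. \<sigma> * (l - (real n)\<^sup>2 * t) > 0#}"
      unfolding dq(1) size_filter_image_mset_set ..
    finally have "real (card (A n)) * (pi / real n) \<le>
      (real (m * (2 * p)) + real (size {#l \<in># eigenvalues_L p \<phi> n. \<sigma> * (l - (real n)\<^sup>2 * t) > 0#})) * (pi / real n)"
      by (rule mult_right_mono) simp
    moreover have "real (m * (2 * p)) * (pi / real n) \<le> 2 * real p * pi / real (S n)"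
    proof -
      have "real m * real (S n) \<le> real n" using mS by (simp flip: of_nat_mult)
      then have "real m / real n \<le> 1 / real (S n)" using n by (simp add: field_simps)
      then have "(2 * real p * pi) * (real m / real n) \<le> (2 * real p * pi) * (1 / real (S n))"
        by (rule mult_left_mono) simp
      then show ?thesis by (simp add: mult_ac)
    qed
    ultimately show ?thesis by (simp add: R_def distrib_right add_divide_distrib)
  qed
  show ?thesis
  \<comment> \<open>A negative bound is trivial and cannot be expressed by
    \<open>ennreal\<close>.\<close>
  proof (cases "c < 0")
    case True
    have "c < R n" for n
    proof -
      have "R n \<ge> 0" by (simp add: R_def)
      with True show ?thesis by simp
    qed
    then show ?thesis by (simp add: R_def)
  next
    case False
    \<comment> \<open>The gap between c and c' pays for the constraints.\<close>
    obtain c' where c': "c < c'" "c' < measure lborel (level_set p \<phi> \<sigma> t)" using c dense by blast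
    have "emeasure lborel (level_set p \<phi> \<sigma> t) = ennreal (measure lborel (level_set p \<phi> \<sigma> t))"
      using emeasure_level_set_finite[of p \<phi> \<sigma> t] by (intro emeasure_eq_ennreal_measure) auto
    then have "ennreal c' < emeasure lborel (level_set p \<phi> \<sigma> t)" using c' False by (simp add: ennreal_less_iff)
    then have "\<forall>\<^sub>F n in sequentially. ennreal c' < emeasure lborel (U n)"
    proof (rule eventually_emeasure_gt[rotated 3])
      show "U n \<in> sets lborel" for n
        unfolding U_def using emeasure_cells(1)[OF _ _ finA Ak] by auto
      show "level_set p \<phi> \<sigma> t \<in> sets lborel" using sets_level_set[OF \<phi>] by simp
      fix z assume z: "z \<in> level_set p \<phi> \<sigma> t"
      have "\<forall>\<^sub>F n in sequentially. z \<in> (\<Union>a\<in>A n. cell n (S n) a)"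
        unfolding A_def by (rule point_in_positive_cell[OF \<phi> S _ z]) (rule \<xi>)
      then show "\<forall>\<^sub>F n in sequentially. z \<in> U n" using ev by eventually_elim (simp add: U_def)
    qed
    moreover have "(\<lambda>n. 2 * real p * pi / real (S n)) \<longlonglongrightarrow> 0"
      by (intro tendsto_divide_0[OF tendsto_const filterlim_at_top_imp_at_infinity]
          filterlim_compose[OF filterlim_real_sequentially S(1)])
    then have "\<forall>\<^sub>F n in sequentially. 2 * real p * pi / real (S n) < c' - c"
      by (rule order_tendstoD(2)) (use c' in simp)
    ultimately show ?thesis using ev
    proof eventually_elim
      case (elim n)
      have "emeasure lborel (U n) = ennreal (real (card (A n)) * pi / real n)"
        using elim(3) emeasure_cells(2)[OF _ _ finA Ak, of n "S n" n] by (simp add: U_def)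
      then have "c' < real (card (A n)) * pi / real n"
        using elim(1) c' False by (simp add: ennreal_less_iff)
      with cards[of n] elim show ?case by (simp add: R_def)
    qed
  qed
qed

section \<open>Null level sets and the distribution function of omega\<close>

lemma dphi_inj:
  assumes "\<phi> \<in> C01" "x \<in> {0..1}" "y \<in> {0..1}" "dphi \<phi> x = dphi \<phi> y"
  shows "x = y"
proof -
  have ne: "dphi \<phi> u \<noteq> dphi \<phi> v" if uv: "u \<in> {0..1}" "v \<in> {0..1}" "u < v" for u v
  proof -
    \<comment> \<open>At interior points the derivative relative to [0, 1] is the ordinary one, so
      the sign of phi'' gives strict monotonicity.\<close>
    have d: "(dphi \<phi> has_real_derivative deriv_on {0..1} (dphi \<phi>) w) (at w)" if w: "u < w" "w < v" for w
    proof -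
      have w01: "w \<in> {0..1}" "w \<in> interior {0..1}" using uv w by auto
      have "dphi \<phi> differentiable (at w within {0..1})"
        using assms(1) w01 by (auto simp: C01_def C2_on_def differentiable_on_def)
      then have "(dphi \<phi> has_vector_derivative deriv_on {0..1} (dphi \<phi>) w) (at w within {0..1})"
        unfolding deriv_on_def[of _ "dphi \<phi>"] by (rule vector_derivative_works[THEN iffD1])
      then show ?thesis
        using at_within_interior[OF w01(2)] by (simp add: has_real_derivative_iff_has_vector_derivative)
    qed
    have cont: "continuous_on {u..v} (dphi \<phi>)"
      by (rule continuous_on_subset[OF C01_dphi(1)[OF assms(1)]]) (use uv in auto)
    have "(\<forall>x\<in>{0..1}. deriv_on {0..1} (dphi \<phi>) x > 0) \<or> (\<forall>x\<in>{0..1}. deriv_on {0..1} (dphi \<phi>) x < 0)"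
      using assms(1) by (auto simp: C01_def)
    then show ?thesis
    proof
      assume pos: "\<forall>x\<in>{0..1}. deriv_on {0..1} (dphi \<phi>) x > 0"
      have "dphi \<phi> u < dphi \<phi> v"
      proof (rule DERIV_pos_imp_increasing_open[OF uv(3) _ cont])
        fix w assume w: "u < w" "w < v"
        show "\<exists>y. (dphi \<phi> has_real_derivative y) (at w) \<and> 0 < y"
          using d[OF w] pos uv w by (intro exI[of _ "deriv_on {0..1} (dphi \<phi>) w"]) auto
      qed
      then show ?thesis by simp
    next
      assume neg: "\<forall>x\<in>{0..1}. deriv_on {0..1} (dphi \<phi>) x < 0"
      have "dphi \<phi> u > dphi \<phi> v"
      proof (rule DERIV_neg_imp_decreasing_open[OF uv(3) _ cont])
        fix w assume w: "u < w" "w < v"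
        show "\<exists>y. (dphi \<phi> has_real_derivative y) (at w) \<and> y < 0"
          using d[OF w] neg uv w by (intro exI[of _ "deriv_on {0..1} (dphi \<phi>) w"]) auto
      qed
      then show ?thesis by simp
    qed
  qed
  show ?thesis using ne[of x y] ne[of y x] assms by (cases x y rule: linorder_cases) auto
qed

lemma continuous_on_omega_dom: "\<phi> \<in> C01 \<Longrightarrow> continuous_on omega_dom (omega p \<phi>)"
  by (rule continuous_on_subset[OF continuous_on_omega]) auto

(* For fixed \<theta> > 0 the symbol is injective in x. *)
lemma negligible_omega_level:
  assumes \<phi>: "\<phi> \<in> C01" and p: "p \<ge> 1"
  shows "negligible {z \<in> omega_dom. omega p \<phi> z = t}"
proof -
  define E where "E = {z \<in> omega_dom. omega p \<phi> z = t}"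
  have "closed E"
    unfolding E_def by (rule continuous_closed_preimage_constant[OF continuous_on_omega_dom[OF \<phi>]])
      (intro closed_Times closed_atLeastAtMost)
  then have E: "E \<in> sets borel" by (rule borel_closed)
  \<comment> \<open>At \<theta> = 0 omega vanishes identically and the section can be the whole
    interval; a single \<theta> is negligible.\<close>
  have sec: "emeasure lborel ((\<lambda>x. (x, \<theta>)) -` E) = 0" if "\<theta> \<noteq> 0" for \<theta> :: real
  proof -
    have "x = y" if xy: "x \<in> (\<lambda>x. (x, \<theta>)) -` E" "y \<in> (\<lambda>x. (x, \<theta>)) -` E" for x y
    proof -
      have xy: "x \<in> {0..1}" "y \<in> {0..1}" "0 \<le> \<theta>" "\<theta> \<le> pi"
        and eq: "e_symbol p \<theta> / (dphi \<phi> x)\<^sup>2 = e_symbol p \<theta> / (dphi \<phi> y)\<^sup>2"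
        using xy by (auto simp: E_def omega_def)
      have "e_symbol p \<theta> > 0" by (rule e_symbol_pos) (use p xy \<open>\<theta> \<noteq> 0\<close> in auto)
      moreover have pos: "dphi \<phi> x > 0" "dphi \<phi> y > 0" using C01_dphi(2)[OF \<phi>] xy by auto
      ultimately have "(dphi \<phi> x)\<^sup>2 = (dphi \<phi> y)\<^sup>2" using eq by (simp add: field_simps)
      then have "dphi \<phi> x = dphi \<phi> y" using pos by (simp add: power2_eq_iff_nonneg)
      then show ?thesis using dphi_inj[OF \<phi>] xy by blast
    qed
    then obtain w where "(\<lambda>x. (x, \<theta>)) -` E \<subseteq> {w}" by blast
    then have "finite ((\<lambda>x. (x, \<theta>)) -` E)" by (rule finite_subset) simp
    then show ?thesis by (rule emeasure_lborel_countable[OF countable_finite])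
  qed
  have Ep: "E \<in> sets (lborel \<Otimes>\<^sub>M lborel)" using E unfolding lborel_prod by simp
  have "emeasure lborel E = emeasure (lborel \<Otimes>\<^sub>M lborel) E" by (simp add: lborel_prod)
  also have "\<dots> = (\<integral>\<^sup>+\<theta>. emeasure lborel ((\<lambda>x. (x, \<theta>)) -` E) \<partial>lborel)"
    by (rule lborel_pair.emeasure_pair_measure_alt2[OF Ep])
  also have "\<dots> = (\<integral>\<^sup>+(\<theta>::real). 0 \<partial>lborel)"
  proof (rule nn_integral_cong_AE)
    have "AE \<theta> in lborel. \<theta> \<noteq> (0::real)" by (rule AE_lborel_singleton)
    then show "AE \<theta> in lborel. emeasure lborel ((\<lambda>x. (x, \<theta>)) -` E) = 0"
      by eventually_elim (rule sec)
  qed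
  finally have "emeasure lborel E = 0" by simp
  then have "E \<in> null_sets lborel" using E by auto
  then have "E \<in> null_sets lebesgue" by (rule null_sets_completionI)
  then show ?thesis by (simp add: negligible_iff_null_sets E_def)
qed

definition distribution :: "nat \<Rightarrow> (real \<Rightarrow> real) \<Rightarrow> real \<Rightarrow> real" where
  "distribution p \<phi> t = measure lebesgue {z \<in> omega_dom. omega p \<phi> z \<le> t} / pi"

lemma omega_dom_boundary_negligible: "negligible (omega_dom - {0..<1} \<times> {0..<pi})"
proof -
  have d: "(1::real, 0::real) \<in> Basis" "(0::real, 1::real) \<in> Basis" by (auto simp: Basis_prod_def)
  have "negligible ({z :: real \<times> real. z \<bullet> (1, 0) = 1} \<union> {z. z \<bullet> (0, 1) = pi})"
    by (intro negligible_Un negligible_standard_hyperplane d)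
  then show ?thesis by (rule negligible_subset) (auto simp: inner_prod_def)
qed

lemma omega_dom_eq_cbox: "omega_dom = cbox (0, 0) (1, pi)"
  by (auto simp: cbox_Pair_eq)

lemma measure_omega_dom: "measure lebesgue omega_dom = pi"
proof -
  have "measure lebesgue omega_dom = measure lborel (cbox (0::real, 0::real) (1, pi))"
    unfolding omega_dom_eq_cbox by simp
  also have "\<dots> = pi" by (subst content_Pair) auto
  finally show ?thesis .
qed

lemma lmeasurable_sublevel: "\<phi> \<in> C01 \<Longrightarrow> {z \<in> omega_dom. omega p \<phi> z \<le> t} \<in> lmeasurable"
proof -
  assume \<phi>: "\<phi> \<in> C01"
  have "closed {z \<in> omega_dom. omega p \<phi> z \<le> t}"
    using continuous_closed_preimage[OF continuous_on_omega_dom[OF \<phi>], of "{..t}" p]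
    by (auto simp: vimage_def Int_def closed_Times)
  moreover have "bounded {z \<in> omega_dom. omega p \<phi> z \<le> t}"
    by (rule bounded_subset[of omega_dom]) (auto simp: omega_dom_eq_cbox)
  ultimately have "compact {z \<in> omega_dom. omega p \<phi> z \<le> t}" by (simp add: compact_eq_bounded_closed)
  then show ?thesis by (rule lmeasurable_compact)
qed

text \<open>Passing between < t and \<le> t, and between half-open and closed rectangles, changes
  the sets by null sets. Hence the two measures add up to pi.\<close>

lemma measure_level_set:
  assumes \<phi>: "\<phi> \<in> C01" and p: "p \<ge> 1"
  shows "measure lborel (level_set p \<phi> (- 1) t) = pi * distribution p \<phi> t"
    and "measure lborel (level_set p \<phi> 1 t) = pi * (1 - distribution p \<phi> t)"
proof -
  let ?Q = "{z \<in> omega_dom. omega p \<phi> z \<le> t}"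
  have conv: "measure lborel (level_set p \<phi> \<sigma> t) = measure lebesgue (level_set p \<phi> \<sigma> t)" for \<sigma>
    using sets_level_set[OF \<phi>] by (simp add: measure_completion)
  have "measure lebesgue (level_set p \<phi> (- 1) t) = measure lebesgue ?Q"
  proof (rule measure_negligible_symdiff)
    show "?Q \<in> lmeasurable" by (rule lmeasurable_sublevel[OF \<phi>])
    show "negligible (?Q - level_set p \<phi> (- 1) t \<union> (level_set p \<phi> (- 1) t - ?Q))"
      by (rule negligible_subset[OF negligible_Un[OF negligible_omega_level[OF \<phi> p, of t] omega_dom_boundary_negligible]])
        (auto simp: level_set_def)
  qed
  then show 1: "measure lborel (level_set p \<phi> (- 1) t) = pi * distribution p \<phi> t"
    by (simp add: conv distribution_def)
  have Q: "?Q \<in> lmeasurable" by (rule lmeasurable_sublevel[OF \<phi>])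
  have D: "omega_dom \<in> lmeasurable" by (simp add: omega_dom_eq_cbox)
  have "measure lebesgue (level_set p \<phi> 1 t) = measure lebesgue (omega_dom - ?Q)"
  proof (rule measure_negligible_symdiff)
    show "omega_dom - ?Q \<in> lmeasurable" using Q D by (intro fmeasurable.Diff)
    show "negligible (omega_dom - ?Q - level_set p \<phi> 1 t \<union> (level_set p \<phi> 1 t - (omega_dom - ?Q)))"
      by (rule negligible_subset[OF omega_dom_boundary_negligible]) (auto simp: level_set_def)
  qed
  also have "\<dots> = measure lebesgue omega_dom - measure lebesgue ?Q"
    by (rule measurable_measure_Diff) (use Q D in \<open>auto simp: fmeasurableD\<close>)
  finally show "measure lborel (level_set p \<phi> 1 t) = pi * (1 - distribution p \<phi> t)"
    by (simp add: conv distribution_def measure_omega_dom right_diff_distrib)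
qed

text \<open>The counts above and below n^2 t together are at most n + p, while their asymptotic
  lower bounds, divided by n, already add up to 1. So the count above cannot exceed its bound in the
  limit.\<close>

lemma eigenvalue_counting_limit:
  assumes \<phi>: "\<phi> \<in> C01" and p: "p \<ge> 1" and t: "t \<ge> 0"
  shows "(\<lambda>n. real (size {#l \<in># eigenvalues_L p \<phi> n. l > (real n)\<^sup>2 * t#}) / real n) \<longlonglongrightarrow> 1 - distribution p \<phi> t"
proof -
  define R where "R n = size {#l \<in># eigenvalues_L p \<phi> n. l > (real n)\<^sup>2 * t#}" for n
  define L where "L n = size {#l \<in># eigenvalues_L p \<phi> n. l < (real n)\<^sup>2 * t#}" for n
  have RL: "real (R n) + real (L n) \<le> real n + real p" if "n \<ge> 1" for n
  proof -
    have "R n + L n \<le> size (eigenvalues_L p \<phi> n)"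
    proof -
      have "{#l \<in># eigenvalues_L p \<phi> n. l > (real n)\<^sup>2 * t#} + {#l \<in># eigenvalues_L p \<phi> n. l < (real n)\<^sup>2 * t#} \<subseteq># eigenvalues_L p \<phi> n"
        by (rule mset_subset_eqI) auto
      then show ?thesis unfolding R_def L_def by (metis size_mset_mono size_union)
    qed
    then show ?thesis using size_eigenvalues_L[OF \<phi> that, of p] by linarith
  qed
  have lim: "(\<lambda>n. real (R n) * pi / real n) \<longlonglongrightarrow> pi * (1 - distribution p \<phi> t)"
  proof (rule order_tendstoI)
    fix c assume "c < pi * (1 - distribution p \<phi> t)"
    then show "\<forall>\<^sub>F n in sequentially. c < real (R n) * pi / real n"
      using eigenvalue_counting_liminf[OF \<phi> p t, of 1 c] by (simp add: measure_level_set[OF \<phi> p] R_def)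
  next
    fix c assume c: "c > pi * (1 - distribution p \<phi> t)"
    \<comment> \<open>Half of the excess is spent on the lower bound for the other count, half on
      the term p pi / n.\<close>
    define \<epsilon> where "\<epsilon> = (c - pi * (1 - distribution p \<phi> t)) / 2"
    have \<epsilon>: "\<epsilon> > 0" using c by (simp add: \<epsilon>_def)
    have "\<forall>\<^sub>F n in sequentially. pi * distribution p \<phi> t - \<epsilon> < real (L n) * pi / real n"
      using eigenvalue_counting_liminf[OF \<phi> p t, of "- 1" "pi * distribution p \<phi> t - \<epsilon>"] \<epsilon>
      by (simp add: measure_level_set[OF \<phi> p] L_def)
    moreover have "(\<lambda>n. real p * pi / real n) \<longlonglongrightarrow> 0"
      by (rule tendsto_divide_0[OF tendsto_const filterlim_at_top_imp_at_infinity[OF filterlim_real_sequentially]])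
    then have "\<forall>\<^sub>F n in sequentially. real p * pi / real n < \<epsilon>" by (rule order_tendstoD(2)) (rule \<epsilon>)
    ultimately show "\<forall>\<^sub>F n in sequentially. real (R n) * pi / real n < c"
      using eventually_ge_at_top[of "1::nat"]
    proof eventually_elim
      case (elim n)
      have "(real (R n) + real (L n)) * (pi / real n) \<le> (real n + real p) * (pi / real n)"
        using RL[OF elim(3)] by (intro mult_right_mono) auto
      then have "real (R n) * pi / real n + real (L n) * pi / real n \<le> pi + real p * pi / real n"
        using elim(3) by (simp add: distrib_right add_divide_distrib)
      moreover have "c = pi * (1 - distribution p \<phi> t) + 2 * \<epsilon>"
      proof -
        have "x = z + 2 * ((x - z) / 2)" for x z :: real by (simp add: field_simps)
        then show ?thesis unfolding \<epsilon>_def .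
      qed
      moreover have "pi * (1 - distribution p \<phi> t) = pi - pi * distribution p \<phi> t" by (simp add: right_diff_distrib)
      ultimately show ?case using elim by linarith
    qed
  qed
  have "(\<lambda>n. real (R n) * pi / real n / pi) \<longlonglongrightarrow> pi * (1 - distribution p \<phi> t) / pi"
    by (intro tendsto_intros lim) simp
  then show ?thesis by (simp add: R_def)
qed

section \<open>The monotone rearrangement\<close>

lemma omega_nonneg: "p \<ge> 1 \<Longrightarrow> omega p \<phi> z \<ge> 0"
  by (cases z) (simp add: omega_def e_symbol_nonneg)

text \<open>The range is a compact interval by connectedness of the rectangle; it begins at 0
  because e_p does, and it is nontrivial because e_p is positive at pi.\<close>

lemma omega_image:
  assumes \<phi>: "\<phi> \<in> C01" and p: "p \<ge> 1"
  obtains T where "T > 0" "omega p \<phi> ` omega_dom = {0..T}"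
proof -
  have "connected omega_dom" "compact omega_dom" by (auto intro!: connected_Times compact_Times)
  then have "connected (omega p \<phi> ` omega_dom)" "compact (omega p \<phi> ` omega_dom)"
    using continuous_on_omega_dom[OF \<phi>] by (auto intro: connected_continuous_image compact_continuous_image)
  then obtain a b where ab: "omega p \<phi> ` omega_dom = {a..b}" by (metis connected_compact_interval_1)
  have "omega p \<phi> (0, 0) = 0" by (simp add: omega_def e_symbol_0[OF p])
  then have "0 \<in> {a..b}" unfolding ab[symmetric] by (intro image_eqI[of _ _ "(0, 0)"]) auto
  moreover have "a \<ge> 0"
  proof -
    have "a \<in> omega p \<phi> ` omega_dom" using \<open>0 \<in> {a..b}\<close> unfolding ab by auto
    then show ?thesis using omega_nonneg[OF p] by auto
  qed
  ultimately have a: "a = 0" by auto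
  have "omega p \<phi> (0, pi) > 0"
    using e_symbol_pos[OF p, of pi] C01_dphi(2)[OF \<phi>, of 0] by (simp add: omega_def)
  moreover have "omega p \<phi> (0, pi) \<in> {a..b}" unfolding ab[symmetric] by (intro imageI) auto
  ultimately have "b > 0" by auto
  then show ?thesis using that[of b] ab a by simp
qed

lemma distribution_mono:
  assumes \<phi>: "\<phi> \<in> C01" and "s \<le> t"
  shows "distribution p \<phi> s \<le> distribution p \<phi> t"
  unfolding distribution_def
  by (intro divide_right_mono measure_mono_fmeasurable) (use assms lmeasurable_sublevel[OF \<phi>] in \<open>auto simp: fmeasurableD\<close>)

text \<open>Near a point with value m, omega stays between s and t. Even if that point is on the
  edge, its neighbourhood meets the open rectangle in a nonempty open set, which is not
  null.\<close>

lemma distribution_strict_mono: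
  assumes \<phi>: "\<phi> \<in> C01" and "s < t" and m: "m \<in> omega p \<phi> ` omega_dom" "s < m" "m < t"
  shows "distribution p \<phi> s < distribution p \<phi> t"
proof -
  define D where "D t = {z \<in> omega_dom. omega p \<phi> z \<le> t}" for t
  have D: "D t \<in> lmeasurable" for t unfolding D_def by (rule lmeasurable_sublevel[OF \<phi>])
  obtain z where z: "z \<in> omega_dom" "omega p \<phi> z = m" using m by auto
  have "openin (top_of_set omega_dom) (omega_dom \<inter> omega p \<phi> -` {s<..<t})"
    by (rule continuous_openin_preimage_gen[OF continuous_on_omega_dom[OF \<phi>] open_greaterThanLessThan])
  then obtain V where V: "open V" "omega_dom \<inter> omega p \<phi> -` {s<..<t} = omega_dom \<inter> V"
    unfolding openin_open by blast
  have zV: "z \<in> V" using z m V by auto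
  have "box (0::real, 0::real) (1, pi) \<noteq> {}" by (simp add: box_ne_empty Basis_prod_def)
  then have "z \<in> closure (box (0, 0) (1, pi))"
    using z(1) omega_dom_eq_cbox closure_box[of "(0::real, 0::real)" "(1, pi)"] by simp
  then have ne: "V \<inter> box (0, 0) (1, pi) \<noteq> {}" using V(1) zV open_Int_closure_eq_empty by blast
  have oV: "open (V \<inter> box (0, 0) (1, pi))" using V(1) by (intro open_Int open_box)
  have sub: "V \<inter> box (0, 0) (1, pi) \<subseteq> D t - D s"
  proof
    fix w assume w: "w \<in> V \<inter> box (0, 0) (1, pi)"
    then have "w \<in> omega_dom" using box_subset_cbox[of "(0::real, 0::real)" "(1, pi)"] omega_dom_eq_cbox by auto
    with w V(2) have "w \<in> omega_dom \<inter> omega p \<phi> -` {s<..<t}" by blast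
    then show "w \<in> D t - D s" by (auto simp: D_def)
  qed
  have "\<not> negligible (D t - D s)"
    using open_not_negligible[OF oV ne] negligible_subset[OF _ sub] by blast
  then have "measure lebesgue (D t - D s) \<noteq> 0"
    using D negligible_iff_measure[of "D t - D s"] by (auto intro: fmeasurable.Diff)
  then have "measure lebesgue (D t - D s) > 0" by (simp add: zero_less_measure_iff)
  moreover have "measure lebesgue (D t - D s) = measure lebesgue (D t) - measure lebesgue (D s)"
    by (rule measurable_measure_Diff) (use D \<open>s < t\<close> in \<open>auto simp: fmeasurableD D_def\<close>)
  ultimately show ?thesis unfolding distribution_def D_def[symmetric] by (simp add: divide_strict_right_mono)
qed

text \<open>Continuity of the measure along decreasing sets, phrased with a bound c because the
  quantile argument uses it that way.\<close>

lemma distribution_right_continuous: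
  assumes \<phi>: "\<phi> \<in> C01" and c: "distribution p \<phi> t < c"
  shows "\<exists>s>t. distribution p \<phi> s < c"
proof -
  define D where "D t = {z \<in> omega_dom. omega p \<phi> z \<le> t}" for t
  have D: "D t \<in> lmeasurable" for t unfolding D_def by (rule lmeasurable_sublevel[OF \<phi>])
  have "(\<lambda>k. measure lebesgue (D (t + 1 / real (Suc k)))) \<longlonglongrightarrow> measure lebesgue (\<Inter>k. D (t + 1 / real (Suc k)))"
  proof (rule Lim_measure_decseq)
    show "range (\<lambda>k. D (t + 1 / real (Suc k))) \<subseteq> sets lebesgue" using D by (auto simp: fmeasurableD)
    show "decseq (\<lambda>k. D (t + 1 / real (Suc k)))"
      unfolding decseq_def D_def by (auto simp: frac_le intro: order_trans add_left_mono)
    show "emeasure lebesgue (D (t + 1 / real (Suc i))) \<noteq> \<infinity>" for i using D[of "t + 1 / real (Suc i)"] by (auto simp: fmeasurable_def)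
  qed
  also have "(\<Inter>k. D (t + 1 / real (Suc k))) = D t"
  proof
    show "(\<Inter>k. D (t + 1 / real (Suc k))) \<subseteq> D t"
    proof
      fix z assume z: "z \<in> (\<Inter>k. D (t + 1 / real (Suc k)))"
      have "omega p \<phi> z \<le> t"
      proof (rule field_le_epsilon)
        fix e :: real assume "e > 0"
        then obtain k where "1 / real (Suc k) < e" using nat_approx_posE by metis
        moreover have "omega p \<phi> z \<le> t + 1 / real (Suc k)" using z by (simp add: D_def)
        ultimately show "omega p \<phi> z \<le> t + e" by linarith
      qed
      then show "z \<in> D t" using z by (simp add: D_def)
    qed
    show "D t \<subseteq> (\<Inter>k. D (t + 1 / real (Suc k)))" by (auto simp: D_def intro: add_increasing2)
  qed
  finally have "(\<lambda>k. measure lebesgue (D (t + 1 / real (Suc k))) / pi) \<longlonglongrightarrow> measure lebesgue (D t) / pi"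
    by (intro tendsto_intros) auto
  then have "\<forall>\<^sub>F k in sequentially. measure lebesgue (D (t + 1 / real (Suc k))) / pi < c"
    by (rule order_tendstoD(2)) (use c in \<open>simp add: distribution_def D_def\<close>)
  then obtain k where "measure lebesgue (D (t + 1 / real (Suc k))) / pi < c" by (auto simp: eventually_sequentially)
  then have "distribution p \<phi> (t + 1 / real (Suc k)) < c" by (simp add: distribution_def D_def)
  then show ?thesis by (intro exI[of _ "t + 1 / real (Suc k)"]) auto
qed

text \<open>The increasing sets exhaust only {omega < t}; what is missing lies in a level set, which
  is null.\<close>

lemma distribution_left_continuous:
  assumes \<phi>: "\<phi> \<in> C01" and p: "p \<ge> 1" and c: "c < distribution p \<phi> t"
  shows "\<exists>s<t. c < distribution p \<phi> s"
proof -
  define D where "D t = {z \<in> omega_dom. omega p \<phi> z \<le> t}" for t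
  have D: "D t \<in> lmeasurable" for t unfolding D_def by (rule lmeasurable_sublevel[OF \<phi>])
  define D' where "D' = (\<Union>k. D (t - 1 / real (Suc k)))"
  have sub: "D' \<subseteq> D t"
    unfolding D'_def D_def by (auto intro: order_trans[of _ "t - _"])
  have "(\<lambda>k. measure lebesgue (D (t - 1 / real (Suc k)))) \<longlonglongrightarrow> measure lebesgue D'"
    unfolding D'_def
  proof (rule Lim_measure_incseq)
    show "range (\<lambda>k. D (t - 1 / real (Suc k))) \<subseteq> sets lebesgue" using D by (auto simp: fmeasurableD)
    show "incseq (\<lambda>k. D (t - 1 / real (Suc k)))"
      unfolding incseq_def D_def by (auto simp: frac_le intro: order_trans diff_left_mono)
    have "emeasure lebesgue D' \<le> emeasure lebesgue (D t)" by (rule emeasure_mono[OF sub]) (use D in \<open>auto simp: fmeasurableD\<close>)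
    then show "emeasure lebesgue (\<Union>k. D (t - 1 / real (Suc k))) \<noteq> \<infinity>"
      using D[of t] by (auto simp: fmeasurable_def D'_def top_unique)
  qed
  also have "measure lebesgue D' = measure lebesgue (D t)"
  proof (rule measure_negligible_symdiff[OF D])
    have "D t - D' \<subseteq> {z \<in> omega_dom. omega p \<phi> z = t}"
    proof
      fix z assume z: "z \<in> D t - D'"
      have "\<not> omega p \<phi> z < t"
      proof
        assume "omega p \<phi> z < t"
        then obtain k where "1 / real (Suc k) < t - omega p \<phi> z" using nat_approx_posE[of "t - omega p \<phi> z"] by auto
        then have "z \<in> D (t - 1 / real (Suc k))" using z by (auto simp: D_def)
        then show False using z by (auto simp: D'_def)
      qed
      then show "z \<in> {z \<in> omega_dom. omega p \<phi> z = t}" using z by (auto simp: D_def)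
    qed
    then have "negligible (D t - D')" using negligible_omega_level[OF \<phi> p] negligible_subset by blast
    moreover have "D' - D t = {}" using sub by blast
    ultimately show "negligible (D t - D' \<union> (D' - D t))" by simp
  qed
  finally have "(\<lambda>k. measure lebesgue (D (t - 1 / real (Suc k))) / pi) \<longlonglongrightarrow> measure lebesgue (D t) / pi"
    by (intro tendsto_intros) auto
  then have "\<forall>\<^sub>F k in sequentially. c < measure lebesgue (D (t - 1 / real (Suc k))) / pi"
    by (rule order_tendstoD(1)) (use c in \<open>simp add: distribution_def D_def\<close>)
  then obtain k where "c < measure lebesgue (D (t - 1 / real (Suc k))) / pi" by (auto simp: eventually_sequentially)
  then have "c < distribution p \<phi> (t - 1 / real (Suc k))" by (simp add: distribution_def D_def)
  then show ?thesis by (intro exI[of _ "t - 1 / real (Suc k)"]) auto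
qed

(* For G the distribution function of \<omega>, r is the monotone rearrangement of \<omega>. *)
lemma quantile_inverse:
  fixes G :: "real \<Rightarrow> real" and T :: real
  assumes T: "T > 0" and strict: "\<And>s t. 0 \<le> s \<Longrightarrow> s < t \<Longrightarrow> t \<le> T \<Longrightarrow> G s < G t"
    and G0: "G 0 = 0" and GT: "G T = 1"
    and right: "\<And>t c. G t < c \<Longrightarrow> \<exists>s>t. G s < c" and left: "\<And>t c. c < G t \<Longrightarrow> \<exists>s<t. c < G s"
    and mono: "\<And>s t. s \<le> t \<Longrightarrow> G s \<le> G t"
  defines "q \<equiv> \<lambda>x. Inf {y \<in> {0..T}. G y > x}"
  defines "r \<equiv> \<lambda>x. if x = 0 then Lim (at_right 0) q else if x = 1 then Lim (at_left 1) q else q x"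
  shows "\<And>x. x \<in> {0..1} \<Longrightarrow> r x \<in> {0..T} \<and> G (r x) = x" and "\<And>t. t \<in> {0..T} \<Longrightarrow> r (G t) = t"
proof -
  have bdd: "bdd_below {y \<in> {0..T}. G y > x}" for x by (rule bdd_belowI[of _ 0]) auto
  have ne: "T \<in> {y \<in> {0..T}. G y > x}" if "x < 1" for x using T GT that by auto
  have q_range: "q x \<in> {0..T}" if "x < 1" for x
  proof -
    have "q x \<le> T" unfolding q_def by (rule cInf_lower[OF ne[OF that] bdd])
    moreover have "q x \<ge> 0" unfolding q_def by (rule cInf_greatest) (use ne[OF that] in auto)
    ultimately show ?thesis by simp
  qed
  have q_upper: "q x \<le> y" if "y \<in> {0..T}" "G y > x" for x y
    unfolding q_def by (rule cInf_lower[OF _ bdd]) (use that in auto)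
  have q_lower: "y \<le> q x" if "x < 1" "G y \<le> x" for x y
    unfolding q_def
  proof (rule cInf_greatest)
    show "{y \<in> {0..T}. x < G y} \<noteq> {}" using ne[OF that(1)] by auto
    fix w assume w: "w \<in> {y \<in> {0..T}. x < G y}"
    show "y \<le> w"
    proof (rule ccontr)
      assume "\<not> y \<le> w"
      then have "G w \<le> G y" by (intro mono) simp
      with w that show False by simp
    qed
  qed
  \<comment> \<open>At the infimum, left continuity excludes a value above x and right continuity a
    value below x.\<close>
  have Gq: "G (q x) = x" if x: "0 < x" "x < 1" for x
  proof (rule antisym)
    show "G (q x) \<le> x"
    proof (rule ccontr)
      assume "\<not> G (q x) \<le> x"
      then obtain s where s: "s < q x" "x < G s" using left[of x "q x"] by auto
      have "s > 0"
      proof (rule ccontr)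
        assume "\<not> s > 0"
        then have "G s \<le> G 0" by (intro mono) simp
        with s x G0 show False by simp
      qed
      then have "q x \<le> s" using s q_range[OF x(2)] by (intro q_upper) auto
      with s show False by simp
    qed
    show "x \<le> G (q x)"
    proof (rule ccontr)
      assume "\<not> x \<le> G (q x)"
      then obtain s where s: "s > q x" "G s < x" using right[of "q x" x] by auto
      then have "s \<le> q x" using x by (intro q_lower) auto
      with s show False by simp
    qed
  qed
  have r0: "r 0 = 0"
  proof -
    have "(q \<longlongrightarrow> 0) (at_right 0)"
    proof (rule order_tendstoI)
      fix a :: real assume "a < 0"
      moreover have "\<forall>\<^sub>F x in at_right (0::real). x < 1" by (rule eventually_at_rightI[of 0 1]) auto
      ultimately show "\<forall>\<^sub>F x in at_right 0. a < q x"
        by (auto elim!: eventually_mono dest: q_range)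
    next
      fix a :: real assume a: "a > 0"
      define y where "y = min (a / 2) T"
      have y: "0 < y" "y < a" "y \<le> T" using a T by (auto simp: y_def)
      have "G y > 0" using strict[of 0 y] y G0 by simp
      then have "\<forall>\<^sub>F x in at_right 0. x < G y" by (intro eventually_at_rightI[of 0 "G y"]) auto
      then show "\<forall>\<^sub>F x in at_right 0. q x < a"
      proof eventually_elim
        case (elim x)
        then have "q x \<le> y" using y by (intro q_upper) auto
        then show ?case using y by simp
      qed
    qed
    then have "Lim (at_right 0) q = 0" by (rule tendsto_Lim[OF trivial_limit_at_right_real])
    then show ?thesis by (simp add: r_def)
  qed
  have r1: "r 1 = T"
  proof -
    have lt1: "\<forall>\<^sub>F x in at_left (1::real). x < 1" by (intro eventually_at_leftI[of 0]) auto
    have "(q \<longlongrightarrow> T) (at_left 1)"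
    proof (rule order_tendstoI)
      fix a :: real assume a: "a > T"
      show "\<forall>\<^sub>F x in at_left 1. q x < a"
        using lt1
      proof eventually_elim
        case (elim x)
        then show ?case using q_range[of x] a by auto
      qed
    next
      fix a :: real assume a: "a < T"
      define y where "y = max ((a + T) / 2) 0"
      have y: "a < y" "0 \<le> y" "y < T" using a T by (auto simp: y_def max_def)
      have "G y < 1" using strict[of y T] y GT by simp
      then have "\<forall>\<^sub>F x in at_left 1. G y < x \<and> x < 1" by (intro eventually_at_leftI[of "G y"]) auto
      then show "\<forall>\<^sub>F x in at_left 1. a < q x"
      proof eventually_elim
        case (elim x)
        then have "y \<le> q x" by (intro q_lower) auto
        then show ?case using y by simp
      qed
    qed
    then have "Lim (at_left 1) q = T" by (rule tendsto_Lim[OF trivial_limit_at_left_real])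
    then show ?thesis by (simp add: r_def)
  qed
  show r: "r x \<in> {0..T} \<and> G (r x) = x" if x01: "x \<in> {0..1}" for x
  proof -
    consider "x = 0" | "x = 1" | "0 < x" "x < 1" using x01 by fastforce
    then show ?thesis
    proof cases
      case 3
      then have "r x = q x" by (simp add: r_def)
      then show ?thesis using q_range[of x] Gq[of x] 3 by simp
    qed (use r0 r1 G0 GT T in auto)
  qed
  show "r (G t) = t" if t: "t \<in> {0..T}" for t
  proof -
    have "G t \<in> {0..1}" using mono[of 0 t] mono[of t T] t G0 GT by auto
    then have rr: "r (G t) \<in> {0..T}" "G (r (G t)) = G t" using r by auto
    show ?thesis
    proof (rule ccontr)
      assume "r (G t) \<noteq> t"
      then consider "r (G t) < t" | "t < r (G t)" by linarith
      then show False
        using strict[of "r (G t)" t] strict[of t "r (G t)"] rr t by cases auto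
    qed
  qed
qed

text \<open>On the range of omega the distribution function is continuous and strictly increasing,
  so its quantile function \<open>xi\<close> is its genuine inverse. Taking the square root only
  replaces t by y^2.\<close>

lemma sqrt_xi_inv_eq:
  assumes \<phi>: "\<phi> \<in> C01" and p: "p \<ge> 1" and y: "y \<in> (\<lambda>z. sqrt (omega p \<phi> z)) ` omega_dom"
  shows "sqrt_xi_inv p \<phi> y = distribution p \<phi> (y\<^sup>2)"
proof -
  obtain T where T: "T > 0" "omega p \<phi> ` omega_dom = {0..T}" using omega_image[OF \<phi> p] .
  let ?G = "distribution p \<phi>"
  have strict: "?G s < ?G t" if "0 \<le> s" "s < t" "t \<le> T" for s t
    using that T(2) by (intro distribution_strict_mono[OF \<phi>, of s t "(s + t) / 2"]) auto
  have mono: "?G s \<le> ?G t" if "s \<le> t" for s t by (rule distribution_mono[OF \<phi> that])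
  have G0: "?G 0 = 0"
  proof -
    have "{z \<in> omega_dom. omega p \<phi> z \<le> 0} = {z \<in> omega_dom. omega p \<phi> z = 0}"
      using omega_nonneg[OF p] by (auto intro: antisym)
    then show ?thesis
      using negligible_omega_level[OF \<phi> p, of 0] negligible_imp_measure0 by (simp add: distribution_def)
  qed
  have GT: "?G T = 1"
  proof -
    have "omega p \<phi> z \<le> T" if "z \<in> omega_dom" for z
      using imageI[OF that, of "omega p \<phi>"] unfolding T(2) by simp
    then have "{z \<in> omega_dom. omega p \<phi> z \<le> T} = omega_dom" by blast
    then show ?thesis by (simp add: distribution_def measure_omega_dom del: mem_Times_iff)
  qed
  have xi_int: "xi_interior p \<phi> = (\<lambda>x. Inf {y \<in> {0..T}. ?G y > x})"
    unfolding xi_interior_def T(2) distribution_def by (simp add: less_divide_eq mult.commute)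
  have xi: "xi p \<phi> = (\<lambda>x. if x = 0 then Lim (at_right 0) (\<lambda>x. Inf {y \<in> {0..T}. ?G y > x})
      else if x = 1 then Lim (at_left 1) (\<lambda>x. Inf {y \<in> {0..T}. ?G y > x}) else Inf {y \<in> {0..T}. ?G y > x})"
    by (rule ext) (simp add: xi_def xi_int)
  note facts = strict G0 GT distribution_right_continuous[OF \<phi>] distribution_left_continuous[OF \<phi> p] mono
  have q1: "xi p \<phi> x \<in> {0..T} \<and> ?G (xi p \<phi> x) = x" if "x \<in> {0..1}" for x
    unfolding xi by (rule quantile_inverse(1)[of T ?G, OF T(1)]) (assumption | rule facts that)+
  have q2: "xi p \<phi> (?G t) = t" if "t \<in> {0..T}" for t
    unfolding xi by (rule quantile_inverse(2)[of T ?G, OF T(1)]) (assumption | rule facts that)+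
  obtain z where z: "z \<in> omega_dom" "y = sqrt (omega p \<phi> z)" using y by auto
  have y2: "y\<^sup>2 \<in> {0..T}" "y \<ge> 0"
    using z omega_nonneg[OF p, of \<phi> z] imageI[OF z(1), of "omega p \<phi>"] unfolding T(2) by auto
  have inj: "inj_on (\<lambda>x. sqrt (xi p \<phi> x)) {0..1}"
  proof (rule inj_onI)
    fix x x' assume "x \<in> {0..1}" "x' \<in> {0..1}" "sqrt (xi p \<phi> x) = sqrt (xi p \<phi> x')"
    then show "x = x'" using q1[of x] q1[of x'] by (metis real_sqrt_eq_iff)
  qed
  have "?G (y\<^sup>2) \<in> {0..1}" using mono[of 0 "y\<^sup>2"] mono[of "y\<^sup>2" T] y2 G0 GT by auto
  moreover have "sqrt (xi p \<phi> (?G (y\<^sup>2))) = y" using q2[OF y2(1)] y2(2) by simp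
  ultimately show ?thesis unfolding sqrt_xi_inv_def by (intro the_inv_into_f_eq[OF inj])
qed

section \<open>Eigenvalue counts in intervals and the comparison of neighbouring cells\<close>

lemma num_eigenvalues_eq:
  assumes n: "n \<ge> 1" and uv: "0 \<le> u" "u \<le> v"
  shows "real (num_eigenvalues p \<phi> n u v) =
    real (size {#l \<in># eigenvalues_L p \<phi> n. l > (real n)\<^sup>2 * u\<^sup>2#}) - real (size {#l \<in># eigenvalues_L p \<phi> n. l > (real n)\<^sup>2 * v\<^sup>2#})"
proof -
  let ?E = "eigenvalues_L p \<phi> n"
  have n2: "(real n)\<^sup>2 > 0" using n by simp
  \<comment> \<open>\<open>sqrt\<close> is strictly increasing on all reals, negative ones included,
    so the sign of l is irrelevant.\<close>
  have 1: "u < sqrt (l / (real n)\<^sup>2) \<longleftrightarrow> (real n)\<^sup>2 * u\<^sup>2 < l" for l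
  proof -
    have "u < sqrt (l / (real n)\<^sup>2) \<longleftrightarrow> sqrt (u\<^sup>2) < sqrt (l / (real n)\<^sup>2)" using uv by simp
    also have "\<dots> \<longleftrightarrow> (real n)\<^sup>2 * u\<^sup>2 < l" using n2 by (simp only: real_sqrt_less_iff less_divide_eq if_True mult.commute)
    finally show ?thesis .
  qed
  have 2: "sqrt (l / (real n)\<^sup>2) \<le> v \<longleftrightarrow> \<not> (real n)\<^sup>2 * v\<^sup>2 < l" for l
  proof -
    have "sqrt (l / (real n)\<^sup>2) \<le> v \<longleftrightarrow> sqrt (l / (real n)\<^sup>2) \<le> sqrt (v\<^sup>2)" using uv by simp
    also have "\<dots> \<longleftrightarrow> l \<le> (real n)\<^sup>2 * v\<^sup>2" using n2 by (simp only: real_sqrt_le_iff divide_le_eq if_True mult.commute)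
    finally show ?thesis by auto
  qed
  have uv2: "(real n)\<^sup>2 * u\<^sup>2 \<le> (real n)\<^sup>2 * v\<^sup>2" using uv by (intro mult_left_mono power_mono) auto
  have "{#l \<in># ?E. l > (real n)\<^sup>2 * u\<^sup>2#} =
    {#l \<in># ?E. u < sqrt (l / (real n)\<^sup>2) \<and> sqrt (l / (real n)\<^sup>2) \<le> v#} + {#l \<in># ?E. l > (real n)\<^sup>2 * v\<^sup>2#}"
    by (rule multiset_eqI) (use uv2 in \<open>auto simp: 1 2\<close>)
  then show ?thesis unfolding num_eigenvalues_def by simp
qed

lemma num_eigenvalues_limit:
  assumes \<phi>: "\<phi> \<in> C01" and p: "p \<ge> 1" and uv: "0 \<le> u" "u \<le> v"
  shows "(\<lambda>n. real (num_eigenvalues p \<phi> n u v) / real n) \<longlonglongrightarrow> distribution p \<phi> (v\<^sup>2) - distribution p \<phi> (u\<^sup>2)"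
proof -
  have "(\<lambda>n. real (size {#l \<in># eigenvalues_L p \<phi> n. l > (real n)\<^sup>2 * u\<^sup>2#}) / real n -
      real (size {#l \<in># eigenvalues_L p \<phi> n. l > (real n)\<^sup>2 * v\<^sup>2#}) / real n)
    \<longlonglongrightarrow> (1 - distribution p \<phi> (u\<^sup>2)) - (1 - distribution p \<phi> (v\<^sup>2))"
    by (intro tendsto_diff eigenvalue_counting_limit[OF \<phi> p]) auto
  moreover have "\<forall>\<^sub>F n in sequentially. real (size {#l \<in># eigenvalues_L p \<phi> n. l > (real n)\<^sup>2 * u\<^sup>2#}) / real n -
      real (size {#l \<in># eigenvalues_L p \<phi> n. l > (real n)\<^sup>2 * v\<^sup>2#}) / real n = real (num_eigenvalues p \<phi> n u v) / real n"
    using eventually_ge_at_top[of "1::nat"]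
    by eventually_elim (simp add: num_eigenvalues_eq[OF _ uv] diff_divide_distrib)
  ultimately show ?thesis by (simp add: tendsto_cong)
qed

lemma num_eigenvalues_eventually_less:
  assumes \<phi>: "\<phi> \<in> C01" and p: "p \<ge> 1" and uv: "0 \<le> u" "u \<le> v" and st: "0 \<le> s" "s \<le> t"
    and lt: "distribution p \<phi> (v\<^sup>2) - distribution p \<phi> (u\<^sup>2) < distribution p \<phi> (t\<^sup>2) - distribution p \<phi> (s\<^sup>2)"
  shows "\<forall>\<^sub>F n in sequentially. num_eigenvalues p \<phi> n u v < num_eigenvalues p \<phi> n s t"
proof -
  obtain c where c: "distribution p \<phi> (v\<^sup>2) - distribution p \<phi> (u\<^sup>2) < c" "c < distribution p \<phi> (t\<^sup>2) - distribution p \<phi> (s\<^sup>2)"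
    using lt dense by blast
  from order_tendstoD(2)[OF num_eigenvalues_limit[OF \<phi> p uv] c(1)]
    order_tendstoD(1)[OF num_eigenvalues_limit[OF \<phi> p st] c(2)] eventually_ge_at_top[of "1::nat"]
  show ?thesis
  proof eventually_elim
    case (elim n)
    then have "real (num_eigenvalues p \<phi> n u v) / real n < real (num_eigenvalues p \<phi> n s t) / real n" by linarith
    then show ?case using elim by (simp add: divide_less_cancel)
  qed
qed

theorem proposition3p2:
  fixes p r :: nat and \<phi> :: "real \<Rightarrow> real" and a b :: real and y :: "nat \<Rightarrow> real"
  assumes "p \<ge> 1" and "\<phi> \<in> C01"
    and "a < b" and "{a..b} \<subseteq> (\<lambda>z. sqrt (omega p \<phi> z)) ` omega_dom"
    and "C2_on {a..b} (sqrt_xi_inv p \<phi>)"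
    and "r \<ge> 1" and "\<And>i. i \<le> r \<Longrightarrow> y i = a + real i / real r * (b - a)"
  shows "\<forall>\<^sub>F n in sequentially.
    (strictly_convex_on {a..b} (sqrt_xi_inv p \<phi>) \<longrightarrow>
      (\<forall>i\<in>{1..r - 1}.
        num_eigenvalues p \<phi> n (y (i - 1)) (y i) < num_eigenvalues p \<phi> n (y i) (y (i + 1)))) \<and>
    (strictly_concave_on {a..b} (sqrt_xi_inv p \<phi>) \<longrightarrow>
      (\<forall>i\<in>{1..r - 1}.
        num_eigenvalues p \<phi> n (y (i - 1)) (y i) > num_eigenvalues p \<phi> n (y i) (y (i + 1))))"
proof -
  let ?F = "sqrt_xi_inv p \<phi>" and ?G = "\<lambda>u. distribution p \<phi> (u\<^sup>2)"
  have F: "?F u = ?G u" if "u \<in> {a..b}" for u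
    using sqrt_xi_inv_eq[OF assms(2,1)] assms(4) that by blast
  have a0: "a \<ge> 0"
  proof -
    have "a \<in> {a..b}" using assms(3) by simp
    then obtain z where "a = sqrt (omega p \<phi> z)" using assms(4) by blast
    then show ?thesis using omega_nonneg[OF assms(1), of \<phi> z] by simp
  qed
  have r0: "real r > 0" using assms(6) by simp
  have y: "y i \<in> {a..b}" if "i \<le> r" for i
  proof -
    have "0 \<le> real i / real r" "real i / real r \<le> 1" using that r0 by auto
    then have "0 \<le> real i / real r * (b - a)" "real i / real r * (b - a) \<le> 1 * (b - a)"
      using assms(3) by (intro mult_nonneg_nonneg mult_right_mono; simp)+
    then show ?thesis using assms(7)[OF that] by simp
  qed
  \<comment> \<open>Equal spacing makes y i the midpoint of its neighbours, so strict convexity or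
    concavity with weight 1 / 2 compares consecutive increments of F.\<close>
  have mid: "0 \<le> y (i - 1)" "y (i - 1) < y i" "0 \<le> y i" "y i < y (i + 1)"
    "y i = (1 - 1 / 2) * y (i - 1) + 1 / 2 * y (i + 1)"
    "y (i - 1) \<in> {a..b}" "y i \<in> {a..b}" "y (i + 1) \<in> {a..b}" if i: "i \<in> {1..r - 1}" for i
  proof -
    have ir: "i - 1 \<le> r" "i \<le> r" "i + 1 \<le> r" using i by auto
    show in_ab: "y (i - 1) \<in> {a..b}" "y i \<in> {a..b}" "y (i + 1) \<in> {a..b}" using y ir by auto
    define h where "h = (b - a) / real r"
    have h: "h > 0" using assms(3) r0 by (simp add: h_def)
    have yh: "y j = a + real j * h" if "j \<le> r" for j using assms(7)[OF that] by (simp add: h_def)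
    have "real (i - 1) = real i - 1" using i by (simp add: of_nat_diff)
    then have e: "y (i - 1) = y i - h" "y (i + 1) = y i + h"
      using yh ir by (simp_all add: algebra_simps)
    then show "y (i - 1) < y i" "y i < y (i + 1)" "y i = (1 - 1 / 2) * y (i - 1) + 1 / 2 * y (i + 1)"
      using h by (auto simp: field_simps)
    show "0 \<le> y (i - 1)" "0 \<le> y i" using in_ab a0 by auto
  qed
  have convex: "\<forall>\<^sub>F n in sequentially. \<forall>i\<in>{1..r - 1}.
      num_eigenvalues p \<phi> n (y (i - 1)) (y i) < num_eigenvalues p \<phi> n (y i) (y (i + 1))"
    if "strictly_convex_on {a..b} ?F"
  \<comment> \<open>There are finitely many i, so one threshold for n serves them all.\<close>
  proof (rule eventually_ball_finite)
    show "\<forall>i\<in>{1..r - 1}. \<forall>\<^sub>F n in sequentially.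
      num_eigenvalues p \<phi> n (y (i - 1)) (y i) < num_eigenvalues p \<phi> n (y i) (y (i + 1))"
    proof
      fix i assume i: "i \<in> {1..r - 1}"
      note m = mid[OF i]
      have "?F ((1 - 1 / 2) * y (i - 1) + 1 / 2 * y (i + 1)) < (1 - 1 / 2) * ?F (y (i - 1)) + 1 / 2 * ?F (y (i + 1))"
        by (rule that[unfolded strictly_convex_on_def, rule_format]) (use m in auto)
      then have "?G (y i) - ?G (y (i - 1)) < ?G (y (i + 1)) - ?G (y i)"
        unfolding m(5)[symmetric] F[OF m(6)] F[OF m(7)] F[OF m(8)] by simp
      then show "\<forall>\<^sub>F n in sequentially.
        num_eigenvalues p \<phi> n (y (i - 1)) (y i) < num_eigenvalues p \<phi> n (y i) (y (i + 1))"
        using m by (intro num_eigenvalues_eventually_less[OF assms(2,1)]) auto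
    qed
  qed simp
  have concave: "\<forall>\<^sub>F n in sequentially. \<forall>i\<in>{1..r - 1}.
      num_eigenvalues p \<phi> n (y (i - 1)) (y i) > num_eigenvalues p \<phi> n (y i) (y (i + 1))"
    if "strictly_concave_on {a..b} ?F"
  proof (rule eventually_ball_finite)
    show "\<forall>i\<in>{1..r - 1}. \<forall>\<^sub>F n in sequentially.
      num_eigenvalues p \<phi> n (y (i - 1)) (y i) > num_eigenvalues p \<phi> n (y i) (y (i + 1))"
    proof
      fix i assume i: "i \<in> {1..r - 1}"
      note m = mid[OF i]
      have "?F ((1 - 1 / 2) * y (i - 1) + 1 / 2 * y (i + 1)) > (1 - 1 / 2) * ?F (y (i - 1)) + 1 / 2 * ?F (y (i + 1))"
        by (rule that[unfolded strictly_concave_on_def, rule_format]) (use m in auto)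
      then have "?G (y (i + 1)) - ?G (y i) < ?G (y i) - ?G (y (i - 1))"
        unfolding m(5)[symmetric] F[OF m(6)] F[OF m(7)] F[OF m(8)] by simp
      then show "\<forall>\<^sub>F n in sequentially.
        num_eigenvalues p \<phi> n (y (i - 1)) (y i) > num_eigenvalues p \<phi> n (y i) (y (i + 1))"
        using m by (intro num_eigenvalues_eventually_less[OF assms(2,1)]) auto
    qed
  qed simp
  \<comment> \<open>Convexity and concavity do not involve n, so a case distinction outside
    \<open>eventually\<close> resolves both implications.\<close>
  show ?thesis
    by (rule eventually_conj) (cases "strictly_convex_on {a..b} ?F"; cases "strictly_concave_on {a..b} ?F";
      use convex concave in simp)+
qed

end
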